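(* Let $k \geq 3$, $t \in \mathbb N$ and $\beta > 0$, and let $b(n)$ be a function with $b(n)=o(n)$. Then for every $\rho>0$ there is $n_0\in\mathbb N$ such that the following holds for every $n\ge n_0$: if $G$ is an $r$-regular $k$-partite $k$-graph with vertex partition $\mathcal Z$ in which each part has order $n$, and $G$ satisfies $\mathrm{Reg}(t)$, $\mathrm{Exp}_1(\alpha_{k,t})$, $\mathrm{Exp}_2(\beta)$ and $\mathrm{Def}(b(n))$, then \[ |\mathcal I(G)| = (1\pm\rho)\cdot 2^{(k-1)n}\cdot\sum_{Z\in\mathcal Z}\exp\left(\sum_{m=1}^t \sum_{\substack{\Gamma\in\mathcal C_{Z,t}\\ \|\Gamma\|=m}} w(\Gamma)\right), \] where $x = (1\pm\rho)y$ means $(1-\rho)y\le x\le(1+\rho)y$.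
   Context: A $k$-graph is a hypergraph each of whose edges has exactly $k$ vertices; it is $k$-partite if its vertex set can be partitioned into $k$ classes such that every edge contains exactly one vertex of each class; $r$-regular if every vertex lies in exactly $r$ edges. An independent set of a hypergraph is a vertex set containing no edge; $\mathcal I(G)$ is the set of independent sets of $G$. For $S\subseteq V(G)$, $N(S)=N_G(S):=\big(\bigcup_{e\in E(G),\,e\cap S\ne\emptyset}e\big)\setminus S$. $\gamma_k:=\frac{2^{k-1}}{2^{k-1}-1}$, $\log$ is natural. For an $r$-regular $k$-partite $k$-graph with vertex partition $\mathcal Z$, parts of order $n$: $\mathrm{Reg}(t)$: $r\ge\frac1t\log_{\gamma_k}n$. $\mathrm{Exp}_1(\alpha)$: for all $Z\in\mathcal Z$, $S\subset Z$ with $|S|\le r$: $|N(S)|\ge(k-1-\alpha)r|S|$. $\mathrm{Exp}_2(\beta)$: for all $Z\in\mathcal Z$, $S\subset Z$ with $|S|\le\beta\frac nr$: $|N(S)|\ge(k-2+\beta)r|S|$. $\mathrm{Def}(b)$: every $I\in\mathcal I(G)$ has some $Z\in\mathcal Z$ with $|I\cap Z|\le b$. Also $\alpha_{k,t}:=\frac12\min\{\frac{\log_2\gamma_k}{e^{2t}},\ \frac{(k-1)(1-\log2)\log\gamma_k}{\log(2^{k-1}-1)+\log\gamma_k}\}$. Polymer model: For a partition class $Z$, let $Z_2$ be the graph on $Z$ with $vu$ an edge iff $v\neq u$ and $N_G(\{v\})\cap N_G(\{u\})\ne\emptyset$; a nonempty $S\subseteq Z$ is $2$-linked if $Z_2[S]$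 is connected. For $S$ contained in one partition class, the link graph $L_G(S)$ is the $(k-1)$-graph on vertex set $N_G(S)$ with edge set $\{e\setminus S: e\in E(G),\ e\cap S\ne\emptyset\}$. For $b\in\mathbb N$, the polymers are $\mathcal P_{Z,b}:=\{S\subset Z: S \text{ is 2-linked and } 1\le|S|\le b\}$; two polymers $S,T$ are compatible ($S\sim T$) iff $N_G(S)\cap N_G(T)=\emptyset$, and incompatible ($S\nsim T$) otherwise; the weight of a polymer is $w(S):=|\mathcal I(L_G(S))|\cdot 2^{-|N_G(S)|}$. For a nonempty finite vector (ordered tuple) $\Gamma$ of not necessarily distinct polymers, its incompatibility graph $H_\Gamma$ has the entries of $\Gamma$ as vertices, with two entries $S,T$ adjacent iff $S\nsim T$. A cluster is such a vector with $H_\Gamma$ connected; $\mathcal C_{Z,b}$ is the set of all clusters with polymers from $\mathcal P_{Z,b}$. The size is $\|\Gamma\|:=\sum_{S\in\Gamma}|S|$. The Ursell function of a connected graph $H$ is $\phi(H):=\frac{1}{|V(H)|!}\sum_{F}(-1)^{|E(F)|}$, summing over spanning connected subgraphs $F\subseteq H$. The weight of a cluster is $w(\Gamma):=\phi(H_\Gamma)\prod_{S\in\Gamma}w(S)$. *)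

theory Defs
  imports Complex_Main "HOL-Library.Disjoint_Sets" "HOL-Library.Landau_Symbols"
begin

record 'a hypergraph =
  verts :: "'a set"
  edges :: "'a set set"

definition uniform_hypergraph :: "nat \<Rightarrow> 'a hypergraph \<Rightarrow> bool" where
  "uniform_hypergraph k G \<longleftrightarrow>
     finite (verts G) \<and> (\<forall>e\<in>edges G. e \<subseteq> verts G \<and> card e = k)"

definition partite_with :: "nat \<Rightarrow> 'a hypergraph \<Rightarrow> 'a set set \<Rightarrow> bool" where
  "partite_with k G \<Z> \<longleftrightarrow>
     partition_on (verts G) \<Z> \<and> card \<Z> = k \<and> (\<forall>e\<in>edges G. \<forall>Z\<in>\<Z>. card (e \<inter> Z) = 1)"

definition regular :: "nat \<Rightarrow> 'a hypergraph \<Rightarrow> bool" where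
  "regular r G \<longleftrightarrow> (\<forall>v\<in>verts G. card {e \<in> edges G. v \<in> e} = r)"

definition indep_sets :: "'a hypergraph \<Rightarrow> 'a set set" where
  "indep_sets G = {I. I \<subseteq> verts G \<and> \<not> (\<exists>e\<in>edges G. e \<subseteq> I)}"

definition nbhd :: "'a hypergraph \<Rightarrow> 'a set \<Rightarrow> 'a set" where
  "nbhd G S = \<Union> {e \<in> edges G. e \<inter> S \<noteq> {}} - S"

definition gam :: "nat \<Rightarrow> real" where
  "gam k = 2 ^ (k - 1) / (2 ^ (k - 1) - 1)"

definition alpha :: "nat \<Rightarrow> nat \<Rightarrow> real" where
  "alpha k t = 1 / 2 * min (log 2 (gam k) / exp (2 * real t))
     ((real k - 1) * (1 - ln 2) * ln (gam k) / (ln (2 ^ (k - 1) - 1) + ln (gam k)))"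

definition Reg :: "nat \<Rightarrow> nat \<Rightarrow> nat \<Rightarrow> nat \<Rightarrow> bool" where
  "Reg k n r t \<longleftrightarrow> real r \<ge> 1 / real t * log (gam k) (real n)"

definition Exp1 :: "nat \<Rightarrow> nat \<Rightarrow> 'a hypergraph \<Rightarrow> 'a set set \<Rightarrow> real \<Rightarrow> bool" where
  "Exp1 k r G \<Z> \<alpha> \<longleftrightarrow>
     (\<forall>Z\<in>\<Z>. \<forall>S\<subseteq>Z. card S \<le> r \<longrightarrow>
        real (card (nbhd G S)) \<ge> (real k - 1 - \<alpha>) * real r * real (card S))"

definition Exp2 ::
    "nat \<Rightarrow> nat \<Rightarrow> nat \<Rightarrow> 'a hypergraph \<Rightarrow> 'a set set \<Rightarrow> real \<Rightarrow> bool" where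
  "Exp2 k n r G \<Z> \<beta> \<longleftrightarrow>
     (\<forall>Z\<in>\<Z>. \<forall>S\<subseteq>Z. real (card S) \<le> \<beta> * (real n / real r) \<longrightarrow>
        real (card (nbhd G S)) \<ge> (real k - 2 + \<beta>) * real r * real (card S))"

definition Defect :: "'a hypergraph \<Rightarrow> 'a set set \<Rightarrow> real \<Rightarrow> bool" where
  "Defect G \<Z> b \<longleftrightarrow> (\<forall>I\<in>indep_sets G. \<exists>Z\<in>\<Z>. real (card (I \<inter> Z)) \<le> b)"

text \<open>An ordinary simple graph is a hypergraph all of whose edges are two-element sets.\<close>

definition graph_connected :: "'a hypergraph \<Rightarrow> bool" where
  "graph_connected H \<longleftrightarrow> verts H \<noteq> {} \<and>
     (\<forall>u\<in>verts H. \<forall>v\<in>verts H. (u, v) \<in> {(x, y). {x, y} \<in> edges H}\<^sup>*)"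

definition induced_subgraph :: "'a hypergraph \<Rightarrow> 'a set \<Rightarrow> 'a hypergraph" where
  "induced_subgraph H S = \<lparr>verts = S, edges = {e \<in> edges H. e \<subseteq> S}\<rparr>"

definition square_graph :: "'a hypergraph \<Rightarrow> 'a set \<Rightarrow> 'a hypergraph" where
  "square_graph G Z = \<lparr>verts = Z,
     edges = {{v, u} | v u. v \<in> Z \<and> u \<in> Z \<and> v \<noteq> u \<and> nbhd G {v} \<inter> nbhd G {u} \<noteq> {}}\<rparr>"

definition two_linked :: "'a hypergraph \<Rightarrow> 'a set \<Rightarrow> 'a set \<Rightarrow> bool" where
  "two_linked G Z S \<longleftrightarrow>
     S \<noteq> {} \<and> S \<subseteq> Z \<and> graph_connected (induced_subgraph (square_graph G Z) S)"

definition link_graph :: "'a hypergraph \<Rightarrow> 'a set \<Rightarrow> 'a hypergraph" where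
  "link_graph G S = \<lparr>verts = nbhd G S, edges = {e - S | e. e \<in> edges G \<and> e \<inter> S \<noteq> {}}\<rparr>"

definition polymers :: "'a hypergraph \<Rightarrow> 'a set \<Rightarrow> nat \<Rightarrow> 'a set set" where
  "polymers G Z b = {S. S \<subseteq> Z \<and> two_linked G Z S \<and> 1 \<le> card S \<and> card S \<le> b}"

definition compatible :: "'a hypergraph \<Rightarrow> 'a set \<Rightarrow> 'a set \<Rightarrow> bool" where
  "compatible G S T \<longleftrightarrow> nbhd G S \<inter> nbhd G T = {}"

definition polymer_weight :: "'a hypergraph \<Rightarrow> 'a set \<Rightarrow> real" where
  "polymer_weight G S = real (card (indep_sets (link_graph G S))) / 2 ^ card (nbhd G S)"

text \<open>A vector of polymers is a list. The vertices of its incompatibility graph are the positions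
  in the list, so that repeated polymers give distinct vertices.\<close>

definition incompat_graph :: "'a hypergraph \<Rightarrow> 'a set list \<Rightarrow> nat hypergraph" where
  "incompat_graph G \<Gamma> = \<lparr>verts = {..<length \<Gamma>},
     edges = {{i, j} | i j. i < length \<Gamma> \<and> j < length \<Gamma> \<and> i \<noteq> j \<and> \<not> compatible G (\<Gamma> ! i) (\<Gamma> ! j)}\<rparr>"

definition clusters :: "'a hypergraph \<Rightarrow> 'a set \<Rightarrow> nat \<Rightarrow> 'a set list set" where
  "clusters G Z b =
     {\<Gamma>. \<Gamma> \<noteq> [] \<and> set \<Gamma> \<subseteq> polymers G Z b \<and> graph_connected (incompat_graph G \<Gamma>)}"

definition cluster_size :: "'a set list \<Rightarrow> nat" where
  "cluster_size \<Gamma> = (\<Sum>S\<leftarrow>\<Gamma>. card S)"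

text \<open>A spanning subgraph is determined by its edge set \<open>F\<close>.\<close>

definition ursell :: "'a hypergraph \<Rightarrow> real" where
  "ursell H = 1 / fact (card (verts H)) *
     (\<Sum>F | F \<subseteq> edges H \<and> graph_connected \<lparr>verts = verts H, edges = F\<rparr>. (- 1) ^ card F)"

definition cluster_weight :: "'a hypergraph \<Rightarrow> 'a set list \<Rightarrow> real" where
  "cluster_weight G \<Gamma> = ursell (incompat_graph G \<Gamma>) * (\<Prod>S\<leftarrow>\<Gamma>. polymer_weight G S)"

text \<open>\<open>x = (1 \<plusminus> \<rho>) y\<close>\<close>

definition eq_upto_factor :: "real \<Rightarrow> real \<Rightarrow> real \<Rightarrow> bool" where
  "eq_upto_factor \<rho> x y \<longleftrightarrow> (1 - \<rho>) * y \<le> x \<and> x \<le> (1 + \<rho>) * y"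

end

theory Submission
  imports Defs "HOL-Complex_Analysis.Complex_Analysis" "HOL-Real_Asymp.Real_Asymp"
begin

text \<open>
  Independent sets with few vertices in a class \<open>Z\<close> are counted by their trace \<open>S\<close> on \<open>Z\<close>: there are
  \<open>2 ^ ((k - 1) * n)\<close> times the weight of \<open>S\<close> of them, and this weight is multiplicative over the
  2-linked components of \<open>S\<close>. The link of \<open>S\<close> contains a matching with at least
  \<open>\<bar>N(S)\<bar> - (k - 2) r \<bar>S\<bar>\<close> edges, so the expansion hypotheses bound the weight exponentially in
  \<open>r \<bar>S\<bar>\<close>. Hence components with more than \<open>t\<close> vertices, and independent sets that are sparse on two
  classes, are negligible, and what remains is the partition function \<open>\<Xi>\<close> of the polymers with at most
  \<open>t\<close> vertices.

  Give a polymer \<open>S\<close> the weight \<open>w(S) z ^ \<bar>S\<bar>\<close>. Inductive removal of polymers (the Kotecky-Preiss argument)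
  shows that \<open>\<Xi>(z)\<close> has no zero in a disc of radius about \<open>\<gamma> ^ r\<close> up to factors polynomial in \<open>r\<close>, and
  bounds \<open>\<Xi>'/\<Xi>\<close> there by \<open>O(n)\<close>. The coefficients of \<open>log \<Xi>(z)\<close> are the cluster sums, so Cauchy's
  estimate bounds the contribution of the clusters of size more than \<open>t\<close> by about
  \<open>n \<gamma> ^ (- r (t + 1)) = o(1)\<close>.
\<close>

section \<open>The polymer partition function\<close>

definition compat_families :: "('p \<Rightarrow> 'p \<Rightarrow> bool) \<Rightarrow> 'p set \<Rightarrow> 'p set set" where
  "compat_families inc P = {X. X \<subseteq> P \<and> pairwise (\<lambda>S T. \<not> inc S T) X}"

definition partition_fn :: "('p \<Rightarrow> 'p \<Rightarrow> bool) \<Rightarrow> ('p \<Rightarrow> 'b::comm_semiring_1) \<Rightarrow> 'p set \<Rightarrow> 'b" where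
  "partition_fn inc w P = (\<Sum>X\<in>compat_families inc P. \<Prod>S\<in>X. w S)"

lemma finite_compat_families: "finite P \<Longrightarrow> finite (compat_families inc P)"
  by (rule finite_subset[of _ "Pow P"]) (auto simp: compat_families_def)

lemma compat_families_containing:
  assumes "S \<in> P" and sym: "\<And>T. T \<in> P \<Longrightarrow> inc S T = inc T S" and "inc S S"
  shows "{X \<in> compat_families inc P. S \<in> X} = insert S ` compat_families inc {T\<in>P. \<not> inc S T}"
    (is "?A = insert S ` ?B")
proof
  show "?A \<subseteq> insert S ` ?B"
  proof
    fix X assume X: "X \<in> ?A"
    then have "X - {S} \<in> ?B"
      by (auto simp: compat_families_def pairwise_def)
    moreover have "X = insert S (X - {S})" using X by auto
    ultimately show "X \<in> insert S ` ?B" by blast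
  qed
  show "insert S ` ?B \<subseteq> ?A"
    using assms unfolding compat_families_def pairwise_def by blast
qed

lemma sum_compat_families_containing:
  assumes "finite P" "S \<in> P" and sym: "\<And>T. T \<in> P \<Longrightarrow> inc S T = inc T S" and refl: "inc S S"
  shows "(\<Sum>X | X \<in> compat_families inc P \<and> S \<in> X. f (X - {S})) =
         (\<Sum>X\<in>compat_families inc {T\<in>P. \<not> inc S T}. f X)"
proof -
  let ?B = "compat_families inc {T\<in>P. \<not> inc S T}"
  have nin: "S \<notin> X" if "X \<in> ?B" for X
    using that refl by (auto simp: compat_families_def)
  have "inj_on (insert S) ?B"
    by (rule inj_onI) (metis Diff_insert_absorb nin)
  then have "(\<Sum>X\<in>insert S ` ?B. f (X - {S})) = (\<Sum>X\<in>?B. f (insert S X - {S}))"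
    by (simp add: sum.reindex)
  also have "\<dots> = (\<Sum>X\<in>?B. f X)"
    by (rule sum.cong) (use nin in auto)
  finally show ?thesis
    using compat_families_containing[of S P inc, OF assms(2,3) refl] by metis
qed

lemma partition_fn_remove:
  fixes w :: "'p \<Rightarrow> 'b::comm_semiring_1"
  assumes "finite P" "S \<in> P" and sym: "\<And>T. T \<in> P \<Longrightarrow> inc S T = inc T S" and refl: "inc S S"
  shows "partition_fn inc w P =
    partition_fn inc w (P - {S}) + w S * partition_fn inc w {T\<in>P. \<not> inc S T}"
proof -
  let ?C = "compat_families inc P"
  have fin: "finite ?C" using assms finite_compat_families by blast
  have finX: "finite X" if "X \<in> ?C" for X
    using that assms(1) finite_subset by (auto simp: compat_families_def)
  have "partition_fn inc w P = (\<Sum>X | X \<in> ?C \<and> S \<notin> X. \<Prod>T\<in>X. w T) + (\<Sum>X | X \<in> ?C \<and> S \<in> X. \<Prod>T\<in>X. w T)"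
  proof -
    have "?C = {X. X \<in> ?C \<and> S \<notin> X} \<union> {X. X \<in> ?C \<and> S \<in> X}" by auto
    then have "partition_fn inc w P = (\<Sum>X\<in>{X. X \<in> ?C \<and> S \<notin> X} \<union> {X. X \<in> ?C \<and> S \<in> X}. \<Prod>T\<in>X. w T)"
      unfolding partition_fn_def by simp
    also have "\<dots> = (\<Sum>X | X \<in> ?C \<and> S \<notin> X. \<Prod>T\<in>X. w T) + (\<Sum>X | X \<in> ?C \<and> S \<in> X. \<Prod>T\<in>X. w T)"
      using fin by (intro sum.union_disjoint) auto
    finally show ?thesis .
  qed
  also have "{X. X \<in> ?C \<and> S \<notin> X} = compat_families inc (P - {S})"
    by (auto simp: compat_families_def)
  also have "(\<Sum>X | X \<in> ?C \<and> S \<in> X. \<Prod>T\<in>X. w T) = (\<Sum>X | X \<in> ?C \<and> S \<in> X. w S * (\<Prod>T\<in>X - {S}. w T))"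
    by (rule sum.cong) (use finX in \<open>auto intro: prod.remove\<close>)
  also have "\<dots> = w S * partition_fn inc w {T\<in>P. \<not> inc S T}"
    unfolding partition_fn_def sum_distrib_left
    by (rule sum_compat_families_containing[where f = "\<lambda>X. w S * (\<Prod>T\<in>X. w T)" and inc = inc, OF assms])
  finally show ?thesis by (simp add: partition_fn_def)
qed

lemma partition_fn_empty [simp]: "partition_fn inc w {} = 1"
proof -
  have "compat_families inc {} = {{}}" by (auto simp: compat_families_def)
  then show ?thesis by (simp add: partition_fn_def)
qed

lemma one_minus_mult_exp_ge:
  fixes y :: real
  shows "exp (- y) \<le> 1 - y * exp (- y)"
proof -
  have "(1 + y) * exp (- y) \<le> exp y * exp (- y)"
    by (intro mult_right_mono) auto
  then show ?thesis by (simp add: algebra_simps exp_minus)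
qed

locale polymer_system =
  fixes inc :: "'p \<Rightarrow> 'p \<Rightarrow> bool" and P :: "'p set"
  assumes finite_P: "finite P"
    and inc_sym: "\<And>S T. S \<in> P \<Longrightarrow> T \<in> P \<Longrightarrow> inc S T = inc T S"
    and inc_refl: "\<And>S. S \<in> P \<Longrightarrow> inc S S"
begin

lemma ratio_bound_from_single_removals:
  fixes w :: "'p \<Rightarrow> complex"
  assumes "M \<subseteq> \<Lambda>" "finite \<Lambda>"
    and step: "\<And>\<Lambda>' S. \<Lambda>' \<subseteq> \<Lambda> \<Longrightarrow> S \<in> \<Lambda>' \<Longrightarrow>
      norm (partition_fn inc w (\<Lambda>' - {S})) \<le> exp (y S) * norm (partition_fn inc w \<Lambda>')"
  shows "norm (partition_fn inc w (\<Lambda> - M)) \<le> exp (\<Sum>S\<in>M. y S) * norm (partition_fn inc w \<Lambda>)"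
proof -
  have "finite M" using assms finite_subset by blast
  then show ?thesis using \<open>M \<subseteq> \<Lambda>\<close>
  proof (induction M rule: finite_induct)
    case (insert S M)
    have "norm (partition_fn inc w (\<Lambda> - M - {S})) \<le> exp (y S) * norm (partition_fn inc w (\<Lambda> - M))"
      using insert by (intro step) auto
    also have "\<dots> \<le> exp (y S) * (exp (\<Sum>S\<in>M. y S) * norm (partition_fn inc w \<Lambda>))"
      using insert by (intro mult_left_mono) auto
    finally show ?case using insert
      by (simp add: exp_add mult.assoc Diff_insert[of \<Lambda> S M])
  qed simp
qed

lemma kotecky_preiss:
  fixes w :: "'p \<Rightarrow> complex" and a :: "'p \<Rightarrow> real"
  assumes KP: "\<And>S. S \<in> P \<Longrightarrow> (\<Sum>T | T \<in> P \<and> inc S T. norm (w T) * exp (a T)) \<le> a S"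
  assumes "\<Lambda> \<subseteq> P"
  shows "partition_fn inc w \<Lambda> \<noteq> 0 \<and> (\<forall>S\<in>\<Lambda>. norm (partition_fn inc w (\<Lambda> - {S})) \<le>
      exp (norm (w S) * exp (a S)) * norm (partition_fn inc w \<Lambda>))"
proof -
  define y where "y = (\<lambda>S. norm (w S) * exp (a S))"
  let ?Z = "partition_fn inc w"
  have "finite \<Lambda>" using assms finite_P finite_subset by blast
  then have "?Z \<Lambda> \<noteq> 0 \<and> (\<forall>S\<in>\<Lambda>. norm (?Z (\<Lambda> - {S})) \<le> exp (y S) * norm (?Z \<Lambda>))"
    using \<open>\<Lambda> \<subseteq> P\<close>
  proof (induction \<Lambda> rule: finite_psubset_induct)
    case (psubset \<Lambda>)
    have main: "?Z (\<Lambda> - {S}) \<noteq> 0 \<and> norm (?Z (\<Lambda> - {S})) \<le> exp (y S) * norm (?Z \<Lambda>)" if S: "S \<in> \<Lambda>" for S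
    proof -
      let ?L = "\<Lambda> - {S}"
      let ?M = "{T \<in> ?L. inc S T}"
      have SP: "S \<in> P" using S psubset.prems by auto
      have nz: "?Z ?L \<noteq> 0" using psubset.IH[of ?L] S psubset.prems by blast
      have M: "norm (?Z (?L - ?M)) \<le> exp (\<Sum>T\<in>?M. y T) * norm (?Z ?L)"
      proof (rule ratio_bound_from_single_removals)
        fix \<Lambda>' T assume "\<Lambda>' \<subseteq> ?L" "T \<in> \<Lambda>'"
        then show "norm (?Z (\<Lambda>' - {T})) \<le> exp (y T) * norm (?Z \<Lambda>')"
          using psubset.IH[of \<Lambda>'] S psubset.prems by blast
      qed (use psubset.hyps in auto)
      have "y S + (\<Sum>T\<in>?M. y T) = (\<Sum>T\<in>insert S ?M. y T)"
        using psubset.hyps by (subst sum.insert) auto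
      also have "\<dots> \<le> (\<Sum>T | T \<in> P \<and> inc S T. y T)"
        using psubset.prems inc_refl SP finite_P S by (intro sum_mono2) (auto simp: y_def)
      also have "\<dots> \<le> a S" unfolding y_def by (rule KP[OF SP])
      finally have le: "(\<Sum>T\<in>?M. y T) \<le> a S - y S" by simp
      have eq: "{T\<in>\<Lambda>. \<not> inc S T} = ?L - ?M" using inc_refl SP by auto
      have rec: "?Z \<Lambda> = ?Z ?L + w S * ?Z (?L - ?M)"
      proof -
        have "inc S T = inc T S" if "T \<in> \<Lambda>" for T
          using that psubset.prems SP by (intro inc_sym) auto
        from partition_fn_remove[of \<Lambda> S inc w, OF psubset.hyps S this inc_refl[OF SP]]
        show ?thesis by (simp only: eq)
      qed
      have "norm (w S * ?Z (?L - ?M)) \<le> norm (w S) * (exp (\<Sum>T\<in>?M. y T) * norm (?Z ?L))"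
        unfolding norm_mult using M by (intro mult_left_mono) auto
      also have "\<dots> \<le> norm (w S) * (exp (a S - y S) * norm (?Z ?L))"
        using le by (intro mult_left_mono mult_right_mono) auto
      also have "exp (a S - y S) = exp (a S) * exp (- y S)"
        by (simp flip: exp_add)
      also have "norm (w S) * (exp (a S) * exp (- y S) * norm (?Z ?L)) =
          norm (w S) * exp (a S) * exp (- y S) * norm (?Z ?L)"
        by (simp only: mult.assoc)
      also have "norm (w S) * exp (a S) = y S" by (simp add: y_def)
      finally have "norm (?Z \<Lambda>) \<ge> norm (?Z ?L) - y S * exp (- y S) * norm (?Z ?L)"
        unfolding rec using norm_diff_ineq[of "?Z ?L" "w S * ?Z (?L - ?M)"] by linarith
      moreover have "exp (- y S) * norm (?Z ?L) \<le> (1 - y S * exp (- y S)) * norm (?Z ?L)"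
        by (intro mult_right_mono one_minus_mult_exp_ge) auto
      ultimately have "exp (- y S) * norm (?Z ?L) \<le> norm (?Z \<Lambda>)"
        by (simp only: left_diff_distrib mult_1)
      then have "exp (y S) * (exp (- y S) * norm (?Z ?L)) \<le> exp (y S) * norm (?Z \<Lambda>)"
        by (rule mult_left_mono) simp
      then have "norm (?Z ?L) \<le> exp (y S) * norm (?Z \<Lambda>)"
        by (simp add: mult.assoc[symmetric] flip: exp_add)
      with nz show ?thesis by blast
    qed
    show ?case
    proof (cases "\<Lambda> = {}")
      case False
      then obtain S where "S \<in> \<Lambda>" by auto
      from main[OF this] have "?Z \<Lambda> \<noteq> 0" by auto
      with main show ?thesis by blast
    qed simp
  qed
  then show ?thesis by (simp add: y_def)
qed

lemma kotecky_preiss_ratio: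
  fixes w :: "'p \<Rightarrow> complex" and a :: "'p \<Rightarrow> real"
  assumes KP: "\<And>S. S \<in> P \<Longrightarrow> (\<Sum>T | T \<in> P \<and> inc S T. norm (w T) * exp (a T)) \<le> a S"
    and S: "S \<in> P"
  shows "norm (partition_fn inc w {T\<in>P. \<not> inc S T}) \<le> exp (a S) * norm (partition_fn inc w P)"
proof -
  let ?M = "{T \<in> P. inc S T}"
  have "norm (partition_fn inc w (P - ?M)) \<le> exp (\<Sum>T\<in>?M. norm (w T) * exp (a T)) * norm (partition_fn inc w P)"
  proof (rule ratio_bound_from_single_removals)
    fix \<Lambda>' T assume "\<Lambda>' \<subseteq> P" "T \<in> \<Lambda>'"
    then show "norm (partition_fn inc w (\<Lambda>' - {T})) \<le> exp (norm (w T) * exp (a T)) * norm (partition_fn inc w \<Lambda>')"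
      using kotecky_preiss[OF KP] by blast
  qed (use finite_P in auto)
  also have "\<dots> \<le> exp (a S) * norm (partition_fn inc w P)"
    using KP[OF S] by (intro mult_right_mono) auto
  also have "P - ?M = {T\<in>P. \<not> inc S T}" by auto
  finally show ?thesis .
qed

lemma has_field_derivative_partition_fn:
  fixes w :: "'p \<Rightarrow> complex" and sz :: "'p \<Rightarrow> nat"
  shows "((\<lambda>z. partition_fn inc (\<lambda>S. w S * z ^ sz S) P) has_field_derivative
    (\<Sum>S\<in>P. w S * (of_nat (sz S) * z ^ (sz S - 1)) *
       partition_fn inc (\<lambda>S. w S * z ^ sz S) {T\<in>P. \<not> inc S T})) (at z)"
proof -
  let ?C = "compat_families inc P"
  let ?d = "\<lambda>S. w S * (of_nat (sz S) * z ^ (sz S - 1))"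
  let ?p = "\<lambda>X. \<Prod>S\<in>X. w S * z ^ sz S"
  have fin: "finite ?C" using finite_P finite_compat_families by blast
  have "((\<lambda>z. partition_fn inc (\<lambda>S. w S * z ^ sz S) P) has_field_derivative
    (\<Sum>X\<in>?C. \<Sum>S\<in>X. ?d S * ?p (X - {S}))) (at z)"
    unfolding partition_fn_def
    by (intro DERIV_sum has_field_derivative_prod) (auto intro!: derivative_eq_intros)
  also have "(\<Sum>X\<in>?C. \<Sum>S\<in>X. ?d S * ?p (X - {S})) =
     (\<Sum>X\<in>?C. \<Sum>S\<in>P. if S \<in> X then ?d S * ?p (X - {S}) else 0)"
    using finite_P by (intro sum.cong refl sum.mono_neutral_cong_left) (auto simp: compat_families_def)
  also have "\<dots> = (\<Sum>S\<in>P. \<Sum>X\<in>?C. if S \<in> X then ?d S * ?p (X - {S}) else 0)"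
    by (rule sum.swap)
  also have "\<dots> = (\<Sum>S\<in>P. ?d S * partition_fn inc (\<lambda>S. w S * z ^ sz S) {T\<in>P. \<not> inc S T})"
  proof (rule sum.cong)
    fix S assume S: "S \<in> P"
    have "(\<Sum>X\<in>?C. if S \<in> X then ?d S * ?p (X - {S}) else 0) =
       (\<Sum>X | X \<in> ?C \<and> S \<in> X. ?d S * ?p (X - {S}))"
      using fin by (rule sum.inter_filter[symmetric])
    also have "\<dots> = (\<Sum>X\<in>compat_families inc {T\<in>P. \<not> inc S T}. ?d S * ?p X)"
      by (rule sum_compat_families_containing[where f = "\<lambda>X. ?d S * ?p X" and inc = inc,
            OF finite_P S inc_sym[OF S] inc_refl[OF S]])
    finally show "(\<Sum>X\<in>?C. if S \<in> X then ?d S * ?p (X - {S}) else 0) =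
       ?d S * partition_fn inc (\<lambda>S. w S * z ^ sz S) {T\<in>P. \<not> inc S T}"
      by (simp add: partition_fn_def sum_distrib_left)
  qed simp
  finally show ?thesis .
qed

end

lemma log_power_series_tail:
  fixes F L :: "complex fps" and D R :: real
  assumes rad: "fps_conv_radius F = \<infinity>"
    and F0: "fps_nth F 0 = 1" and L0: "fps_nth L 0 = 0"
    and ode: "fps_deriv L * F = fps_deriv F"
    and R: "R \<ge> 2" and D: "D \<ge> 0"
    and nz: "\<And>z. norm z < 2 * R \<Longrightarrow> eval_fps F z \<noteq> 0"
    and bound: "\<And>z. norm z < 2 * R \<Longrightarrow> norm (deriv (eval_fps F) z) \<le> D * norm (eval_fps F z)"
  shows "\<exists>l. exp l = eval_fps F 1 \<and> norm (l - (\<Sum>m\<le>t. fps_nth L m)) \<le> 2 * D / R ^ t"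
proof -
  have F_nz: "fps_nth F 0 \<noteq> 0" using F0 by simp
  then have "F \<noteq> 0" by auto
  have L': "fps_deriv L = fps_deriv F / F"
    unfolding ode[symmetric] using \<open>F \<noteq> 0\<close> by simp
  have radF': "fps_conv_radius (fps_deriv F) = \<infinity>"
    using fps_conv_radius_deriv[of F] rad by simp
  have "fps_conv_radius (fps_deriv F / F) \<ge> Min {ereal (2 * R), fps_conv_radius (fps_deriv F), fps_conv_radius F}"
    using rad radF' R nz by (intro fps_conv_radius_divide') (auto simp: zero_ereal_def in_eball_iff)
  then have radL': "fps_conv_radius (fps_deriv L) \<ge> 2 * R"
    by (simp add: L' rad radF')
  have evalL': "eval_fps (fps_deriv L) z = deriv (eval_fps F) z / eval_fps F z" if "norm z < 2 * R" for z
  proof -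
    have "eval_fps (fps_deriv F / F) z = eval_fps (fps_deriv F) z / eval_fps F z"
      using rad radF' R nz that by (intro eval_fps_divide'[where r = "ereal (2 * R)"])
        (auto simp: zero_ereal_def in_eball_iff)
    then show ?thesis using rad by (simp add: L' eval_fps_deriv)
  qed
  have coeff: "norm (fps_nth (fps_deriv L) m) \<le> D / R ^ m" for m
  proof -
    have "norm ((deriv ^^ m) (eval_fps (fps_deriv L)) 0) \<le> fact m * D / R ^ m"
    proof (rule Cauchy_inequality)
      have "eval_fps (fps_deriv L) holomorphic_on ball 0 (2 * R)"
        by (intro holomorphic_on_eval_fps) (auto simp: in_eball_iff intro!: less_le_trans[OF _ radL'])
      then show "eval_fps (fps_deriv L) holomorphic_on ball 0 R" "continuous_on (cball 0 R) (eval_fps (fps_deriv L))"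
        using R by (auto intro!: holomorphic_on_imp_continuous_on elim!: holomorphic_on_subset)
      fix z :: complex assume "norm (0 - z) = R"
      then have z: "norm z < 2 * R" using R by simp
      then show "norm (eval_fps (fps_deriv L) z) \<le> D"
        using bound[OF z] nz[OF z] by (simp add: evalL'[OF z] norm_divide field_simps)
    qed (use R in auto)
    then have "norm ((deriv ^^ m) (eval_fps (fps_deriv L)) 0) / fact m \<le> fact m * D / R ^ m / fact m"
      by (rule divide_right_mono) simp
    moreover have "fps_conv_radius (fps_deriv L) > 0"
      by (rule less_le_trans[OF _ radL']) (use R in auto)
    then have "fps_nth (fps_deriv L) m = (deriv ^^ m) (eval_fps (fps_deriv L)) 0 / fact m"
      by (rule fps_nth_conv_deriv)
    then have "norm (fps_nth (fps_deriv L) m) = norm ((deriv ^^ m) (eval_fps (fps_deriv L)) 0) / fact m"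
      by (simp only: norm_divide norm_fact)
    ultimately show ?thesis by (simp del: fps_deriv_nth)
  qed
  have coeffL: "norm (fps_nth L (Suc m)) \<le> D / R ^ m" for m
  proof -
    have "1 * norm (fps_nth L (Suc m)) \<le> of_nat (Suc m) * norm (fps_nth L (Suc m))"
      by (intro mult_right_mono) auto
    also have "\<dots> = norm (fps_nth (fps_deriv L) m)"
      by (simp add: norm_mult del: of_nat_Suc)
    finally show ?thesis using coeff[of m] by (simp del: fps_deriv_nth)
  qed
  have geo: "(\<lambda>i. D / R ^ t * (1 / R) ^ i) sums (D / R ^ t * (1 / (1 - 1 / R)))"
    using R by (intro sums_mult geometric_sums) auto
  have tail_le: "norm (fps_nth L (i + Suc t)) \<le> D / R ^ t * (1 / R) ^ i" for i
    using coeffL[of "i + t"] by (simp add: power_add field_simps)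
  have sm: "summable (\<lambda>i. norm (fps_nth L (i + Suc t)))"
    by (rule summable_comparison_test'[OF sums_summable[OF geo]]) (use tail_le in simp)
  then have smL: "summable (fps_nth L)"
    using summable_iff_shift[of "fps_nth L" "Suc t"] summable_norm_cancel by metis
  have tail: "norm ((\<Sum>m. fps_nth L m) - (\<Sum>m\<le>t. fps_nth L m)) \<le> 2 * D / R ^ t"
  proof -
    have "(\<Sum>m. fps_nth L m) - (\<Sum>m\<le>t. fps_nth L m) = (\<Sum>i. fps_nth L (i + Suc t))"
      using suminf_split_initial_segment[OF smL, of "Suc t"] by (simp add: lessThan_Suc_atMost)
    also have "norm \<dots> \<le> (\<Sum>i. norm (fps_nth L (i + Suc t)))"
      by (rule summable_norm[OF sm])
    also have "\<dots> \<le> (\<Sum>i. D / R ^ t * (1 / R) ^ i)"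
      using sm sums_summable[OF geo] tail_le by (intro suminf_le) auto
    also have "\<dots> = D / R ^ t * (1 / (1 - 1 / R))" using geo by (rule sums_unique[symmetric])
    also have "\<dots> \<le> D / R ^ t * 2" using R D by (intro mult_left_mono) (auto simp: field_simps)
    finally show ?thesis by (simp add: mult.commute)
  qed
  have radL: "fps_conv_radius L \<ge> R"
    unfolding fps_conv_radius_def
  proof (rule conv_radius_geI_ex')
    fix \<rho> :: real assume \<rho>: "0 < \<rho>" "ereal \<rho> < ereal R"
    have "summable (\<lambda>m. fps_nth L (Suc m) * of_real \<rho> ^ Suc m)"
    proof (rule summable_comparison_test')
      show "summable (\<lambda>m. D * \<rho> * (\<rho> / R) ^ m)" using \<rho> R by (intro summable_mult summable_geometric) auto
      fix m
      have "norm (fps_nth L (Suc m)) * \<rho> ^ Suc m \<le> D / R ^ m * \<rho> ^ Suc m"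
        using coeffL \<rho> by (intro mult_right_mono) auto
      then show "norm (fps_nth L (Suc m) * of_real \<rho> ^ Suc m) \<le> D * \<rho> * (\<rho> / R) ^ m"
        using \<rho> by (simp add: norm_mult norm_power power_divide field_simps)
    qed
    then show "summable (\<lambda>m. fps_nth L m * of_real \<rho> ^ m)"
      using summable_Suc_iff[of "\<lambda>m. fps_nth L m * of_real \<rho> ^ m"] by simp
  qed
  have inR: "ereal (norm z) < fps_conv_radius L" if "norm z < R" for z
    by (rule less_le_trans[OF _ radL]) (use that in simp)
  have "\<exists>c. \<forall>z\<in>ball 0 R. eval_fps F z * exp (- eval_fps L z) = c"
  proof (rule has_field_derivative_zero_constant)
    fix z :: complex assume "z \<in> ball 0 R"
    then have z: "norm z < R" "norm z < 2 * R" using R by auto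
    have "((\<lambda>z. eval_fps F z * exp (- eval_fps L z)) has_field_derivative
      (eval_fps (fps_deriv F) z * exp (- eval_fps L z) +
       eval_fps F z * (exp (- eval_fps L z) * - eval_fps (fps_deriv L) z))) (at z within ball 0 R)"
      using rad inR[OF z(1)] by (auto intro!: derivative_eq_intros has_field_derivative_eval_fps)
    then show "((\<lambda>z. eval_fps F z * exp (- eval_fps L z)) has_field_derivative 0) (at z within ball 0 R)"
      using nz[OF z(2)] rad by (simp add: evalL'[OF z(2)] eval_fps_deriv)
  qed simp
  then obtain c where c: "\<And>z. norm z < R \<Longrightarrow> eval_fps F z * exp (- eval_fps L z) = c" by auto
  have "c = 1" using c[of 0] R F0 L0 by (simp add: eval_fps_at_0)
  then have "eval_fps F 1 * exp (- eval_fps L 1) = 1" using c[of 1] R by simp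
  then have "exp (eval_fps L 1) = eval_fps F 1" by (simp add: exp_minus field_simps)
  moreover have "eval_fps L 1 = (\<Sum>m. fps_nth L m)" by (simp add: eval_fps_def)
  ultimately show ?thesis using tail by auto
qed

section \<open>The Mayer expansion\<close>

definition conn_sum :: "'v set \<Rightarrow> 'v set set \<Rightarrow> 'b::comm_ring_1" where
  "conn_sum V E = (\<Sum>F | F \<subseteq> E \<and> graph_connected \<lparr>verts = V, edges = F\<rparr>. (- 1) ^ card F)"

definition all_sum :: "'v set set \<Rightarrow> 'b::comm_ring_1" where
  "all_sum E = (\<Sum>F\<in>Pow E. (- 1) ^ card F)"

lemma all_sum_eq:
  assumes "finite E"
  shows "all_sum E = (if E = {} then 1 else 0 :: 'b::comm_ring_1)"
proof -
  have "(\<Prod>x\<in>E. 1 - 1 :: 'b) = all_sum E"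
    unfolding all_sum_def by (subst prod_diff_conv_sum[OF assms]) simp
  then have "all_sum E = (0 :: 'b) ^ card E" by simp
  then show ?thesis using assms by (simp add: zero_power card_gt_0_iff)
qed

abbreviation edge_rel :: "'v set set \<Rightarrow> ('v \<times> 'v) set" where
  "edge_rel F \<equiv> {(x, y). {x, y} \<in> F}"

lemma edge_rel_rtrancl_sym: "(x, y) \<in> (edge_rel F)\<^sup>* \<Longrightarrow> (y, x) \<in> (edge_rel F)\<^sup>*"
proof -
  have "sym (edge_rel F)" by (auto simp: sym_def insert_commute)
  then show "(x, y) \<in> (edge_rel F)\<^sup>* \<Longrightarrow> (y, x) \<in> (edge_rel F)\<^sup>*"
    by (meson sym_rtrancl symD)
qed

lemma edge_rel_rtrancl_mono: "F \<subseteq> F' \<Longrightarrow> (edge_rel F)\<^sup>* \<subseteq> (edge_rel F')\<^sup>*"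
  by (rule rtrancl_mono) auto

lemma graph_connected_iff_root:
  assumes "i \<in> V"
  shows "graph_connected \<lparr>verts = V, edges = F\<rparr> \<longleftrightarrow> (\<forall>v\<in>V. (i, v) \<in> (edge_rel F)\<^sup>*)"
  using assms unfolding graph_connected_def
  by (auto intro: rtrancl_trans[OF edge_rel_rtrancl_sym])

definition root_component :: "'v set \<Rightarrow> 'v \<Rightarrow> 'v set set \<Rightarrow> 'v set" where
  "root_component V i F = {v \<in> V. (i, v) \<in> (edge_rel F)\<^sup>*}"

lemma root_component_edge:
  assumes "{x, y} \<in> F" "x \<in> V" "y \<in> V"
  shows "x \<in> root_component V i F \<longleftrightarrow> y \<in> root_component V i F"
proof -
  have "(x, y) \<in> edge_rel F" "(y, x) \<in> edge_rel F"
    using assms by (auto simp: insert_commute)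
  then show ?thesis
    using assms unfolding root_component_def by (blast intro: rtrancl_into_rtrancl)
qed

lemma sum_subgraphs_with_root_component:
  assumes "finite V" "i \<in> U" "U \<subseteq> V"
    and E: "\<And>e. e \<in> E \<Longrightarrow> e \<subseteq> V \<and> (\<exists>x y. e = {x, y})"
  shows "(\<Sum>F | F \<in> Pow E \<and> root_component V i F = U. (- 1) ^ card F) =
    (conn_sum U {e\<in>E. e \<subseteq> U} * all_sum {e\<in>E. e \<subseteq> V - U} :: 'b::comm_ring_1)"
proof -
  let ?A = "{F. F \<subseteq> {e\<in>E. e \<subseteq> U} \<and> graph_connected \<lparr>verts = U, edges = F\<rparr>}"
  let ?B = "Pow {e\<in>E. e \<subseteq> V - U}"
  have finE: "finite E" using E \<open>finite V\<close> by (intro finite_subset[of E "Pow V"]) auto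
  have ne: "\<forall>e\<in>E. \<not> (e \<subseteq> U \<and> e \<subseteq> V - U)"
  proof
    fix e assume "e \<in> E"
    from E[OF this] show "\<not> (e \<subseteq> U \<and> e \<subseteq> V - U)" by auto
  qed
  have split: "e \<subseteq> U \<or> e \<subseteq> V - U" if F: "F \<subseteq> E" "root_component V i F = U" "e \<in> F" for F e
  proof -
    have "e \<in> E" using F by auto
    then obtain x y where xy: "e = {x, y}" "x \<in> V" "y \<in> V" using E[of e] by auto
    then have "x \<in> U \<longleftrightarrow> y \<in> U" using root_component_edge[of x y F V i] F by auto
    then show ?thesis using xy by auto
  qed
  have "(\<Sum>F | F \<in> Pow E \<and> root_component V i F = U. (- 1 :: 'b) ^ card F) =
    (\<Sum>(F1, F2)\<in>?A \<times> ?B. (- 1) ^ card F1 * (- 1) ^ card F2)"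
  proof (rule sum.reindex_bij_witness[where i = "\<lambda>(F1, F2). F1 \<union> F2"
        and j = "\<lambda>F. ({e\<in>F. e \<subseteq> U}, {e\<in>F. e \<subseteq> V - U})"], goal_cases)
    case (1 F)
    then have "e \<subseteq> U \<or> e \<subseteq> V - U" if "e \<in> F" for e
      using split[of F e] that by auto
    then show ?case by auto
  next
    case (2 F)
    then have F: "F \<subseteq> E" and U: "root_component V i F = U" by auto
    have "v \<in> U \<and> (i, v) \<in> (edge_rel {e\<in>F. e \<subseteq> U})\<^sup>*" if "(i, v) \<in> (edge_rel F)\<^sup>*" for v
      using that
    proof induction
      case base
      then show ?case using \<open>i \<in> U\<close> by simp
    next
      case (step x y)
      then have xy: "{x, y} \<in> F" "x \<in> U" by auto
      then have "y \<in> U" using split[OF F U xy(1)] by auto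
      then have "(x, y) \<in> edge_rel {e\<in>F. e \<subseteq> U}" using xy by auto
      from rtrancl_into_rtrancl[OF conjunct2[OF step.IH] this] \<open>y \<in> U\<close> show ?case by (rule conjI[rotated])
    qed
    then have "graph_connected \<lparr>verts = U, edges = {e\<in>F. e \<subseteq> U}\<rparr>"
      using graph_connected_iff_root[OF \<open>i \<in> U\<close>] U unfolding root_component_def by blast
    then show ?case using F by auto
  next
    case (3 b)
    obtain F1 F2 where b: "b = (F1, F2)" by (cases b)
    then have F: "F1 \<subseteq> {e\<in>E. e \<subseteq> U}" "F2 \<subseteq> {e\<in>E. e \<subseteq> V - U}" using 3 by auto
    have F1: "e \<notin> F2" if "e \<subseteq> U" for e using that F ne by (metis (no_types, lifting) mem_Collect_eq subsetD)
    have F2: "e \<notin> F1" if "e \<subseteq> V - U" for e using that F ne by (metis (no_types, lifting) mem_Collect_eq subsetD)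
    have "{e \<in> F1 \<union> F2. e \<subseteq> U} = F1" using F1 F by auto
    moreover have "{e \<in> F1 \<union> F2. e \<subseteq> V - U} = F2" using F2 F by auto
    ultimately show ?case by (simp add: b)
  next
    case (4 b)
    obtain F1 F2 where b: "b = (F1, F2)" by (cases b)
    then have F1: "F1 \<subseteq> {e\<in>E. e \<subseteq> U}" "graph_connected \<lparr>verts = U, edges = F1\<rparr>"
      and F2: "F2 \<subseteq> {e\<in>E. e \<subseteq> V - U}" using 4 by auto
    have "v \<in> U" if "(i, v) \<in> (edge_rel (F1 \<union> F2))\<^sup>*" for v
      using that
    proof induction
      case (step x y)
      then have "{x, y} \<in> F1" using F2 by auto
      then show ?case using F1 by auto
    qed (use \<open>i \<in> U\<close> in auto)
    moreover have "(i, v) \<in> (edge_rel (F1 \<union> F2))\<^sup>*" if "v \<in> U" for v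
      using F1(2) that edge_rel_rtrancl_mono[of F1 "F1 \<union> F2"]
      unfolding graph_connected_iff_root[OF \<open>i \<in> U\<close>] by blast
    ultimately have "root_component V i (F1 \<union> F2) = U"
      using \<open>U \<subseteq> V\<close> unfolding root_component_def by blast
    then show ?case using F1 F2 b by auto
  next
    case (5 F)
    then have F: "F \<subseteq> E" and U: "root_component V i F = U" by auto
    have fin: "finite F" using F finE finite_subset by blast
    have eq: "F = {e\<in>F. e \<subseteq> U} \<union> {e\<in>F. e \<subseteq> V - U}" using split[OF F U] by auto
    have "{e\<in>F. e \<subseteq> U} \<inter> {e\<in>F. e \<subseteq> V - U} = {}"
    proof (rule equals0I)
      fix e assume e: "e \<in> {e\<in>F. e \<subseteq> U} \<inter> {e\<in>F. e \<subseteq> V - U}"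
      then have "e \<in> E" using F by auto
      from bspec[OF ne this] e show False by simp
    qed
    then have "card ({e\<in>F. e \<subseteq> U} \<union> {e\<in>F. e \<subseteq> V - U}) = card {e\<in>F. e \<subseteq> U} + card {e\<in>F. e \<subseteq> V - U}"
      using fin by (intro card_Un_disjoint) auto
    then have "card F = card {e\<in>F. e \<subseteq> U} + card {e\<in>F. e \<subseteq> V - U}"
      by (simp only: eq[symmetric])
    then show ?case by (simp add: power_add)
  qed
  also have "\<dots> = conn_sum U {e\<in>E. e \<subseteq> U} * all_sum {e\<in>E. e \<subseteq> V - U}"
    unfolding conn_sum_def all_sum_def by (simp add: sum_product sum.cartesian_product)
  finally show ?thesis .
qed

lemma all_sum_root_decomposition:
  assumes "finite V" "i \<in> V"
    and E: "\<And>e. e \<in> E \<Longrightarrow> e \<subseteq> V \<and> (\<exists>x y. e = {x, y})"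
  shows "(all_sum E :: 'b::comm_ring_1) =
    (\<Sum>U | U \<subseteq> V \<and> i \<in> U. conn_sum U {e\<in>E. e \<subseteq> U} * all_sum {e\<in>E. e \<subseteq> V - U})"
proof -
  have finE: "finite E" using E \<open>finite V\<close> by (intro finite_subset[of E "Pow V"]) auto
  have "(all_sum E :: 'b) = (\<Sum>U | U \<subseteq> V \<and> i \<in> U. \<Sum>F | F \<in> Pow E \<and> root_component V i F = U. (- 1) ^ card F)"
    unfolding all_sum_def
    by (rule sum.group[symmetric]) (use finE assms in \<open>auto simp: root_component_def\<close>)
  also have "\<dots> = (\<Sum>U | U \<subseteq> V \<and> i \<in> U. conn_sum U {e\<in>E. e \<subseteq> U} * all_sum {e\<in>E. e \<subseteq> V - U})"
    by (intro sum.cong refl sum_subgraphs_with_root_component) (use assms in auto)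
  finally show ?thesis .
qed

lemma graph_connected_image:
  assumes "graph_connected \<lparr>verts = V, edges = F\<rparr>"
  shows "graph_connected \<lparr>verts = h ` V, edges = (`) h ` F\<rparr>"
proof -
  have "(h u, h v) \<in> (edge_rel ((`) h ` F))\<^sup>*" if "(u, v) \<in> (edge_rel F)\<^sup>*" for u v
    using that
  proof induction
    case (step x y)
    then have "h ` {x, y} \<in> (`) h ` F" by blast
    then have "(h x, h y) \<in> edge_rel ((`) h ` F)" by simp
    then show ?case using step.IH by (rule rtrancl_into_rtrancl[rotated])
  qed simp
  then show ?thesis using assms unfolding graph_connected_def by auto
qed

lemma conn_sum_image:
  assumes inj: "inj_on h V" and E: "E \<subseteq> Pow V"
  shows "(conn_sum (h ` V) ((`) h ` E) :: 'b::comm_ring_1) = conn_sum V E"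
proof -
  let ?g = "inv_into V h"
  have gh: "?g ` h ` e = e" if "e \<in> E" for e
    using that E inj by (intro inv_into_image_cancel) auto
  have ghF: "(`) ?g ` (`) h ` F = F" if "F \<subseteq> E" for F
  proof -
    have "(`) ?g ` (`) h ` F = (\<lambda>e. e) ` F"
      unfolding image_image[of "(`) ?g"] by (rule image_cong[OF refl]) (use gh that in auto)
    then show ?thesis by simp
  qed
  have hgF: "(`) h ` (`) ?g ` F = F" if F: "F \<subseteq> (`) h ` E" for F
  proof -
    obtain F' where "F' \<subseteq> E" "F = (`) h ` F'" using F by (auto simp: subset_image_iff)
    then show ?thesis using ghF[of F'] by simp
  qed
  have gF: "(`) ?g ` F \<subseteq> E" if "F \<subseteq> (`) h ` E" for F
    using image_mono[OF that, of "(`) ?g"] ghF[of E] by simp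
  have gV: "?g ` h ` V = V" using inj by (intro inv_into_image_cancel) auto
  show ?thesis unfolding conn_sum_def
  proof (rule sum.reindex_bij_witness[where i = "\<lambda>F. (`) h ` F" and j = "\<lambda>F. (`) ?g ` F"], goal_cases)
    case (1 F) then show ?case using hgF by auto
  next
    case (2 F) then show ?case using gF graph_connected_image[of "h ` V" F ?g] gV by auto
  next
    case (3 F) then show ?case using ghF by auto
  next
    case (4 F) then show ?case using graph_connected_image[of V F h] by auto
  next
    case (5 F)
    have "inj_on ((`) ?g) F"
    proof (rule inj_on_inverseI[where g = "(`) h"])
      fix e assume "e \<in> F"
      then obtain e' where "e' \<in> E" "e = h ` e'" using 5 by auto
      then show "h ` ?g ` e = e" using gh[of e'] by simp
    qed
    then show ?case by (simp add: card_image)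
  qed
qed

definition inc_edges :: "('p \<Rightarrow> 'p \<Rightarrow> bool) \<Rightarrow> 'v set \<Rightarrow> ('v \<Rightarrow> 'p) \<Rightarrow> 'v set set" where
  "inc_edges inc V \<Gamma> = {{i, j} | i j. i \<in> V \<and> j \<in> V \<and> i \<noteq> j \<and> inc (\<Gamma> i) (\<Gamma> j)}"

lemma inc_edges_restrict: "U \<subseteq> V \<Longrightarrow> {e \<in> inc_edges inc V \<Gamma>. e \<subseteq> U} = inc_edges inc U \<Gamma>"
  by (auto simp: inc_edges_def)

lemma inc_edges_cong:
  assumes "\<And>i. i \<in> V \<Longrightarrow> \<Gamma> i = \<Gamma>' i"
  shows "inc_edges inc V \<Gamma> = inc_edges inc V \<Gamma>'"
proof -
  have "(i \<in> V \<and> j \<in> V \<and> i \<noteq> j \<and> inc (\<Gamma> i) (\<Gamma> j)) = (i \<in> V \<and> j \<in> V \<and> i \<noteq> j \<and> inc (\<Gamma>' i) (\<Gamma>' j))" for i j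
    using assms by auto
  then show ?thesis unfolding inc_edges_def by (simp only:)
qed

lemma inc_edges_image:
  assumes "inj_on h V"
  shows "inc_edges inc (h ` V) \<Gamma> = (`) h ` inc_edges inc V (\<Gamma> \<circ> h)"
proof
  show "inc_edges inc (h ` V) \<Gamma> \<subseteq> (`) h ` inc_edges inc V (\<Gamma> \<circ> h)"
  proof
    fix e assume "e \<in> inc_edges inc (h ` V) \<Gamma>"
    then obtain i j where ij: "e = {h i, h j}" "i \<in> V" "j \<in> V" "h i \<noteq> h j" "inc (\<Gamma> (h i)) (\<Gamma> (h j))"
      unfolding inc_edges_def by auto
    then have "{i, j} \<in> inc_edges inc V (\<Gamma> \<circ> h)" unfolding inc_edges_def by auto
    moreover have "e = h ` {i, j}" using ij by simp
    ultimately show "e \<in> (`) h ` inc_edges inc V (\<Gamma> \<circ> h)" by blast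
  qed
  show "(`) h ` inc_edges inc V (\<Gamma> \<circ> h) \<subseteq> inc_edges inc (h ` V) \<Gamma>"
    using assms by (fastforce simp: inc_edges_def inj_on_def)
qed

lemma finite_inc_edges: "finite V \<Longrightarrow> finite (inc_edges inc V \<Gamma>)"
  by (rule finite_subset[of _ "Pow V"]) (auto simp: inc_edges_def)

lemma inc_edges_empty_iff:
  "inc_edges inc V \<Gamma> = {} \<longleftrightarrow> (\<forall>i\<in>V. \<forall>j\<in>V. i \<noteq> j \<longrightarrow> \<not> inc (\<Gamma> i) (\<Gamma> j))"
  unfolding inc_edges_def by auto

lemma sum_PiE_split:
  fixes f g :: "('v \<Rightarrow> 'p) \<Rightarrow> 'b::comm_semiring_1"
  assumes "U \<subseteq> V"
  shows "(\<Sum>\<Gamma>\<in>PiE V (\<lambda>_. P). f (restrict \<Gamma> U) * g (restrict \<Gamma> (V - U))) =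
    (\<Sum>\<Gamma>\<in>PiE U (\<lambda>_. P). f \<Gamma>) * (\<Sum>\<Gamma>\<in>PiE (V - U) (\<lambda>_. P). g \<Gamma>)"
proof -
  have "(\<Sum>\<Gamma>\<in>PiE V (\<lambda>_. P). f (restrict \<Gamma> U) * g (restrict \<Gamma> (V - U))) =
    (\<Sum>(a, b)\<in>PiE U (\<lambda>_. P) \<times> PiE (V - U) (\<lambda>_. P). f a * g b)"
  proof (rule sum.reindex_bij_witness[where
        i = "\<lambda>(a, b). (\<lambda>x\<in>V. if x \<in> U then a x else b x)" and
        j = "\<lambda>\<Gamma>. (restrict \<Gamma> U, restrict \<Gamma> (V - U))"], goal_cases)
    case (1 \<Gamma>)
    then show ?case using assms by (auto simp: fun_eq_iff PiE_def extensional_def)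
  next
    case (2 \<Gamma>)
    then show ?case using assms by (auto simp: PiE_def Pi_def)
  next
    case (3 x)
    have "x \<notin> U" if "x \<notin> V" for x using assms that by auto
    with 3 show ?case by (auto simp: fun_eq_iff PiE_def extensional_def)
  next
    case (4 x)
    then show ?case using assms by (auto simp: PiE_def Pi_def)
  qed auto
  then show ?thesis by (simp add: sum_product sum.cartesian_product)
qed

lemma sum_Pow_card:
  fixes f :: "nat \<Rightarrow> 'b::comm_semiring_1"
  assumes "finite V"
  shows "(\<Sum>U\<in>Pow V. f (card U)) = (\<Sum>j\<le>card V. of_nat (card V choose j) * f j)"
proof -
  have "(\<Sum>U\<in>Pow V. f (card U)) = (\<Sum>j\<le>card V. \<Sum>U | U \<in> Pow V \<and> card U = j. f (card U))"
    by (rule sum.group[symmetric]) (use assms card_mono in auto)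
  also have "\<dots> = (\<Sum>j\<le>card V. of_nat (card V choose j) * f j)"
    using n_subsets[OF assms] by (intro sum.cong) auto
  finally show ?thesis .
qed

definition conn_weight ::
    "('p \<Rightarrow> 'p \<Rightarrow> bool) \<Rightarrow> ('p \<Rightarrow> 'b::comm_ring_1) \<Rightarrow> 'p set \<Rightarrow> 'v set \<Rightarrow> 'b" where
  "conn_weight inc \<omega> P V = (\<Sum>\<Gamma>\<in>PiE V (\<lambda>_. P). (\<Prod>i\<in>V. \<omega> (\<Gamma> i)) * conn_sum V (inc_edges inc V \<Gamma>))"

definition all_weight ::
    "('p \<Rightarrow> 'p \<Rightarrow> bool) \<Rightarrow> ('p \<Rightarrow> 'b::comm_ring_1) \<Rightarrow> 'p set \<Rightarrow> 'v set \<Rightarrow> 'b" where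
  "all_weight inc \<omega> P V = (\<Sum>\<Gamma>\<in>PiE V (\<lambda>_. P). (\<Prod>i\<in>V. \<omega> (\<Gamma> i)) * all_sum (inc_edges inc V \<Gamma>))"

lemma sum_PiE_reindex:
  assumes h: "bij_betw h V' V"
  shows "(\<Sum>\<Gamma>\<in>PiE V (\<lambda>_. P). f (restrict (\<Gamma> \<circ> h) V')) = (\<Sum>\<Gamma>\<in>PiE V' (\<lambda>_. P). f \<Gamma>)"
proof (rule sum.reindex_bij_witness[where
      i = "\<lambda>\<Gamma>. restrict (\<Gamma> \<circ> inv_into V' h) V" and j = "\<lambda>\<Gamma>. restrict (\<Gamma> \<circ> h) V'"], goal_cases)
  case (1 \<Gamma>)
  have "\<Gamma> x = undefined" if "x \<notin> V" for x using 1 that by (auto simp: PiE_def extensional_def)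
  moreover have "inv_into V' h x \<in> V'" "h (inv_into V' h x) = x" if "x \<in> V" for x
    using h that by (auto simp: bij_betw_def inv_into_into f_inv_into_f)
  ultimately show ?case by (auto simp: fun_eq_iff)
next
  case (2 \<Gamma>)
  then show ?case using h by (auto simp: bij_betw_def)
next
  case (3 \<Gamma>)
  have "\<Gamma> x = undefined" if "x \<notin> V'" for x using 3 that by (auto simp: PiE_def extensional_def)
  moreover have "h x \<in> V" "inv_into V' h (h x) = x" if "x \<in> V'" for x
    using h that by (auto simp: bij_betw_def)
  ultimately show ?case by (auto simp: fun_eq_iff)
next
  case (4 \<Gamma>)
  have "inv_into V' h x \<in> V'" if "x \<in> V" for x
    using h that by (auto simp: bij_betw_def inv_into_into)
  then show ?case using 4 by auto
qed auto

lemma conn_weight_reindex: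
  assumes "finite V" "card V' = card V" "finite V'"
  shows "conn_weight inc \<omega> P V = (conn_weight inc \<omega> P V' :: 'b::comm_ring_1)"
proof -
  obtain h where h: "bij_betw h V' V"
    using finite_same_card_bij[of V' V] assms by auto
  then have inj: "inj_on h V'" and hV: "h ` V' = V" by (auto simp: bij_betw_def)
  let ?f = "\<lambda>\<Gamma>. (\<Prod>i\<in>V'. \<omega> (\<Gamma> i)) * conn_sum V' (inc_edges inc V' \<Gamma>)"
  have "(\<Prod>i\<in>V. \<omega> (\<Gamma> i)) * conn_sum V (inc_edges inc V \<Gamma>) = ?f (restrict (\<Gamma> \<circ> h) V')" for \<Gamma>
  proof -
    have "(\<Prod>i\<in>V. \<omega> (\<Gamma> i)) = (\<Prod>i\<in>V'. \<omega> (restrict (\<Gamma> \<circ> h) V' i))"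
      unfolding hV[symmetric] by (simp add: prod.reindex[OF inj])
    moreover have "conn_sum V (inc_edges inc V \<Gamma>) = (conn_sum V' (inc_edges inc V' (\<Gamma> \<circ> h)) :: 'b)"
      unfolding hV[symmetric] inc_edges_image[OF inj]
      by (rule conn_sum_image[OF inj]) (auto simp: inc_edges_def)
    moreover have "inc_edges inc V' (\<Gamma> \<circ> h) = inc_edges inc V' (restrict (\<Gamma> \<circ> h) V')"
      by (rule inc_edges_cong) simp
    ultimately show ?thesis by simp
  qed
  then have "conn_weight inc \<omega> P V = (\<Sum>\<Gamma>\<in>PiE V (\<lambda>_. P). ?f (restrict (\<Gamma> \<circ> h) V'))"
    unfolding conn_weight_def by (rule sum.cong[OF refl])
  also have "\<dots> = (\<Sum>\<Gamma>\<in>PiE V' (\<lambda>_. P). ?f \<Gamma>)"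
    by (rule sum_PiE_reindex[OF h])
  finally show ?thesis unfolding conn_weight_def .
qed

lemma all_weight_reindex:
  assumes "finite V" "card V' = card V" "finite V'"
  shows "all_weight inc \<omega> P V = (all_weight inc \<omega> P V' :: 'b::comm_ring_1)"
proof -
  obtain h where h: "bij_betw h V' V"
    using finite_same_card_bij[of V' V] assms by auto
  then have inj: "inj_on h V'" and hV: "h ` V' = V" by (auto simp: bij_betw_def)
  let ?f = "\<lambda>\<Gamma>. (\<Prod>i\<in>V'. \<omega> (\<Gamma> i)) * all_sum (inc_edges inc V' \<Gamma>)"
  have "(\<Prod>i\<in>V. \<omega> (\<Gamma> i)) * all_sum (inc_edges inc V \<Gamma>) = ?f (restrict (\<Gamma> \<circ> h) V')" for \<Gamma>
  proof -
    have "(\<Prod>i\<in>V. \<omega> (\<Gamma> i)) = (\<Prod>i\<in>V'. \<omega> (restrict (\<Gamma> \<circ> h) V' i))"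
      unfolding hV[symmetric] by (simp add: prod.reindex[OF inj])
    moreover have "all_sum (inc_edges inc V \<Gamma>) = (all_sum (inc_edges inc V' (\<Gamma> \<circ> h)) :: 'b)"
      unfolding hV[symmetric] inc_edges_image[OF inj]
      using assms by (simp add: all_sum_eq finite_inc_edges)
    moreover have "inc_edges inc V' (\<Gamma> \<circ> h) = inc_edges inc V' (restrict (\<Gamma> \<circ> h) V')"
      by (rule inc_edges_cong) simp
    ultimately show ?thesis by simp
  qed
  then have "all_weight inc \<omega> P V = (\<Sum>\<Gamma>\<in>PiE V (\<lambda>_. P). ?f (restrict (\<Gamma> \<circ> h) V'))"
    unfolding all_weight_def by (rule sum.cong[OF refl])
  also have "\<dots> = (\<Sum>\<Gamma>\<in>PiE V' (\<lambda>_. P). ?f \<Gamma>)"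
    by (rule sum_PiE_reindex[OF h])
  finally show ?thesis unfolding all_weight_def .
qed

text \<open>The component of \<open>i\<close> is split off for every \<open>i\<close>, and the resulting identities are summed with
  weights \<open>sz (\<Gamma> i)\<close>; this produces the Euler operator \<open>X d/dX\<close> on both sides.\<close>

lemma weighted_all_sum_decomposition:
  assumes "finite V"
  shows "of_nat (\<Sum>i\<in>V. sz (\<Gamma> i)) * (all_sum (inc_edges inc V \<Gamma>) :: 'b::comm_ring_1) =
    (\<Sum>U\<in>Pow V. of_nat (\<Sum>i\<in>U. sz (\<Gamma> i)) * conn_sum U (inc_edges inc U \<Gamma>) *
       all_sum (inc_edges inc (V - U) \<Gamma>))"
proof -
  let ?t = "\<lambda>U. conn_sum U (inc_edges inc U \<Gamma>) * all_sum (inc_edges inc (V - U) \<Gamma>) :: 'b"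
  have "of_nat (\<Sum>i\<in>V. sz (\<Gamma> i)) * (all_sum (inc_edges inc V \<Gamma>) :: 'b) =
    (\<Sum>i\<in>V. of_nat (sz (\<Gamma> i)) * all_sum (inc_edges inc V \<Gamma>))"
    by (simp add: sum_distrib_right)
  also have "\<dots> = (\<Sum>i\<in>V. \<Sum>U | U \<in> Pow V \<and> i \<in> U. of_nat (sz (\<Gamma> i)) * ?t U)"
  proof (rule sum.cong[OF refl])
    fix i assume i: "i \<in> V"
    have "(all_sum (inc_edges inc V \<Gamma>) :: 'b) =
      (\<Sum>U | U \<subseteq> V \<and> i \<in> U. conn_sum U {e\<in>inc_edges inc V \<Gamma>. e \<subseteq> U} * all_sum {e\<in>inc_edges inc V \<Gamma>. e \<subseteq> V - U})"
      by (rule all_sum_root_decomposition[OF assms i]) (auto simp: inc_edges_def)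
    also have "\<dots> = (\<Sum>U | U \<subseteq> V \<and> i \<in> U. ?t U)"
      by (rule sum.cong) (auto simp: inc_edges_restrict)
    finally show "of_nat (sz (\<Gamma> i)) * all_sum (inc_edges inc V \<Gamma>) =
        (\<Sum>U | U \<in> Pow V \<and> i \<in> U. of_nat (sz (\<Gamma> i)) * ?t U)"
      by (simp add: sum_distrib_left)
  qed
  also have "\<dots> = (\<Sum>U\<in>Pow V. \<Sum>i | i \<in> V \<and> i \<in> U. of_nat (sz (\<Gamma> i)) * ?t U)"
    using assms by (intro sum.swap_restrict) auto
  also have "\<dots> = (\<Sum>U\<in>Pow V. of_nat (\<Sum>i\<in>U. sz (\<Gamma> i)) * ?t U)"
  proof (rule sum.cong[OF refl])
    fix U assume "U \<in> Pow V"
    then have "{i. i \<in> V \<and> i \<in> U} = U" by auto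
    then show "(\<Sum>i | i \<in> V \<and> i \<in> U. of_nat (sz (\<Gamma> i)) * ?t U) = of_nat (\<Sum>i\<in>U. sz (\<Gamma> i)) * ?t U"
      by (simp add: sum_distrib_right)
  qed
  finally show ?thesis by (simp add: mult.assoc)
qed

abbreviation size_weight :: "('p \<Rightarrow> 'b::comm_ring_1) \<Rightarrow> ('p \<Rightarrow> nat) \<Rightarrow> 'p \<Rightarrow> 'b fps" where
  "size_weight w sz S \<equiv> fps_const (w S) * fps_X ^ sz S"

lemma prod_size_weight:
  "finite V \<Longrightarrow> (\<Prod>i\<in>V. size_weight w sz (\<Gamma> i)) = fps_const (\<Prod>i\<in>V. w (\<Gamma> i)) * fps_X ^ (\<Sum>i\<in>V. sz (\<Gamma> i))"
  by (induction V rule: finite_induct) (auto simp: power_add mult_ac simp flip: fps_const_mult)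

lemma euler_monomial:
  "fps_X * fps_deriv (fps_const c * fps_X ^ m) = of_nat m * (fps_const c * fps_X ^ m :: 'b::comm_ring_1 fps)"
proof (rule fps_ext)
  fix n show "(fps_X * fps_deriv (fps_const c * fps_X ^ m)) $ n = (of_nat m * (fps_const c * fps_X ^ m :: 'b fps)) $ n"
    by (cases n) (auto simp: fps_of_nat[symmetric] simp del: fps_of_nat)
qed

lemma fps_deriv_conn_sum: "fps_deriv (conn_sum V E) = 0"
  unfolding conn_sum_def by (simp add: fps_deriv_sum fps_deriv_power)

lemma fps_deriv_all_sum: "fps_deriv (all_sum E) = 0"
  unfolding all_sum_def by (simp add: fps_deriv_sum fps_deriv_power)

lemma euler_prod_size_weight:
  assumes "finite V" "fps_deriv K = 0"
  shows "fps_X * fps_deriv ((\<Prod>i\<in>V. size_weight w sz (\<Gamma> i)) * K) =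
    (\<Prod>i\<in>V. size_weight w sz (\<Gamma> i)) * (of_nat (\<Sum>i\<in>V. sz (\<Gamma> i)) * K)"
proof -
  let ?p = "\<Prod>i\<in>V. size_weight w sz (\<Gamma> i)"
  have "fps_X * fps_deriv (?p * K) = (fps_X * fps_deriv ?p) * K"
    by (simp only: fps_deriv_mult assms(2) mult_zero_right add_0 mult.assoc)
  also have "fps_X * fps_deriv ?p = of_nat (\<Sum>i\<in>V. sz (\<Gamma> i)) * ?p"
    unfolding prod_size_weight[OF assms(1)] by (rule euler_monomial)
  finally show ?thesis by (simp only: ac_simps)
qed

lemma euler_conn_weight:
  assumes "finite V"
  shows "fps_X * fps_deriv (conn_weight inc (size_weight w sz) P V) =
    (\<Sum>\<Gamma>\<in>PiE V (\<lambda>_. P). (\<Prod>i\<in>V. size_weight w sz (\<Gamma> i)) *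
      (of_nat (\<Sum>i\<in>V. sz (\<Gamma> i)) * conn_sum V (inc_edges inc V \<Gamma>)))"
  unfolding conn_weight_def fps_deriv_sum sum_distrib_left
  by (rule sum.cong[OF refl], rule euler_prod_size_weight[OF assms fps_deriv_conn_sum])

lemma euler_all_weight:
  assumes "finite V"
  shows "fps_X * fps_deriv (all_weight inc (size_weight w sz) P V) =
    (\<Sum>\<Gamma>\<in>PiE V (\<lambda>_. P). (\<Prod>i\<in>V. size_weight w sz (\<Gamma> i)) *
      (of_nat (\<Sum>i\<in>V. sz (\<Gamma> i)) * all_sum (inc_edges inc V \<Gamma>)))"
  unfolding all_weight_def fps_deriv_sum sum_distrib_left
  by (rule sum.cong[OF refl], rule euler_prod_size_weight[OF assms fps_deriv_all_sum])

lemma euler_all_weight_decomposition: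
  assumes "finite V"
  shows "fps_X * fps_deriv (all_weight inc (size_weight w sz) P V) =
    (\<Sum>U\<in>Pow V. fps_X * fps_deriv (conn_weight inc (size_weight w sz) P U) *
       all_weight inc (size_weight w sz) P (V - U))"
proof -
  let ?\<omega> = "size_weight w sz"
  let ?c = "\<lambda>U \<Gamma>. (\<Prod>i\<in>U. ?\<omega> (\<Gamma> i)) * (of_nat (\<Sum>i\<in>U. sz (\<Gamma> i)) * conn_sum U (inc_edges inc U \<Gamma>))"
  let ?a = "\<lambda>U \<Gamma>. (\<Prod>i\<in>U. ?\<omega> (\<Gamma> i)) * all_sum (inc_edges inc U \<Gamma>)"
  have c_restrict: "?c U (restrict \<Gamma> U) = ?c U \<Gamma>" for U \<Gamma>
    using inc_edges_cong[of U "restrict \<Gamma> U" \<Gamma> inc] by simp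
  have a_restrict: "?a U (restrict \<Gamma> U) = ?a U \<Gamma>" for U \<Gamma>
    using inc_edges_cong[of U "restrict \<Gamma> U" \<Gamma> inc] by simp
  have "(\<Prod>i\<in>V. ?\<omega> (\<Gamma> i)) * (of_nat (\<Sum>i\<in>V. sz (\<Gamma> i)) * all_sum (inc_edges inc V \<Gamma>)) =
    (\<Sum>U\<in>Pow V. ?c U (restrict \<Gamma> U) * ?a (V - U) (restrict \<Gamma> (V - U)))" for \<Gamma>
    unfolding weighted_all_sum_decomposition[OF assms] c_restrict a_restrict sum_distrib_left
  proof (rule sum.cong[OF refl])
    fix U assume "U \<in> Pow V"
    then have "(\<Prod>i\<in>V. ?\<omega> (\<Gamma> i)) = (\<Prod>i\<in>V - U. ?\<omega> (\<Gamma> i)) * (\<Prod>i\<in>U. ?\<omega> (\<Gamma> i))"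
      using assms by (intro prod.subset_diff) auto
    then show "(\<Prod>i\<in>V. ?\<omega> (\<Gamma> i)) * (of_nat (\<Sum>i\<in>U. sz (\<Gamma> i)) * conn_sum U (inc_edges inc U \<Gamma>) *
       all_sum (inc_edges inc (V - U) \<Gamma>)) = ?c U \<Gamma> * ?a (V - U) \<Gamma>"
      by (simp only: ac_simps)
  qed
  then have "fps_X * fps_deriv (all_weight inc ?\<omega> P V) =
    (\<Sum>\<Gamma>\<in>PiE V (\<lambda>_. P). \<Sum>U\<in>Pow V. ?c U (restrict \<Gamma> U) * ?a (V - U) (restrict \<Gamma> (V - U)))"
    unfolding euler_all_weight[OF assms] by (simp only:)
  also have "\<dots> = (\<Sum>U\<in>Pow V. \<Sum>\<Gamma>\<in>PiE V (\<lambda>_. P). ?c U (restrict \<Gamma> U) * ?a (V - U) (restrict \<Gamma> (V - U)))"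
    by (rule sum.swap)
  also have "\<dots> = (\<Sum>U\<in>Pow V. (\<Sum>\<Gamma>\<in>PiE U (\<lambda>_. P). ?c U \<Gamma>) * (\<Sum>\<Gamma>\<in>PiE (V - U) (\<lambda>_. P). ?a (V - U) \<Gamma>))"
    by (rule sum.cong[OF refl], rule sum_PiE_split[where f = "?c _" and g = "?a _"]) auto
  also have "\<dots> = (\<Sum>U\<in>Pow V. fps_X * fps_deriv (conn_weight inc ?\<omega> P U) * all_weight inc ?\<omega> P (V - U))"
    using assms finite_subset
    by (intro sum.cong[OF refl]) (simp only: euler_conn_weight all_weight_def Pow_iff finite_subset)
  finally show ?thesis .
qed

context polymer_system
begin

definition conn_term :: "('p \<Rightarrow> 'b::field_char_0) \<Rightarrow> ('p \<Rightarrow> nat) \<Rightarrow> nat \<Rightarrow> 'b fps" where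
  "conn_term w sz n = fps_const (1 / fact n) * conn_weight inc (size_weight w sz) P {..<n}"

definition all_term :: "('p \<Rightarrow> 'b::field_char_0) \<Rightarrow> ('p \<Rightarrow> nat) \<Rightarrow> nat \<Rightarrow> 'b fps" where
  "all_term w sz n = fps_const (1 / fact n) * all_weight inc (size_weight w sz) P {..<n}"

lemma euler_all_term:
  fixes w :: "'p \<Rightarrow> 'b::field_char_0"
  shows "fps_X * fps_deriv (all_term w sz n) = (\<Sum>j\<le>n. fps_X * fps_deriv (conn_term w sz j) * all_term w sz (n - j))"
proof -
  let ?\<omega> = "size_weight w sz"
  let ?C = "\<lambda>j. conn_weight inc ?\<omega> P {..<j::nat}" and ?A = "\<lambda>j. all_weight inc ?\<omega> P {..<j::nat}"
  have "fps_X * fps_deriv (?A n) = (\<Sum>U\<in>Pow {..<n}. fps_X * fps_deriv (?C (card U)) * ?A (n - card U))"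
    unfolding euler_all_weight_decomposition[OF finite_lessThan]
  proof (rule sum.cong[OF refl])
    fix U :: "nat set" assume U: "U \<in> Pow {..<n}"
    then have "finite U" using finite_subset by auto
    then have "conn_weight inc ?\<omega> P U = ?C (card U)"
      by (intro conn_weight_reindex) auto
    moreover have "all_weight inc ?\<omega> P ({..<n} - U) = ?A (n - card U)"
      using U \<open>finite U\<close> by (intro all_weight_reindex) (auto simp: card_Diff_subset)
    ultimately show "fps_X * fps_deriv (conn_weight inc ?\<omega> P U) * all_weight inc ?\<omega> P ({..<n} - U) =
       fps_X * fps_deriv (?C (card U)) * ?A (n - card U)" by simp
  qed
  also have "\<dots> = (\<Sum>j\<le>n. of_nat (n choose j) * (fps_X * fps_deriv (?C j) * ?A (n - j)))"
    using sum_Pow_card[of "{..<n}" "\<lambda>j. fps_X * fps_deriv (?C j) * ?A (n - j)"] by simp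
  finally have eq: "fps_X * fps_deriv (?A n) = (\<Sum>j\<le>n. of_nat (n choose j) * (fps_X * fps_deriv (?C j) * ?A (n - j)))" .
  have "fps_X * fps_deriv (all_term w sz n) = fps_const (1 / fact n) * (fps_X * fps_deriv (?A n))"
    unfolding all_term_def by (simp add: mult_ac)
  also have "\<dots> = (\<Sum>j\<le>n. fps_const (1 / fact n) * (of_nat (n choose j) * (fps_X * fps_deriv (?C j) * ?A (n - j))))"
    unfolding eq sum_distrib_left ..
  also have "\<dots> = (\<Sum>j\<le>n. fps_X * fps_deriv (conn_term w sz j) * all_term w sz (n - j))"
  proof (rule sum.cong[OF refl])
    fix j assume "j \<in> {..n}"
    then have "(1 / fact n) * of_nat (n choose j) = (1 / fact j) * (1 / fact (n - j) :: 'b)"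
      by (simp add: binomial_fact)
    then have coeff: "fps_const (1 / fact n) * of_nat (n choose j) = fps_const (1 / fact j) * fps_const (1 / fact (n - j) :: 'b)"
      unfolding fps_of_nat[symmetric] fps_const_mult by simp
    have "fps_const (1 / fact n) * (of_nat (n choose j) * (fps_X * fps_deriv (?C j) * ?A (n - j))) =
       (fps_const (1 / fact n) * of_nat (n choose j)) * (fps_X * fps_deriv (?C j) * ?A (n - j))"
      by (simp only: mult.assoc)
    also have "\<dots> = fps_X * fps_deriv (conn_term w sz j) * all_term w sz (n - j)"
      unfolding coeff conn_term_def all_term_def fps_deriv_mult fps_deriv_const by (simp only: ac_simps mult_zero_left add_0)
    finally show "fps_const (1 / fact n) * (of_nat (n choose j) * (fps_X * fps_deriv (?C j) * ?A (n - j))) =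
       fps_X * fps_deriv (conn_term w sz j) * all_term w sz (n - j)" .
  qed
  finally show ?thesis .
qed

lemma compatible_tuple_inj:
  assumes \<Gamma>: "\<Gamma> \<in> PiE V (\<lambda>_. P)" "inc_edges inc V \<Gamma> = {}"
  shows "inj_on \<Gamma> V"
proof (rule inj_onI, rule ccontr)
  fix i j assume ij: "i \<in> V" "j \<in> V" "\<Gamma> i = \<Gamma> j" "i \<noteq> j"
  have "\<Gamma> j \<in> P" using \<Gamma>(1) ij(2) by (rule PiE_mem)
  then have "inc (\<Gamma> i) (\<Gamma> j)" using inc_refl ij(3) by simp
  then show False using \<Gamma>(2) ij unfolding inc_edges_empty_iff by blast
qed

lemma compatible_tuples_of_family:
  assumes X: "X \<in> compat_families inc P" "card X = n"
  shows "{\<Gamma> \<in> PiE {..<n} (\<lambda>_. P). inc_edges inc {..<n} \<Gamma> = {} \<and> \<Gamma> ` {..<n} = X} =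
    {\<Gamma> \<in> PiE {..<n} (\<lambda>_. X). inj_on \<Gamma> {..<n}}" (is "?L = ?R")
proof (intro equalityI subsetI)
  fix \<Gamma> assume \<Gamma>: "\<Gamma> \<in> ?L"
  have "inj_on \<Gamma> {..<n}" using \<Gamma> by (intro compatible_tuple_inj) auto
  then show "\<Gamma> \<in> ?R" using \<Gamma> by (auto simp: PiE_def)
next
  fix \<Gamma> assume \<Gamma>: "\<Gamma> \<in> ?R"
  have XP: "X \<subseteq> P" and pw: "pairwise (\<lambda>S T. \<not> inc S T) X" using X by (auto simp: compat_families_def)
  have "finite X" using XP finite_P finite_subset by auto
  moreover have "\<Gamma> ` {..<n} \<subseteq> X" using \<Gamma> by auto
  moreover have "card (\<Gamma> ` {..<n}) = n" using \<Gamma> by (simp add: card_image)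
  ultimately have im: "\<Gamma> ` {..<n} = X" using X(2) by (intro card_subset_eq) auto
  moreover have "inc_edges inc {..<n} \<Gamma> = {}"
    unfolding inc_edges_empty_iff
  proof (intro ballI impI)
    fix i j assume ij: "i \<in> {..<n}" "j \<in> {..<n}" "i \<noteq> j"
    then have "\<Gamma> i \<in> X" "\<Gamma> j \<in> X" "\<Gamma> i \<noteq> \<Gamma> j"
      using \<Gamma> by (auto simp: inj_on_def)
    then show "\<not> inc (\<Gamma> i) (\<Gamma> j)" using pw by (auto simp: pairwise_def)
  qed
  ultimately show "\<Gamma> \<in> ?L" using \<Gamma> XP by (auto simp: PiE_def Pi_def)
qed

lemma all_weight_eq:
  fixes \<omega> :: "'p \<Rightarrow> 'b::comm_ring_1"
  shows "all_weight inc \<omega> P {..<n} = of_nat (fact n) * (\<Sum>X | X \<in> compat_families inc P \<and> card X = n. \<Prod>S\<in>X. \<omega> S)"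
proof -
  let ?Q = "{\<Gamma> \<in> PiE {..<n} (\<lambda>_. P). inc_edges inc {..<n} \<Gamma> = {}}"
  let ?F = "{X. X \<in> compat_families inc P \<and> card X = n}"
  have fin: "finite (PiE {..<n} (\<lambda>_. P))" using finite_P by (intro finite_PiE) auto
  have im: "(\<lambda>\<Gamma>. \<Gamma> ` {..<n}) ` ?Q \<subseteq> ?F"
  proof (clarify, intro conjI)
    fix \<Gamma> assume \<Gamma>: "\<Gamma> \<in> PiE {..<n} (\<lambda>_. P)" "inc_edges inc {..<n} \<Gamma> = {}"
    have "pairwise (\<lambda>S T. \<not> inc S T) (\<Gamma> ` {..<n})"
      using \<Gamma>(2) unfolding pairwise_image by (auto simp: pairwise_def inc_edges_empty_iff)
    moreover have "\<Gamma> ` {..<n} \<subseteq> P" using \<Gamma>(1) by auto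
    ultimately show "\<Gamma> ` {..<n} \<in> compat_families inc P"
      by (simp add: compat_families_def)
    have "inj_on \<Gamma> {..<n}" using \<Gamma> by (rule compatible_tuple_inj)
    then show "card (\<Gamma> ` {..<n}) = n" by (simp add: card_image)
  qed
  have "all_weight inc \<omega> P {..<n} = (\<Sum>\<Gamma>\<in>PiE {..<n} (\<lambda>_. P). if inc_edges inc {..<n} \<Gamma> = {} then \<Prod>i<n. \<omega> (\<Gamma> i) else 0)"
    unfolding all_weight_def by (intro sum.cong refl) (simp add: all_sum_eq finite_inc_edges)
  also have "\<dots> = (\<Sum>\<Gamma>\<in>?Q. \<Prod>i<n. \<omega> (\<Gamma> i))"
    using fin by (rule sum.inter_filter[symmetric])
  also have "\<dots> = (\<Sum>X\<in>?F. \<Sum>\<Gamma> | \<Gamma> \<in> ?Q \<and> \<Gamma> ` {..<n} = X. \<Prod>i<n. \<omega> (\<Gamma> i))"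
    using fin finite_compat_families[OF finite_P, of inc] im by (intro sum.group[symmetric]) auto
  also have "\<dots> = (\<Sum>X\<in>?F. of_nat (fact n) * (\<Prod>S\<in>X. \<omega> S))"
  proof (rule sum.cong[OF refl])
    fix X assume "X \<in> ?F"
    then have X: "X \<in> compat_families inc P" "card X = n" by auto
    let ?R = "{\<Gamma> \<in> PiE {..<n} (\<lambda>_. X). inj_on \<Gamma> {..<n}}"
    have "{\<Gamma>. \<Gamma> \<in> ?Q \<and> \<Gamma> ` {..<n} = X} = {\<Gamma> \<in> PiE {..<n} (\<lambda>_. P). inc_edges inc {..<n} \<Gamma> = {} \<and> \<Gamma> ` {..<n} = X}"
      by auto
    also have "\<dots> = ?R" by (rule compatible_tuples_of_family[OF X])
    finally have eq: "{\<Gamma>. \<Gamma> \<in> ?Q \<and> \<Gamma> ` {..<n} = X} = ?R" .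
    have finX: "finite X" using X finite_P finite_subset by (auto simp: compat_families_def)
    have "(\<Prod>i<n. \<omega> (\<Gamma> i)) = (\<Prod>S\<in>X. \<omega> S)" if "\<Gamma> \<in> ?R" for \<Gamma>
    proof -
      have "\<Gamma> ` {..<n} = X" "inj_on \<Gamma> {..<n}" using that eq by blast+
      then show ?thesis using prod.reindex[of \<Gamma> "{..<n}" \<omega>] by simp
    qed
    then have "(\<Sum>\<Gamma>\<in>?R. \<Prod>i<n. \<omega> (\<Gamma> i)) = (\<Sum>\<Gamma>\<in>?R. \<Prod>S\<in>X. \<omega> S)" by (rule sum.cong[OF refl])
    also have "\<dots> = of_nat (card ?R) * (\<Prod>S\<in>X. \<omega> S)" by simp
    also have "card ?R = fact n"
      using card_inj_on_subset_funcset[of "{..<n}" X "{..<n}"] finX X fact_prod_rev[of n, where 'a = nat]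
      by (simp add: lessThan_atLeast0)
    finally show "(\<Sum>\<Gamma> | \<Gamma> \<in> ?Q \<and> \<Gamma> ` {..<n} = X. \<Prod>i<n. \<omega> (\<Gamma> i)) = of_nat (fact n) * (\<Prod>S\<in>X. \<omega> S)"
      unfolding eq by simp
  qed
  finally show ?thesis by (simp add: sum_distrib_left)
qed

lemma sum_all_term:
  fixes w :: "'p \<Rightarrow> 'b::field_char_0"
  assumes "card P \<le> N"
  shows "(\<Sum>n\<le>N. all_term w sz n) = partition_fn inc (size_weight w sz) P"
proof -
  let ?F = "compat_families inc P"
  have "all_term w sz n = (\<Sum>X | X \<in> ?F \<and> card X = n. \<Prod>S\<in>X. size_weight w sz S)" for n
  proof -
    have "fps_const (1 / fact n) * (of_nat (fact n) :: 'b fps) = 1"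
      unfolding fps_of_nat[symmetric] fps_const_mult by simp
    then show ?thesis
      unfolding all_term_def all_weight_eq by (simp only: mult.assoc[symmetric] mult_1)
  qed
  then have "(\<Sum>n\<le>N. all_term w sz n) = (\<Sum>n\<le>N. \<Sum>X | X \<in> ?F \<and> card X = n. \<Prod>S\<in>X. size_weight w sz S)" by simp
  also have "\<dots> = (\<Sum>X\<in>?F. \<Prod>S\<in>X. size_weight w sz S)"
  proof (rule sum.group)
    show "card ` ?F \<subseteq> {..N}"
    proof
      fix n assume "n \<in> card ` ?F"
      then obtain X where "X \<subseteq> P" "n = card X" by (auto simp: compat_families_def)
      then show "n \<in> {..N}" using card_mono[OF finite_P, of X] assms by simp
    qed
  qed (use finite_compat_families[OF finite_P] in auto)
  finally show ?thesis by (simp add: partition_fn_def)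
qed

end

lemma fps_const_sum: "fps_const (\<Sum>x\<in>A. f x) = (\<Sum>x\<in>A. fps_const (f x :: 'b::comm_ring_1))"
  by (induction A rule: infinite_finite_induct) (auto simp flip: fps_const_add)

lemma fps_const_minus_one_power: "fps_const ((- 1) ^ k) = (- 1 :: 'b::comm_ring_1 fps) ^ k"
  by (metis fps_const_1_eq_1 fps_const_neg fps_const_power)

lemma conn_sum_fps: "(conn_sum V E :: 'b::comm_ring_1 fps) = fps_const (conn_sum V E)"
  unfolding conn_sum_def fps_const_sum fps_const_minus_one_power ..

lemma all_sum_fps: "(all_sum E :: 'b::comm_ring_1 fps) = fps_const (all_sum E)"
  unfolding all_sum_def fps_const_sum fps_const_minus_one_power ..

lemma fps_nth_scaled_monomial:
  "fps_nth (fps_const a * (fps_const p * fps_X ^ s * fps_const c)) m = (if s = m then a * (p * c) else 0 :: 'b::comm_ring_1)"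
  by auto

lemma fps_nth_euler: "fps_nth (fps_X * fps_deriv f) m = of_nat m * fps_nth (f :: 'b::comm_ring_1 fps) m"
  by (cases m) auto

lemma fps_mult_nth_zero:
  fixes f g :: "'b::comm_ring_1 fps"
  assumes "\<And>m. m < i \<Longrightarrow> fps_nth f m = 0" "\<And>m. m < j \<Longrightarrow> fps_nth g m = 0" "M < i + j"
  shows "fps_nth (f * g) M = 0"
  unfolding fps_mult_nth
proof (rule sum.neutral, rule ballI)
  fix k assume "k \<in> {0..M}"
  then have "k < i \<or> M - k < j" using assms(3) by auto
  then show "fps_nth f k * fps_nth g (M - k) = 0" using assms(1,2) by auto
qed

context polymer_system
begin

definition log_series :: "('p \<Rightarrow> 'b::field_char_0) \<Rightarrow> ('p \<Rightarrow> nat) \<Rightarrow> 'b fps" where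
  "log_series w sz = Abs_fps (\<lambda>m. \<Sum>n\<le>m. fps_nth (conn_term w sz n) m)"

definition tuple_weight :: "('p \<Rightarrow> 'b::field_char_0) \<Rightarrow> 'p list \<Rightarrow> 'b" where
  "tuple_weight w xs = 1 / fact (length xs) *
     conn_sum {..<length xs} (inc_edges inc {..<length xs} ((!) xs)) * (\<Prod>S\<leftarrow>xs. w S)"

lemma sum_size_ge_length:
  fixes sz :: "'p \<Rightarrow> nat"
  assumes "\<And>S. S \<in> P \<Longrightarrow> sz S \<ge> 1" "\<Gamma> \<in> PiE {..<n} (\<lambda>_. P)"
  shows "n \<le> (\<Sum>i<n. sz (\<Gamma> i))"
proof -
  have "(\<Sum>i<n. 1 :: nat) \<le> (\<Sum>i<n. sz (\<Gamma> i))"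
    using assms by (intro sum_mono) (auto simp: PiE_def Pi_def)
  then show ?thesis by simp
qed

lemma fps_nth_conn_term:
  fixes w :: "'p \<Rightarrow> 'b::field_char_0"
  shows "fps_nth (conn_term w sz n) m = (\<Sum>\<Gamma>\<in>PiE {..<n} (\<lambda>_. P).
    if (\<Sum>i<n. sz (\<Gamma> i)) = m then 1 / fact n * ((\<Prod>i<n. w (\<Gamma> i)) * conn_sum {..<n} (inc_edges inc {..<n} \<Gamma>)) else 0)"
  unfolding conn_term_def conn_weight_def prod_size_weight[OF finite_lessThan] conn_sum_fps
    sum_distrib_left fps_sum_nth fps_nth_scaled_monomial ..

lemma fps_nth_all_term:
  fixes w :: "'p \<Rightarrow> 'b::field_char_0"
  shows "fps_nth (all_term w sz n) m = (\<Sum>\<Gamma>\<in>PiE {..<n} (\<lambda>_. P).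
    if (\<Sum>i<n. sz (\<Gamma> i)) = m then 1 / fact n * ((\<Prod>i<n. w (\<Gamma> i)) * all_sum (inc_edges inc {..<n} \<Gamma>)) else 0)"
  unfolding all_term_def all_weight_def prod_size_weight[OF finite_lessThan] all_sum_fps
    sum_distrib_left fps_sum_nth fps_nth_scaled_monomial ..

lemma conn_term_subdegree:
  assumes "\<And>S. S \<in> P \<Longrightarrow> sz S \<ge> 1" "m < n"
  shows "fps_nth (conn_term w sz n) m = 0"
  unfolding fps_nth_conn_term
proof (rule sum.neutral, rule ballI, rule if_not_P)
  fix \<Gamma> assume "\<Gamma> \<in> PiE {..<n} (\<lambda>_. P)"
  with assms(1) have "n \<le> (\<Sum>i<n. sz (\<Gamma> i))" by (rule sum_size_ge_length)
  with assms(2) show "(\<Sum>i<n. sz (\<Gamma> i)) \<noteq> m" by linarith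
qed

lemma all_term_subdegree:
  assumes "\<And>S. S \<in> P \<Longrightarrow> sz S \<ge> 1" "m < n"
  shows "fps_nth (all_term w sz n) m = 0"
  unfolding fps_nth_all_term
proof (rule sum.neutral, rule ballI, rule if_not_P)
  fix \<Gamma> assume "\<Gamma> \<in> PiE {..<n} (\<lambda>_. P)"
  with assms(1) have "n \<le> (\<Sum>i<n. sz (\<Gamma> i))" by (rule sum_size_ge_length)
  with assms(2) show "(\<Sum>i<n. sz (\<Gamma> i)) \<noteq> m" by linarith
qed

lemma log_series_ode:
  fixes w :: "'p \<Rightarrow> 'b::field_char_0"
  assumes sz: "\<And>S. S \<in> P \<Longrightarrow> sz S \<ge> 1"
  shows "fps_deriv (log_series w sz) * partition_fn inc (size_weight w sz) P =
    fps_deriv (partition_fn inc (size_weight w sz) P)"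
proof -
  let ?F = "partition_fn inc (size_weight w sz) P"
  let ?c = "conn_term w sz" and ?a = "all_term w sz" and ?L = "log_series w sz"
  let ?E = "\<lambda>f. fps_X * fps_deriv f :: 'b fps"
  have "fps_nth (?E ?L * ?F) M = fps_nth (?E ?F) M" for M
  proof -
    define N where "N = max M (card P)"
    have NM: "M \<le> N" and F: "?F = (\<Sum>n\<le>N. ?a n)" by (auto simp: N_def sum_all_term)
    have "fps_nth (?E ?L * ?F) M = (\<Sum>k=0..M. fps_nth (?E ?L) k * fps_nth ?F (M - k))"
      by (rule fps_mult_nth)
    also have "\<dots> = (\<Sum>k=0..M. fps_nth (?E (\<Sum>j\<le>N. ?c j)) k * fps_nth ?F (M - k))"
    proof (rule sum.cong[OF refl])
      fix k assume "k \<in> {0..M}"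
      then have "(\<Sum>j\<le>k. fps_nth (?c j) k) = (\<Sum>j\<le>N. fps_nth (?c j) k)"
        using NM sz by (intro sum.mono_neutral_left) (auto simp: conn_term_subdegree)
      then show "fps_nth (?E ?L) k * fps_nth ?F (M - k) = fps_nth (?E (\<Sum>j\<le>N. ?c j)) k * fps_nth ?F (M - k)"
        unfolding fps_nth_euler by (simp add: log_series_def fps_sum_nth)
    qed
    also have "\<dots> = fps_nth (?E (\<Sum>j\<le>N. ?c j) * (\<Sum>i\<le>N. ?a i)) M"
      unfolding F by (rule fps_mult_nth[symmetric])
    also have "?E (\<Sum>j\<le>N. ?c j) = (\<Sum>j\<le>N. ?E (?c j))"
      by (simp add: fps_deriv_sum sum_distrib_left)
    also have "fps_nth ((\<Sum>j\<le>N. ?E (?c j)) * (\<Sum>i\<le>N. ?a i)) M = fps_nth (\<Sum>(j, i)\<in>{..N} \<times> {..N}. ?E (?c j) * ?a i) M"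
      unfolding sum_product sum.cartesian_product ..
    also have "\<dots> = (\<Sum>(j, i)\<in>{..N} \<times> {..N}. fps_nth (?E (?c j) * ?a i) M)"
      by (simp add: fps_sum_nth case_prod_unfold)
    also have "\<dots> = (\<Sum>(j, i) | j + i \<le> N. fps_nth (?E (?c j) * ?a i) M)"
    proof (rule sum.mono_neutral_right)
      show "\<forall>p\<in>{..N} \<times> {..N} - {(j, i). j + i \<le> N}. (case p of (j, i) \<Rightarrow> fps_nth (?E (?c j) * ?a i) M) = 0"
      proof (rule ballI)
        fix p assume "p \<in> {..N} \<times> {..N} - {(j, i). j + i \<le> N}"
        then obtain j i where ji: "p = (j, i)" "M < j + i" using NM by (cases p) auto
        have "fps_nth (?E (?c j) * ?a i) M = 0"
          by (rule fps_mult_nth_zero[OF _ _ ji(2)])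
            (simp_all only: fps_nth_euler conn_term_subdegree[OF sz] all_term_subdegree[OF sz] mult_zero_right)
        then show "(case p of (j, i) \<Rightarrow> fps_nth (?E (?c j) * ?a i) M) = 0" using ji(1) by simp
      qed
    qed auto
    also have "\<dots> = (\<Sum>n\<le>N. \<Sum>j\<le>n. fps_nth (?E (?c j) * ?a (n - j)) M)"
      by (rule sum.triangle_reindex_eq)
    also have "\<dots> = (\<Sum>n\<le>N. fps_nth (?E (?a n)) M)"
      unfolding euler_all_term fps_sum_nth ..
    also have "\<dots> = fps_nth (?E ?F) M"
      unfolding F fps_nth_euler by (simp add: fps_sum_nth sum_distrib_left)
    finally show ?thesis .
  qed
  then have "?E ?L * ?F = ?E ?F" by (rule fps_ext)
  then have "fps_X * (fps_deriv ?L * ?F) = fps_X * fps_deriv ?F" by (simp only: mult.assoc)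
  then show ?thesis by simp
qed

lemma log_series_nth:
  fixes w :: "'p \<Rightarrow> 'b::field_char_0"
  assumes sz: "\<And>S. S \<in> P \<Longrightarrow> sz S \<ge> 1"
  shows "fps_nth (log_series w sz) m = (\<Sum>xs | set xs \<subseteq> P \<and> (\<Sum>S\<leftarrow>xs. sz S) = m. tuple_weight w xs)"
proof -
  have "fps_nth (conn_term w sz n) m =
    (\<Sum>xs | set xs \<subseteq> P \<and> length xs = n \<and> (\<Sum>S\<leftarrow>xs. sz S) = m. tuple_weight w xs)" for n
  proof -
    have "fps_nth (conn_term w sz n) m = (\<Sum>\<Gamma>| \<Gamma> \<in> PiE {..<n} (\<lambda>_. P) \<and> (\<Sum>i<n. sz (\<Gamma> i)) = m.
        1 / fact n * ((\<Prod>i<n. w (\<Gamma> i)) * conn_sum {..<n} (inc_edges inc {..<n} \<Gamma>)))"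
      unfolding fps_nth_conn_term
      by (rule sum.inter_filter[symmetric]) (use finite_P in \<open>auto intro: finite_PiE\<close>)
    also have "\<dots> = (\<Sum>xs | set xs \<subseteq> P \<and> length xs = n \<and> (\<Sum>S\<leftarrow>xs. sz S) = m. tuple_weight w xs)"
    proof (rule sum.reindex_bij_witness[where i = "\<lambda>xs. restrict ((!) xs) {..<n}" and j = "\<lambda>\<Gamma>. map \<Gamma> [0..<n]"], goal_cases)
      case (1 \<Gamma>)
      then show ?case by (auto simp: fun_eq_iff PiE_def extensional_def)
    next
      case (2 \<Gamma>)
      then show ?case by (auto simp: PiE_def Pi_def interv_sum_list_conv_sum_set_nat atLeast0LessThan)
    next
      case (3 xs)
      then show ?case by (auto intro!: nth_equalityI)
    next
      case (4 xs)
      then show ?case by (auto simp: PiE_def Pi_def sum_list_sum_nth atLeast0LessThan)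
    next
      case (5 \<Gamma>)
      have "inc_edges inc {..<n} ((!) (map \<Gamma> [0..<n])) = inc_edges inc {..<n} \<Gamma>"
        by (rule inc_edges_cong) simp
      moreover have "(\<Prod>S\<leftarrow>map \<Gamma> [0..<n]. w S) = (\<Prod>i<n. w (\<Gamma> i))"
        by (induction n) (auto simp: mult.commute)
      ultimately show ?case by (simp add: tuple_weight_def mult_ac)
    qed
    finally show ?thesis .
  qed
  then have "fps_nth (log_series w sz) m =
      (\<Sum>n\<le>m. \<Sum>xs | set xs \<subseteq> P \<and> length xs = n \<and> (\<Sum>S\<leftarrow>xs. sz S) = m. tuple_weight w xs)"
    by (simp add: log_series_def)
  also have "\<dots> = (\<Sum>n\<le>m. \<Sum>xs | xs \<in> {xs. set xs \<subseteq> P \<and> (\<Sum>S\<leftarrow>xs. sz S) = m} \<and> length xs = n. tuple_weight w xs)"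
    by (intro sum.cong refl) auto
  also have "\<dots> = (\<Sum>xs | set xs \<subseteq> P \<and> (\<Sum>S\<leftarrow>xs. sz S) = m. tuple_weight w xs)"
  proof (rule sum.group)
    have len: "length xs \<le> (\<Sum>S\<leftarrow>xs. sz S)" if "set xs \<subseteq> P" for xs
      using that sz by (induction xs) force+
    then show "length ` {xs. set xs \<subseteq> P \<and> (\<Sum>S\<leftarrow>xs. sz S) = m} \<subseteq> {..m}" by auto
    show "finite {xs. set xs \<subseteq> P \<and> (\<Sum>S\<leftarrow>xs. sz S) = m}"
      by (rule finite_subset[OF _ finite_lists_length_le[OF finite_P, of m]]) (use len in auto)
  qed auto
  finally show ?thesis .
qed

lemma partition_fn_eq_1:
  assumes "\<And>S. S \<in> P \<Longrightarrow> w S = (0 :: 'b::comm_semiring_1)"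
  shows "partition_fn inc w P = 1"
proof -
  have "(\<Prod>S\<in>X. w S) = (if X = {} then 1 else 0)" if "X \<in> compat_families inc P" for X
  proof (cases "X = {}")
    case False
    moreover have "finite X" "X \<subseteq> P" using that finite_P finite_subset by (auto simp: compat_families_def)
    ultimately obtain S where "S \<in> X" "w S = 0" using assms by blast
    then show ?thesis using \<open>finite X\<close> False prod.remove[of X S w] by simp
  qed simp
  moreover have "{} \<in> compat_families inc P" by (simp add: compat_families_def)
  ultimately show ?thesis
    using finite_compat_families[OF finite_P, of inc] by (simp add: partition_fn_def)
qed

lemma partition_fn_size_weight_poly:
  fixes w :: "'p \<Rightarrow> complex"
  obtains p where "partition_fn inc (size_weight w sz) P = fps_of_poly p"
    "\<And>z. poly p z = partition_fn inc (\<lambda>S. w S * z ^ sz S) P"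
proof
  let ?p = "partition_fn inc (\<lambda>S. monom (w S) (sz S)) P"
  show "partition_fn inc (size_weight w sz) P = fps_of_poly ?p"
    unfolding partition_fn_def fps_of_poly_sum fps_of_poly_prod fps_of_poly_monom ..
  show "poly ?p z = partition_fn inc (\<lambda>S. w S * z ^ sz S) P" for z
    unfolding partition_fn_def poly_sum poly_prod poly_monom ..
qed

lemma tuple_weight_of_real: "tuple_weight (\<lambda>S. complex_of_real (w S)) xs = of_real (tuple_weight w xs)"
proof -
  have "(\<Prod>S\<leftarrow>xs. complex_of_real (w S)) = of_real (\<Prod>S\<leftarrow>xs. w S)"
    by (induction xs) auto
  moreover have "conn_sum V E = complex_of_real (conn_sum V E)" for V :: "nat set" and E
    unfolding conn_sum_def by simp
  ultimately show ?thesis unfolding tuple_weight_def by simp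
qed

lemma cluster_expansion_truncation:
  fixes w :: "'p \<Rightarrow> real" and sz :: "'p \<Rightarrow> nat" and R D :: real
  assumes sz: "\<And>S. S \<in> P \<Longrightarrow> sz S \<ge> 1" and w: "\<And>S. S \<in> P \<Longrightarrow> w S \<ge> 0" and R: "R \<ge> 2"
    and KP: "\<And>S. S \<in> P \<Longrightarrow> (\<Sum>T | T \<in> P \<and> inc S T. w T * (2 * R) ^ sz T * exp (sz T)) \<le> sz S"
    and D: "(\<Sum>S\<in>P. sz S * (w S * (2 * R) ^ sz S * exp (sz S))) \<le> D"
  shows "\<bar>ln (partition_fn inc w P) -
      (\<Sum>m=1..t. \<Sum>xs | set xs \<subseteq> P \<and> (\<Sum>S\<leftarrow>xs. sz S) = m. tuple_weight w xs)\<bar> \<le> D / R ^ Suc t"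
proof -
  define v where "v = (\<lambda>S. complex_of_real (w S))"
  let ?\<Xi> = "\<lambda>z. partition_fn inc (\<lambda>S. v S * z ^ sz S) P"
  let ?F = "partition_fn inc (size_weight v sz) P" and ?L = "log_series v sz"
  obtain p where p: "?F = fps_of_poly p" "\<And>z. poly p z = ?\<Xi> z"
    using partition_fn_size_weight_poly[of v sz] by blast
  have evalF: "eval_fps ?F = ?\<Xi>" using p by (simp add: fun_eq_iff)
  have KPz: "(\<Sum>T | T \<in> P \<and> inc S T. norm (v T * z ^ sz T) * exp (sz T)) \<le> sz S"
    if "norm z < 2 * R" "S \<in> P" for z S
  proof -
    have "(\<Sum>T | T \<in> P \<and> inc S T. norm (v T * z ^ sz T) * exp (sz T)) \<le>
      (\<Sum>T | T \<in> P \<and> inc S T. w T * (2 * R) ^ sz T * exp (sz T))"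
    proof (rule sum_mono)
      fix T assume "T \<in> {T. T \<in> P \<and> inc S T}"
      then have "w T \<ge> 0" using w by blast
      moreover have "norm z ^ sz T \<le> (2 * R) ^ sz T" using that(1) by (intro power_mono) auto
      ultimately have "w T * norm z ^ sz T * exp (sz T) \<le> w T * (2 * R) ^ sz T * exp (sz T)"
        by (intro mult_right_mono mult_left_mono) auto
      then show "norm (v T * z ^ sz T) * exp (sz T) \<le> w T * (2 * R) ^ sz T * exp (sz T)"
        using \<open>w T \<ge> 0\<close> by (simp only: v_def norm_mult norm_power norm_of_real abs_of_nonneg)
    qed
    then show ?thesis using KP[OF that(2)] by linarith
  qed
  have nz: "?\<Xi> z \<noteq> 0" if "norm z < 2 * R" for z
    using kotecky_preiss[OF KPz[OF that] order_refl] by blast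
  have bound: "norm (deriv ?\<Xi> z) \<le> D / (2 * R) * norm (?\<Xi> z)" if z: "norm z < 2 * R" for z
  proof -
    have "deriv ?\<Xi> z = (\<Sum>S\<in>P. v S * (of_nat (sz S) * z ^ (sz S - 1)) *
       partition_fn inc (\<lambda>S. v S * z ^ sz S) {T\<in>P. \<not> inc S T})"
      by (rule DERIV_imp_deriv[OF has_field_derivative_partition_fn])
    then have "norm (deriv ?\<Xi> z) \<le> (\<Sum>S\<in>P. norm (v S * (of_nat (sz S) * z ^ (sz S - 1)) *
       partition_fn inc (\<lambda>S. v S * z ^ sz S) {T\<in>P. \<not> inc S T}))"
      by (simp only: norm_sum)
    also have "\<dots> \<le> (\<Sum>S\<in>P. sz S * (w S * (2 * R) ^ sz S * exp (sz S)) / (2 * R) * norm (?\<Xi> z))"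
    proof (rule sum_mono)
      fix S assume S: "S \<in> P"
      have "norm z ^ (sz S - 1) \<le> (2 * R) ^ (sz S - 1)"
        using z by (intro power_mono) auto
      also have "\<dots> = (2 * R) ^ sz S / (2 * R)"
        using sz[OF S] R by (cases "sz S") auto
      finally have pw: "norm z ^ (sz S - 1) \<le> (2 * R) ^ sz S / (2 * R)" .
      have "norm (v S * (of_nat (sz S) * z ^ (sz S - 1)) *
         partition_fn inc (\<lambda>S. v S * z ^ sz S) {T\<in>P. \<not> inc S T}) =
         w S * sz S * norm z ^ (sz S - 1) * norm (partition_fn inc (\<lambda>S. v S * z ^ sz S) {T\<in>P. \<not> inc S T})"
        using w[OF S] by (simp add: norm_mult norm_power v_def)
      also have "\<dots> \<le> w S * sz S * ((2 * R) ^ sz S / (2 * R)) * (exp (sz S) * norm (?\<Xi> z))"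
        using w[OF S] R kotecky_preiss_ratio[OF KPz[OF z] S] pw
        by (intro mult_mono mult_left_mono) auto
      also have "\<dots> = sz S * (w S * (2 * R) ^ sz S * exp (sz S)) / (2 * R) * norm (?\<Xi> z)"
        by (simp add: field_simps)
      finally show "norm (v S * (of_nat (sz S) * z ^ (sz S - 1)) *
         partition_fn inc (\<lambda>S. v S * z ^ sz S) {T\<in>P. \<not> inc S T}) \<le>
         sz S * (w S * (2 * R) ^ sz S * exp (sz S)) / (2 * R) * norm (?\<Xi> z)" .
    qed
    also have "\<dots> = (\<Sum>S\<in>P. sz S * (w S * (2 * R) ^ sz S * exp (sz S))) / (2 * R) * norm (?\<Xi> z)"
      by (simp add: sum_distrib_right sum_divide_distrib)
    also have "\<dots> \<le> D / (2 * R) * norm (?\<Xi> z)"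
      using D R by (intro mult_right_mono divide_right_mono) auto
    finally show ?thesis .
  qed
  have "0 \<le> (\<Sum>S\<in>P. sz S * (w S * (2 * R) ^ sz S * exp (sz S)))"
    using w R by (intro sum_nonneg) auto
  then have "D \<ge> 0" using D by linarith
  have "\<exists>l. exp l = eval_fps ?F 1 \<and> norm (l - (\<Sum>m\<le>t. fps_nth ?L m)) \<le> 2 * (D / (2 * R)) / R ^ t"
  proof (rule log_power_series_tail)
    show "fps_conv_radius ?F = \<infinity>" by (simp add: p(1))
    have "fps_nth ?F 0 = poly p 0" by (simp add: p(1) poly_0_coeff_0)
    also have "\<dots> = 1" unfolding p(2) using sz by (intro partition_fn_eq_1) (auto simp: power_0_left dest!: sz)
    finally show "fps_nth ?F 0 = 1" .
    have "fps_nth ?L 0 = 0" by (simp add: log_series_def fps_nth_conn_term conn_sum_def graph_connected_def)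
    then show "fps_nth ?L 0 = 0" .
    show "fps_deriv ?L * ?F = fps_deriv ?F" by (rule log_series_ode[OF sz])
  qed (use R nz bound \<open>D \<ge> 0\<close> in \<open>auto simp: evalF\<close>)
  then obtain l where l: "exp l = eval_fps ?F 1" "norm (l - (\<Sum>m\<le>t. fps_nth ?L m)) \<le> 2 * (D / (2 * R)) / R ^ t"
    by blast
  let ?c = "\<lambda>m. \<Sum>xs | set xs \<subseteq> P \<and> (\<Sum>S\<leftarrow>xs. sz S) = m. tuple_weight w xs"
  define C where "C = (\<Sum>m=1..t. ?c m)"
  have L: "fps_nth ?L m = of_real (?c m)" for m
  proof -
    have "fps_nth ?L m = (\<Sum>xs | set xs \<subseteq> P \<and> (\<Sum>S\<leftarrow>xs. sz S) = m. tuple_weight v xs)"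
      by (rule log_series_nth[OF sz])
    then show ?thesis unfolding v_def tuple_weight_of_real of_real_sum .
  qed
  have "fps_nth ?L 0 = 0" by (simp add: log_series_def fps_nth_conn_term conn_sum_def graph_connected_def)
  then have "(\<Sum>m\<le>t. fps_nth ?L m) = (\<Sum>m=1..t. fps_nth ?L m)"
    by (intro sum.mono_neutral_right) (auto simp: not_less_eq_eq)
  also have "\<dots> = of_real C" unfolding L C_def of_real_sum ..
  finally have Lsum: "(\<Sum>m\<le>t. fps_nth ?L m) = of_real C" .
  have "eval_fps ?F 1 = of_real (partition_fn inc w P)"
    unfolding evalF by (simp add: partition_fn_def v_def)
  then have "exp l = of_real (partition_fn inc w P)" using l(1) by simp
  moreover have "partition_fn inc w P \<ge> 0"
    unfolding partition_fn_def using w by (intro sum_nonneg prod_nonneg) (auto simp: compat_families_def)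
  ultimately have "exp (Re l) = partition_fn inc w P"
    using norm_exp_eq_Re[of l] by simp
  then have "ln (partition_fn inc w P) = Re l" by (simp flip: \<open>exp (Re l) = _\<close>)
  moreover have "\<bar>Re l - C\<bar> \<le> norm (l - of_real C)"
    using abs_Re_le_cmod[of "l - of_real C"] by simp
  moreover have "norm (l - of_real C) \<le> D / R ^ Suc t"
    using l(2) unfolding Lsum by (simp add: mult.commute)
  ultimately show ?thesis unfolding C_def by linarith
qed

end

section \<open>Weights and matchings in the link\<close>

definition avoid :: "'a set set \<Rightarrow> 'a set \<Rightarrow> nat" where
  "avoid E N = card {X. X \<subseteq> N \<and> \<not> (\<exists>e\<in>E. e \<subseteq> X)}"

lemma finite_avoid: "finite N \<Longrightarrow> finite {X. X \<subseteq> N \<and> \<not> (\<exists>e\<in>E. e \<subseteq> X)}"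
  by (rule finite_subset[of _ "Pow N"]) auto

lemma avoid_empty: "finite N \<Longrightarrow> avoid {} N = 2 ^ card N"
  by (simp add: avoid_def card_Pow flip: Pow_def)

lemma avoid_antimono:
  assumes "E \<subseteq> E'" "finite N"
  shows "avoid E' N \<le> avoid E N"
  unfolding avoid_def using assms finite_avoid[OF assms(2), of E] by (intro card_mono) auto

lemma avoid_Un:
  assumes fin: "finite N" "finite N'" and disj: "N \<inter> N' = {}"
    and E: "\<And>e. e \<in> E \<Longrightarrow> e \<subseteq> N" and E': "\<And>e. e \<in> E' \<Longrightarrow> e \<subseteq> N'"
  shows "avoid (E \<union> E') (N \<union> N') = avoid E N * avoid E' N'"
proof -
  let ?A = "\<lambda>E N. {X. X \<subseteq> N \<and> \<not> (\<exists>e\<in>E. e \<subseteq> X)}"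
  have "bij_betw (\<lambda>(X, Y). X \<union> Y) (?A E N \<times> ?A E' N') (?A (E \<union> E') (N \<union> N'))"
  proof (rule bij_betw_byWitness[where f' = "\<lambda>X. (X \<inter> N, X \<inter> N')"])
    show "\<forall>p\<in>?A E N \<times> ?A E' N'. (\<lambda>X. (X \<inter> N, X \<inter> N')) ((\<lambda>(X, Y). X \<union> Y) p) = p"
      using disj by auto
    show "\<forall>X\<in>?A (E \<union> E') (N \<union> N'). (\<lambda>(X, Y). X \<union> Y) (X \<inter> N, X \<inter> N') = X"
      by auto
    show "(\<lambda>(X, Y). X \<union> Y) ` (?A E N \<times> ?A E' N') \<subseteq> ?A (E \<union> E') (N \<union> N')"
    proof (rule image_subsetI)
      fix p assume "p \<in> ?A E N \<times> ?A E' N'"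
      then obtain X Y where p: "p = (X, Y)" "X \<subseteq> N" "Y \<subseteq> N'"
        "\<forall>e\<in>E. \<not> e \<subseteq> X" "\<forall>e\<in>E'. \<not> e \<subseteq> Y" by auto
      have "\<not> e \<subseteq> X \<union> Y" if "e \<in> E" for e
      proof
        assume "e \<subseteq> X \<union> Y"
        then have "e \<subseteq> X" using E[OF that] p(3) disj by auto
        then show False using p(4) that by simp
      qed
      moreover have "\<not> e \<subseteq> X \<union> Y" if "e \<in> E'" for e
      proof
        assume "e \<subseteq> X \<union> Y"
        then have "e \<subseteq> Y" using E'[OF that] p(2) disj by auto
        then show False using p(5) that by simp
      qed
      ultimately show "(\<lambda>(X, Y). X \<union> Y) p \<in> ?A (E \<union> E') (N \<union> N')"
        using p(1,2,3) by auto
    qed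
    show "(\<lambda>X. (X \<inter> N, X \<inter> N')) ` ?A (E \<union> E') (N \<union> N') \<subseteq> ?A E N \<times> ?A E' N'"
      by auto
  qed
  then have "card (?A (E \<union> E') (N \<union> N')) = card (?A E N \<times> ?A E' N')"
    by (rule bij_betw_same_card[symmetric])
  then show ?thesis by (simp add: avoid_def card_cartesian_product)
qed

lemma avoid_superset:
  assumes "finite N'" "N \<subseteq> N'" "\<And>e. e \<in> E \<Longrightarrow> e \<subseteq> N"
  shows "real (avoid E N') / 2 ^ card N' = real (avoid E N) / 2 ^ card N"
proof -
  have fin: "finite N" "finite (N' - N)" using assms finite_subset by auto
  have eq: "N \<union> (N' - N) = N'" using assms(2) by auto
  have "avoid (E \<union> {}) (N \<union> (N' - N)) = avoid E N * avoid {} (N' - N)"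
    using fin assms(3) by (intro avoid_Un) auto
  then have "avoid E N' = avoid E N * 2 ^ card (N' - N)"
    unfolding eq Un_empty_right avoid_empty[OF fin(2)] .
  moreover have "card N' = card N + card (N' - N)"
    using assms(1,2) fin by (metis card_Un_disjoint Diff_disjoint eq)
  ultimately show ?thesis by (simp add: power_add)
qed

lemma avoid_singleton:
  assumes "finite e"
  shows "avoid {e} e = 2 ^ card e - 1"
proof -
  have "{X. X \<subseteq> e \<and> \<not> (\<exists>e'\<in>{e}. e' \<subseteq> X)} = Pow e - {e}" by auto
  then show ?thesis using assms by (simp add: avoid_def card_Pow)
qed

lemma avoid_matching:
  assumes "finite M" "disjoint M" "\<And>e. e \<in> M \<Longrightarrow> card e = q" "q > 0"
  shows "avoid M (\<Union>M) = (2 ^ q - 1) ^ card M \<and> card (\<Union>M) = q * card M \<and> finite (\<Union>M)"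
  using assms(1,2,3)
proof (induction M rule: finite_induct)
  case empty
  have "{X. X = {}} = {{} :: 'a set}" by auto
  then show ?case by (simp add: avoid_def)
next
  case (insert e M)
  have IH: "avoid M (\<Union>M) = (2 ^ q - 1) ^ card M" "card (\<Union>M) = q * card M" "finite (\<Union>M)"
    using insert.IH insert.prems by (auto simp: disjoint_def)
  have e: "card e = q" using insert.prems by auto
  then have fe: "finite e" using assms(4) card.infinite by fastforce
  have disj: "e \<inter> \<Union>M = {}" using insert.prems(1) insert.hyps(2) by (auto simp: disjoint_def)
  have "avoid ({e} \<union> M) (e \<union> \<Union>M) = avoid {e} e * avoid M (\<Union>M)"
    using fe IH(3) disj by (intro avoid_Un) auto
  then have "avoid (insert e M) (\<Union>(insert e M)) = (2 ^ q - 1) ^ card (insert e M)"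
    using insert.hyps by (simp add: avoid_singleton[OF fe] e IH(1))
  moreover have "card (\<Union>(insert e M)) = q * card (insert e M)"
    using insert.hyps card_Un_disjoint[OF fe IH(3) disj] by (simp add: e IH(2))
  ultimately show ?case using fe IH(3) by simp
qed

locale regular_partite =
  fixes G :: "'a hypergraph" and \<Z> :: "'a set set" and k n r :: nat
  assumes uniform: "uniform_hypergraph k G" and partite: "partite_with k G \<Z>"
    and regular: "regular r G" and part_size: "\<And>Z. Z \<in> \<Z> \<Longrightarrow> card Z = n"
    and k_ge: "k \<ge> 2" and r_ge: "r \<ge> 1"
begin

lemma finite_verts: "finite (verts G)"
  using uniform by (simp add: uniform_hypergraph_def)

lemma edge_subset: "e \<in> edges G \<Longrightarrow> e \<subseteq> verts G"
  and card_edge: "e \<in> edges G \<Longrightarrow> card e = k"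
  using uniform by (auto simp: uniform_hypergraph_def)

lemma finite_edge: "e \<in> edges G \<Longrightarrow> finite e"
  using edge_subset finite_verts finite_subset by blast

lemma finite_edges: "finite (edges G)"
  by (rule finite_subset[of _ "Pow (verts G)"]) (use edge_subset finite_verts in auto)

lemma Union_parts: "\<Union>\<Z> = verts G" and disjoint_parts: "disjoint \<Z>" and card_parts: "card \<Z> = k"
  using partite by (auto simp: partite_with_def partition_on_def)

lemma finite_parts: "finite \<Z>"
  using card_parts k_ge card.infinite by fastforce

lemma part_subset: "Z \<in> \<Z> \<Longrightarrow> Z \<subseteq> verts G"
  using Union_parts by auto

lemma finite_part: "Z \<in> \<Z> \<Longrightarrow> finite Z"
  by (rule finite_subset[OF part_subset finite_verts])

lemma parts_disjoint: "Z \<in> \<Z> \<Longrightarrow> Z' \<in> \<Z> \<Longrightarrow> Z \<noteq> Z' \<Longrightarrow> Z \<inter> Z' = {}"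
  using disjoint_parts by (auto simp: disjoint_def)

lemma card_edge_part: "e \<in> edges G \<Longrightarrow> Z \<in> \<Z> \<Longrightarrow> card (e \<inter> Z) = 1"
  using partite by (auto simp: partite_with_def)

lemma edge_part_singleton:
  assumes "e \<in> edges G" "Z \<in> \<Z>"
  obtains v where "e \<inter> Z = {v}"
  using card_edge_part[OF assms] by (auto simp: card_1_singleton_iff)

lemma edge_part_unique: "e \<in> edges G \<Longrightarrow> Z \<in> \<Z> \<Longrightarrow> v \<in> e \<Longrightarrow> v \<in> Z \<Longrightarrow> e \<inter> Z = {v}"
  by (metis IntI edge_part_singleton singletonD)

lemma card_edge_minus_part: "e \<in> edges G \<Longrightarrow> Z \<in> \<Z> \<Longrightarrow> card (e - Z) = k - 1"
  using card_edge_part[of e Z] card_edge[of e] card_Diff_subset_Int[of e Z] finite_edge[of e] by simp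

lemma edge_minus_part_nonempty:
  assumes "e \<in> edges G" "Z \<in> \<Z>"
  shows "e - Z \<noteq> {}"
proof
  assume "e - Z = {}"
  then have "card (e - Z) = 0" by (simp only: card.empty)
  then show False using card_edge_minus_part[OF assms] k_ge by simp
qed

lemma card_verts: "card (verts G) = k * n"
proof -
  have "card (\<Union>\<Z>) = (\<Sum>Z\<in>\<Z>. card Z)"
    using disjoint_parts finite_part by (intro card_Union_disjoint) auto
  then show ?thesis by (simp add: Union_parts part_size card_parts)
qed

lemma card_verts_minus_part: "Z \<in> \<Z> \<Longrightarrow> card (verts G - Z) = (k - 1) * n"
  using card_verts card_Diff_subset[of Z "verts G"] finite_part[of Z] part_subset[of Z] part_size[of Z]
  by (simp add: diff_mult_distrib)

definition star :: "'a set \<Rightarrow> 'a set set" where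
  "star S = {e \<in> edges G. e \<inter> S \<noteq> {}}"

lemma finite_star: "finite (star S)"
  using finite_edges by (simp add: star_def)

lemma card_star_singleton: "v \<in> verts G \<Longrightarrow> card (star {v}) = r"
  using regular by (simp add: star_def regular_def Int_commute)

end

locale partite_class = regular_partite +
  fixes Z :: "'a set"
  assumes Z: "Z \<in> \<Z>"
begin

definition links :: "'a set \<Rightarrow> 'a set set" where
  "links S = (\<lambda>e. e - Z) ` star S"

lemma star_Int: "S \<subseteq> Z \<Longrightarrow> e \<in> star S \<Longrightarrow> e \<inter> Z \<subseteq> S"
proof -
  assume S: "S \<subseteq> Z" and "e \<in> star S"
  then obtain v where v: "e \<in> edges G" "v \<in> e" "v \<in> S" "v \<in> Z" by (auto simp: star_def)
  then show ?thesis using edge_part_unique[OF v(1) Z v(2,4)] by auto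
qed

lemma star_minus: "S \<subseteq> Z \<Longrightarrow> e \<in> star S \<Longrightarrow> e - S = e - Z"
  using star_Int[of S e] by auto

lemma nbhd_eq: "S \<subseteq> Z \<Longrightarrow> nbhd G S = \<Union>(links S)"
proof -
  assume S: "S \<subseteq> Z"
  have "nbhd G S = (\<Union>e\<in>star S. e - S)" by (auto simp: nbhd_def star_def)
  also have "\<dots> = (\<Union>e\<in>star S. e - Z)" using star_minus[OF S] by simp
  finally show ?thesis by (simp add: links_def)
qed

lemma nbhd_subset: "S \<subseteq> Z \<Longrightarrow> nbhd G S \<subseteq> verts G - Z"
  using edge_subset by (auto simp: nbhd_eq links_def star_def)

lemma finite_nbhd: "S \<subseteq> Z \<Longrightarrow> finite (nbhd G S)"
  by (rule finite_subset[OF nbhd_subset]) (use finite_verts in auto)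

lemma star_Union: "star (\<Union>X) = (\<Union>S\<in>X. star S)"
  by (auto simp: star_def)

lemma star_mono: "S \<subseteq> T \<Longrightarrow> star S \<subseteq> star T"
  by (auto simp: star_def)

lemma links_Un: "links (S \<union> T) = links S \<union> links T"
  by (auto simp: links_def star_def)

lemma links_mono: "S \<subseteq> T \<Longrightarrow> links S \<subseteq> links T"
  unfolding links_def by (intro image_mono star_mono)

lemma links_subset: "e \<in> links S \<Longrightarrow> e \<subseteq> verts G - Z"
  using edge_subset by (auto simp: links_def star_def)

lemma nbhd_UN: "S \<subseteq> Z \<Longrightarrow> nbhd G S = (\<Union>v\<in>S. nbhd G {v})"
proof -
  assume S: "S \<subseteq> Z"
  have "(\<Union>v\<in>S. nbhd G {v}) = (\<Union>v\<in>S. \<Union>(links {v}))"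
    using S by (intro SUP_cong refl nbhd_eq) auto
  also have "\<dots> = \<Union>(links S)" by (auto simp: links_def star_def)
  finally show ?thesis using nbhd_eq[OF S] by simp
qed

lemma nbhd_Union: "(\<And>S. S \<in> X \<Longrightarrow> S \<subseteq> Z) \<Longrightarrow> nbhd G (\<Union>X) = (\<Union>S\<in>X. nbhd G S)"
proof -
  assume X: "\<And>S. S \<in> X \<Longrightarrow> S \<subseteq> Z"
  then have "nbhd G (\<Union>X) = \<Union>(links (\<Union>X))" by (intro nbhd_eq) auto
  also have "\<dots> = (\<Union>S\<in>X. \<Union>(links S))" by (auto simp: links_def star_Union)
  finally show ?thesis using X by (simp add: nbhd_eq)
qed

lemma card_star: "S \<subseteq> Z \<Longrightarrow> card (star S) = r * card S"
proof -
  assume S: "S \<subseteq> Z"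
  have finS: "finite S" using S finite_part[OF Z] finite_subset by auto
  have "star S = (\<Union>v\<in>S. star {v})" by (auto simp: star_def)
  also have "card \<dots> = (\<Sum>v\<in>S. card (star {v}))"
  proof (rule card_UN_disjoint)
    show "\<forall>u\<in>S. \<forall>v\<in>S. u \<noteq> v \<longrightarrow> star {u} \<inter> star {v} = {}"
    proof (intro ballI impI equals0I)
      fix u v e assume uv: "u \<in> S" "v \<in> S" "u \<noteq> v" "e \<in> star {u} \<inter> star {v}"
      then have e: "e \<in> edges G" "u \<in> e" "v \<in> e" "u \<in> Z" "v \<in> Z" using S by (auto simp: star_def)
      then show False using uv(3) edge_part_unique[OF e(1) Z e(2,4)] edge_part_unique[OF e(1) Z e(3,5)] by auto
    qed
  qed (use finS finite_star in auto)
  also have "\<dots> = (\<Sum>v\<in>S. r)"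
    using S part_subset[OF Z] by (intro sum.cong refl card_star_singleton) auto
  finally show ?thesis by simp
qed

lemma polymer_weight_eq:
  assumes "S \<subseteq> Z"
  shows "polymer_weight G S = real (avoid (links S) (verts G - Z)) / 2 ^ ((k - 1) * n)"
proof -
  have "edges (link_graph G S) = (\<lambda>e. e - S) ` star S"
    by (auto simp: link_graph_def star_def)
  also have "\<dots> = links S"
    unfolding links_def using star_minus[OF assms] by (intro image_cong) auto
  finally have "indep_sets (link_graph G S) = {X. X \<subseteq> nbhd G S \<and> \<not> (\<exists>e\<in>links S. e \<subseteq> X)}"
    by (simp add: indep_sets_def link_graph_def)
  then have "polymer_weight G S = real (avoid (links S) (nbhd G S)) / 2 ^ card (nbhd G S)"
    by (simp add: polymer_weight_def avoid_def)
  also have "\<dots> = real (avoid (links S) (verts G - Z)) / 2 ^ card (verts G - Z)"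
    using finite_verts nbhd_subset[OF assms] nbhd_eq[OF assms]
    by (intro avoid_superset[symmetric]) auto
  finally show ?thesis by (simp add: card_verts_minus_part[OF Z])
qed

lemma polymer_weight_nonneg: "polymer_weight G S \<ge> 0"
  by (simp add: polymer_weight_def)

lemma polymer_weight_empty: "polymer_weight G {} = 1"
proof -
  have "links {} = {}" by (simp add: links_def star_def)
  then show ?thesis using polymer_weight_eq[of "{}"] finite_verts
    by (simp add: avoid_empty card_verts_minus_part[OF Z])
qed

lemma polymer_weight_antimono:
  assumes "S \<subseteq> T" "T \<subseteq> Z"
  shows "polymer_weight G T \<le> polymer_weight G S"
proof -
  have "avoid (links T) (verts G - Z) \<le> avoid (links S) (verts G - Z)"
    using finite_verts by (intro avoid_antimono links_mono assms) auto
  then show ?thesis using assms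
    by (simp add: polymer_weight_eq divide_right_mono)
qed

lemma polymer_weight_Un:
  assumes "S \<subseteq> Z" "T \<subseteq> Z" "nbhd G S \<inter> nbhd G T = {}"
  shows "polymer_weight G (S \<union> T) = polymer_weight G S * polymer_weight G T"
proof -
  let ?q = "\<lambda>S N. real (avoid (links S) N) / 2 ^ card N"
  have q: "polymer_weight G S = ?q S N" if "S \<subseteq> Z" "nbhd G S \<subseteq> N" "N \<subseteq> verts G - Z" for S N
  proof -
    have "?q S (verts G - Z) = ?q S N"
      using that nbhd_eq[OF that(1)] finite_verts by (intro avoid_superset) auto
    then show ?thesis using polymer_weight_eq[OF that(1)] by (simp add: card_verts_minus_part[OF Z])
  qed
  have fin: "finite (nbhd G S)" "finite (nbhd G T)" using finite_nbhd assms by auto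
  have "avoid (links S \<union> links T) (nbhd G S \<union> nbhd G T) = avoid (links S) (nbhd G S) * avoid (links T) (nbhd G T)"
    using fin assms(3) by (intro avoid_Un) (auto simp: nbhd_eq assms)
  moreover have "card (nbhd G S \<union> nbhd G T) = card (nbhd G S) + card (nbhd G T)"
    using fin assms(3) by (intro card_Un_disjoint) auto
  moreover have "nbhd G (S \<union> T) = nbhd G S \<union> nbhd G T"
    using nbhd_Union[of "{S, T}"] assms by auto
  moreover have "polymer_weight G (S \<union> T) = ?q (S \<union> T) (nbhd G (S \<union> T))"
    using assms by (intro q nbhd_subset) auto
  moreover have "polymer_weight G S = ?q S (nbhd G S)" "polymer_weight G T = ?q T (nbhd G T)"
    using assms by (auto intro!: q nbhd_subset)
  ultimately show ?thesis by (simp add: links_Un power_add)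
qed

end

lemma gam_gt_1: "k \<ge> 2 \<Longrightarrow> gam k > 1"
proof -
  assume "k \<ge> 2"
  then have "(2::real) ^ 1 \<le> 2 ^ (k - 1)" by (intro power_increasing) auto
  then show ?thesis by (simp add: gam_def field_simps)
qed

lemma inverse_gam: "inverse (gam k) = (2 ^ (k - 1) - 1) / 2 ^ (k - 1)"
  by (simp add: gam_def)

lemma card_Diff_add_card: "finite A \<Longrightarrow> B \<subseteq> A \<Longrightarrow> card (A - B) + card B = card A"
  by (metis Diff_disjoint Diff_partition Int_commute Un_commute card_Un_disjoint finite_Diff finite_subset)

context partite_class
begin

lemma card_nbhd_Int:
  assumes "S \<subseteq> Z" "Z' \<in> \<Z>" "Z' \<noteq> Z"
  shows "card ((\<lambda>e. e \<inter> Z') ` star S) = card (nbhd G S \<inter> Z')"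
proof -
  have ZZ: "Z' \<inter> Z = {}" using parts_disjoint[OF assms(2) Z assms(3)] .
  have "(\<lambda>e. e \<inter> Z') ` star S = (\<lambda>x. {x}) ` (nbhd G S \<inter> Z')"
  proof (intro equalityI subsetI)
    fix A assume "A \<in> (\<lambda>e. e \<inter> Z') ` star S"
    then obtain e where e: "e \<in> star S" "A = e \<inter> Z'" by auto
    then obtain x where x: "A = {x}" using edge_part_singleton[of e Z'] assms(2) by (auto simp: star_def)
    then have "x \<in> e - Z" "x \<in> Z'" using e ZZ by auto
    then have "x \<in> nbhd G S" using e(1) by (auto simp: nbhd_eq[OF assms(1)] links_def)
    then show "A \<in> (\<lambda>x. {x}) ` (nbhd G S \<inter> Z')" using x \<open>x \<in> Z'\<close> by auto
  next
    fix A assume "A \<in> (\<lambda>x. {x}) ` (nbhd G S \<inter> Z')"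
    then obtain x where x: "A = {x}" "x \<in> nbhd G S" "x \<in> Z'" by auto
    then obtain e where e: "e \<in> star S" "x \<in> e" by (auto simp: nbhd_eq[OF assms(1)] links_def)
    then have "e \<inter> Z' = {x}" using edge_part_unique[of e Z' x] assms(2) x by (auto simp: star_def)
    then show "A \<in> (\<lambda>e. e \<inter> Z') ` star S" using e x by auto
  qed
  then show ?thesis by (simp add: card_image)
qed

lemma card_nbhd:
  assumes "S \<subseteq> Z"
  shows "card (nbhd G S) = (\<Sum>Z'\<in>\<Z> - {Z}. card (nbhd G S \<inter> Z'))"
proof -
  have "nbhd G S \<subseteq> \<Union>\<Z> - Z" using nbhd_subset[OF assms] by (simp add: Union_parts)
  then have "nbhd G S = (\<Union>Z'\<in>\<Z> - {Z}. nbhd G S \<inter> Z')" by auto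
  also have "card \<dots> = (\<Sum>Z'\<in>\<Z> - {Z}. card (nbhd G S \<inter> Z'))"
  proof (rule card_UN_disjoint)
    show "\<forall>A\<in>\<Z> - {Z}. \<forall>B\<in>\<Z> - {Z}. A \<noteq> B \<longrightarrow> (nbhd G S \<inter> A) \<inter> (nbhd G S \<inter> B) = {}"
    proof (intro ballI impI)
      fix A B assume "A \<in> \<Z> - {Z}" "B \<in> \<Z> - {Z}" "A \<noteq> B"
      then have "A \<inter> B = {}" using parts_disjoint by auto
      then show "(nbhd G S \<inter> A) \<inter> (nbhd G S \<inter> B) = {}" by auto
    qed
  qed (use finite_parts finite_nbhd[OF assms] in auto)
  finally show ?thesis .
qed

text \<open>In every other class keep one link edge per neighbour; the edges kept in all classes form a
  matching, and the number of edges lost is at most the total multiplicity defect.\<close>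

lemma link_matching:
  assumes S: "S \<subseteq> Z"
  obtains M where "M \<subseteq> links S" "disjoint M"
    "card (nbhd G S) \<le> card M + (k - 2) * (r * card S)"
proof -
  have "\<exists>E\<subseteq>star S. inj_on (\<lambda>e. e \<inter> Z') E \<and> (\<lambda>e. e \<inter> Z') ` star S = (\<lambda>e. e \<inter> Z') ` E" for Z'
    using subset_image_inj[of "(\<lambda>e. e \<inter> Z') ` star S" "\<lambda>e. e \<inter> Z'" "star S"] by blast
  then obtain E where E: "\<And>Z'. E Z' \<subseteq> star S" "\<And>Z'. inj_on (\<lambda>e. e \<inter> Z') (E Z')"
    "\<And>Z'. (\<lambda>e. e \<inter> Z') ` star S = (\<lambda>e. e \<inter> Z') ` E Z'"
    by metis
  define M0 where "M0 = {e \<in> star S. \<forall>Z'\<in>\<Z> - {Z}. e \<in> E Z'}"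
  have finM0: "finite M0" using finite_star by (simp add: M0_def)
  have cardE: "card (E Z') = card (nbhd G S \<inter> Z')" if "Z' \<in> \<Z> - {Z}" for Z'
    using card_image[OF E(2), of Z'] card_nbhd_Int[OF S, of Z'] E(3)[of Z'] that by simp
  have dj: "(e - Z) \<inter> (e' - Z) = {}" if "e \<in> M0" "e' \<in> M0" "e \<noteq> e'" for e e'
  proof (rule equals0I)
    fix x assume x: "x \<in> (e - Z) \<inter> (e' - Z)"
    have ee: "e \<in> edges G" "e' \<in> edges G" using that by (auto simp: M0_def star_def)
    then have "x \<in> \<Union>\<Z>" using x edge_subset Union_parts by auto
    then obtain Z' where Z': "Z' \<in> \<Z>" "x \<in> Z'" by auto
    then have "Z' \<in> \<Z> - {Z}" using x by auto
    then have "e \<in> E Z'" "e' \<in> E Z'" using that by (auto simp: M0_def)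
    moreover have "e \<inter> Z' = {x}" "e' \<inter> Z' = {x}"
      using ee Z' x edge_part_unique[of e Z' x] edge_part_unique[of e' Z' x] by simp_all
    ultimately have "e = e'" using inj_onD[OF E(2)[of Z'], of e e'] by simp
    then show False using that by simp
  qed
  have ne: "e - Z \<noteq> {}" if "e \<in> star S" for e
    using edge_minus_part_nonempty[OF _ Z, of e] that by (simp add: star_def)
  have inj: "inj_on (\<lambda>e. e - Z) M0"
  proof (rule inj_onI, rule ccontr)
    fix e e' assume h: "e \<in> M0" "e' \<in> M0" "e - Z = e' - Z" "e \<noteq> e'"
    then show False using dj[OF h(1,2,4)] ne[of e] by (auto simp: M0_def)
  qed
  let ?M = "(\<lambda>e. e - Z) ` M0"
  have eq: "star S - M0 = (\<Union>Z'\<in>\<Z> - {Z}. star S - E Z')" by (auto simp: M0_def)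
  have "card (star S - M0) \<le> (\<Sum>Z'\<in>\<Z> - {Z}. card (star S - E Z'))"
    unfolding eq using finite_parts by (intro card_UN_le) auto
  moreover have "card (star S - E Z') + card (nbhd G S \<inter> Z') = card (star S)" if "Z' \<in> \<Z> - {Z}" for Z'
    unfolding cardE[OF that, symmetric]
    by (rule card_Diff_add_card[OF finite_star E(1)])
  then have "(\<Sum>Z'\<in>\<Z> - {Z}. card (star S - E Z')) + card (nbhd G S) = (\<Sum>Z'\<in>\<Z> - {Z}. card (star S))"
    unfolding card_nbhd[OF S] sum.distrib[symmetric] by (intro sum.cong) auto
  moreover have "(\<Sum>Z'\<in>\<Z> - {Z}. card (star S)) = (k - 1) * (r * card S)"
    using card_parts Z finite_parts by (simp add: card_star[OF S])
  moreover have "card (star S - M0) + card M0 = r * card S"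
    unfolding card_star[OF S, symmetric] by (rule card_Diff_add_card[OF finite_star]) (auto simp: M0_def)
  moreover have "(k - 1) * (r * card S) = (k - 2) * (r * card S) + r * card S"
  proof -
    have "k - 1 = (k - 2) + 1" using k_ge by simp
    then show ?thesis by (simp add: add_mult_distrib)
  qed
  ultimately have "card (nbhd G S) \<le> card M0 + (k - 2) * (r * card S)" by linarith
  moreover have "card ?M = card M0" using inj by (rule card_image)
  moreover have "?M \<subseteq> links S" by (auto simp: links_def M0_def)
  moreover have "disjoint ?M"
    unfolding disjoint_def
  proof (intro ballI impI)
    fix A B assume "A \<in> ?M" "B \<in> ?M" "A \<noteq> B"
    then obtain e e' where "e \<in> M0" "e' \<in> M0" "A = e - Z" "B = e' - Z" "e \<noteq> e'" by auto
    then show "A \<inter> B = {}" using dj by blast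
  qed
  ultimately show ?thesis using that[of ?M] by simp
qed

lemma polymer_weight_le:
  assumes S: "S \<subseteq> Z" and m: "m \<le> real (card (nbhd G S)) - (real k - 2) * r * card S"
  shows "polymer_weight G S \<le> gam k powr (- m)"
proof -
  obtain M where M: "M \<subseteq> links S" "disjoint M" "card (nbhd G S) \<le> card M + (k - 2) * (r * card S)"
    using link_matching[OF S] .
  have finM: "finite M"
    using M(1) finite_star[of S] by (auto simp: links_def intro: finite_subset)
  have cM: "card e = k - 1" if "e \<in> M" for e
    using that M(1) card_edge_minus_part[OF _ Z] by (auto simp: links_def star_def)
  have am: "avoid M (\<Union>M) = (2 ^ (k - 1) - 1) ^ card M" "card (\<Union>M) = (k - 1) * card M" "finite (\<Union>M)"
    using avoid_matching[OF finM M(2) cM] k_ge by auto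
  have "avoid (links S) (verts G - Z) \<le> avoid M (verts G - Z)"
    using M(1) finite_verts by (intro avoid_antimono) auto
  then have "polymer_weight G S \<le> real (avoid M (verts G - Z)) / 2 ^ card (verts G - Z)"
    unfolding polymer_weight_eq[OF S] card_verts_minus_part[OF Z] by (intro divide_right_mono) auto
  also have "\<dots> = real (avoid M (\<Union>M)) / 2 ^ card (\<Union>M)"
    using M(1) links_subset finite_verts by (intro avoid_superset) blast+
  also have "\<dots> = inverse (gam k) ^ card M"
    unfolding am inverse_gam by (simp add: power_divide power_mult of_nat_diff)
  also have "\<dots> = gam k powr (- real (card M))"
    using gam_gt_1[OF k_ge] by (simp add: powr_minus powr_realpow power_inverse)
  also have "\<dots> \<le> gam k powr (- m)"
  proof (rule powr_mono)
    have "real (card (nbhd G S)) \<le> real (card M + (k - 2) * (r * card S))" using M(3) by linarith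
    also have "\<dots> = real (card M) + (real k - 2) * r * card S" using k_ge by (simp add: of_nat_diff)
    finally show "- real (card M) \<le> - m" using m by linarith
  qed (use gam_gt_1[OF k_ge] in auto)
  finally show ?thesis .
qed

lemma card_indep_sets_trace:
  assumes S: "S \<subseteq> Z"
  shows "real (card {I \<in> indep_sets G. I \<inter> Z = S}) = 2 ^ ((k - 1) * n) * polymer_weight G S"
proof -
  let ?A = "{I \<in> indep_sets G. I \<inter> Z = S}"
  let ?B = "{X. X \<subseteq> verts G - Z \<and> \<not> (\<exists>e\<in>links S. e \<subseteq> X)}"
  have "bij_betw (\<lambda>X. X \<union> S) ?B ?A"
  proof (rule bij_betw_byWitness[where f' = "\<lambda>I. I - Z"])
    show "\<forall>X\<in>?B. (X \<union> S) - Z = X" using S by auto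
    show "\<forall>I\<in>?A. (I - Z) \<union> S = I" by auto
    show "(\<lambda>X. X \<union> S) ` ?B \<subseteq> ?A"
    proof (rule image_subsetI)
      fix X assume X: "X \<in> ?B"
      have "\<not> e \<subseteq> X \<union> S" if e: "e \<in> edges G" for e
      proof
        assume sub: "e \<subseteq> X \<union> S"
        obtain v where "e \<inter> Z = {v}" using edge_part_singleton[OF e Z] .
        then have "v \<in> S" "v \<in> e" using sub X by auto
        then have "e - Z \<in> links S" using e by (auto simp: links_def star_def)
        moreover have "e - Z \<subseteq> X" using sub S by auto
        ultimately show False using X by auto
      qed
      then show "X \<union> S \<in> ?A"
        using X S part_subset[OF Z] by (auto simp: indep_sets_def)
    qed
    show "(\<lambda>I. I - Z) ` ?A \<subseteq> ?B"
    proof (rule image_subsetI)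
      fix I assume I: "I \<in> ?A"
      have "\<not> A \<subseteq> I - Z" if A: "A \<in> links S" for A
      proof
        assume sub: "A \<subseteq> I - Z"
        obtain e where e: "e \<in> star S" "A = e - Z" using A by (auto simp: links_def)
        have "e \<subseteq> I" using sub e star_Int[OF S e(1)] I by auto
        then show False using I e(1) by (auto simp: indep_sets_def star_def)
      qed
      then show "I - Z \<in> ?B" using I by (auto simp: indep_sets_def)
    qed
  qed
  then have "card ?A = avoid (links S) (verts G - Z)"
    unfolding avoid_def by (rule bij_betw_same_card[symmetric])
  then show ?thesis by (simp add: polymer_weight_eq[OF S])
qed

end

section \<open>Linked sets\<close>

context partite_class
begin

definition adj :: "'a \<Rightarrow> 'a \<Rightarrow> bool" where
  "adj v u \<longleftrightarrow> nbhd G {v} \<inter> nbhd G {u} \<noteq> {}"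

abbreviation incompat :: "'a set \<Rightarrow> 'a set \<Rightarrow> bool" where
  "incompat S T \<equiv> \<not> compatible G S T"

lemma adj_sym: "adj v u \<longleftrightarrow> adj u v"
  by (auto simp: adj_def)

lemma nbhd_singleton_nonempty:
  assumes "v \<in> Z"
  shows "nbhd G {v} \<noteq> {}"
proof -
  have v: "v \<in> verts G" using assms part_subset[OF Z] by auto
  have "star {v} \<noteq> {}" using card_star_singleton[OF v] r_ge by auto
  then obtain e where e: "e \<in> star {v}" by auto
  then have "e - Z \<noteq> {}" using edge_minus_part_nonempty[OF _ Z] by (simp add: star_def)
  then show ?thesis using e assms by (auto simp: nbhd_eq links_def)
qed

lemma adj_refl: "v \<in> Z \<Longrightarrow> adj v v"
  using nbhd_singleton_nonempty by (simp add: adj_def)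

lemma incompat_iff:
  assumes "S \<subseteq> Z" "T \<subseteq> Z"
  shows "incompat S T \<longleftrightarrow> (\<exists>v\<in>S. \<exists>u\<in>T. adj v u)"
  unfolding compatible_def nbhd_UN[OF assms(1)] nbhd_UN[OF assms(2)] adj_def by auto

lemma card_nbhd_singleton: "v \<in> Z \<Longrightarrow> card (nbhd G {v}) \<le> k * r"
proof -
  assume v: "v \<in> Z"
  have "nbhd G {v} = (\<Union>e\<in>star {v}. e - Z)" using v by (simp add: nbhd_eq links_def)
  also have "card \<dots> \<le> (\<Sum>e\<in>star {v}. card (e - Z))" by (rule card_UN_le[OF finite_star])
  also have "\<dots> \<le> (\<Sum>e\<in>star {v}. k)"
    using card_edge_minus_part[OF _ Z] by (intro sum_mono) (auto simp: star_def)
  also have "\<dots> = k * r" using card_star_singleton[of v] v part_subset[OF Z] by auto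
  finally show ?thesis .
qed

definition \<Delta> :: nat where "\<Delta> = k * r ^ 2"

lemma card_adj: "v \<in> Z \<Longrightarrow> card {u \<in> Z. adj v u} \<le> \<Delta>"
proof -
  assume v: "v \<in> Z"
  have "{u \<in> Z. adj v u} \<subseteq> (\<Union>y\<in>nbhd G {v}. \<Union>e\<in>star {y}. e \<inter> Z)"
  proof
    fix u assume u: "u \<in> {u \<in> Z. adj v u}"
    then obtain y where y: "y \<in> nbhd G {v}" "y \<in> nbhd G {u}" by (auto simp: adj_def)
    then obtain e where "e \<in> star {u}" "y \<in> e" using u by (auto simp: nbhd_eq links_def)
    then have "e \<in> star {y}" "u \<in> e \<inter> Z" using u by (auto simp: star_def)
    then show "u \<in> (\<Union>y\<in>nbhd G {v}. \<Union>e\<in>star {y}. e \<inter> Z)" using y by auto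
  qed
  then have "card {u \<in> Z. adj v u} \<le> card (\<Union>y\<in>nbhd G {v}. \<Union>e\<in>star {y}. e \<inter> Z)"
    using finite_nbhd[of "{v}"] v finite_star finite_part[OF Z] by (intro card_mono) auto
  also have "\<dots> \<le> (\<Sum>y\<in>nbhd G {v}. card (\<Union>e\<in>star {y}. e \<inter> Z))"
    using finite_nbhd[of "{v}"] v by (intro card_UN_le) auto
  also have "\<dots> \<le> (\<Sum>y\<in>nbhd G {v}. r)"
  proof (rule sum_mono)
    fix y assume y: "y \<in> nbhd G {v}"
    have "card (\<Union>e\<in>star {y}. e \<inter> Z) \<le> (\<Sum>e\<in>star {y}. card (e \<inter> Z))"
      by (rule card_UN_le[OF finite_star])
    also have "\<dots> = (\<Sum>e\<in>star {y}. 1)"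
      using card_edge_part[OF _ Z] by (intro sum.cong) (auto simp: star_def)
    also have "\<dots> = r" using card_star_singleton[of y] y nbhd_subset[of "{v}"] v by auto
    finally show "card (\<Union>e\<in>star {y}. e \<inter> Z) \<le> r" .
  qed
  also have "\<dots> \<le> k * r * r" using card_nbhd_singleton[OF v] by simp
  finally show ?thesis by (simp add: \<Delta>_def power2_eq_square mult.assoc)
qed

lemma edge_rel_square:
  assumes "S \<subseteq> Z"
  shows "edge_rel (edges (induced_subgraph (square_graph G Z) S)) = {(v, u). v \<in> S \<and> u \<in> S \<and> v \<noteq> u \<and> adj v u}"
proof -
  have "{v, u} \<in> edges (induced_subgraph (square_graph G Z) S) \<longleftrightarrow> v \<in> S \<and> u \<in> S \<and> v \<noteq> u \<and> adj v u" for v u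
    unfolding induced_subgraph_def square_graph_def adj_def using assms by (auto simp: doubleton_eq_iff)
  then show ?thesis by simp
qed

lemma two_linked_iff:
  "two_linked G Z S \<longleftrightarrow> S \<noteq> {} \<and> S \<subseteq> Z \<and>
    (\<forall>u\<in>S. \<forall>v\<in>S. (u, v) \<in> {(v, u). v \<in> S \<and> u \<in> S \<and> v \<noteq> u \<and> adj v u}\<^sup>*)"
proof (cases "S \<subseteq> Z")
  case True
  have "verts (induced_subgraph (square_graph G Z) S) = S" by (simp add: induced_subgraph_def)
  then show ?thesis
    unfolding two_linked_def graph_connected_def edge_rel_square[OF True] by auto
qed (simp add: two_linked_def)

lemma two_linked_no_split:
  assumes "two_linked G Z S" "W \<subseteq> S" "W \<noteq> {}" "W \<noteq> S"
  obtains w u where "w \<in> W" "u \<in> S - W" "adj w u"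
proof -
  let ?R = "{(v, u). v \<in> S \<and> u \<in> S \<and> v \<noteq> u \<and> adj v u}"
  obtain a b where ab: "a \<in> W" "b \<in> S" "b \<notin> W" using assms by auto
  have "(a, b) \<in> ?R\<^sup>*" using assms ab unfolding two_linked_iff by auto
  then have "b \<notin> W \<longrightarrow> (\<exists>w u. w \<in> W \<and> u \<in> S - W \<and> adj w u)"
  proof (induction rule: rtrancl_induct)
    case base
    then show ?case using ab by simp
  next
    case (step y z)
    then show ?case by (cases "y \<in> W") auto
  qed
  then show ?thesis using ab that by blast
qed

abbreviation linked_sets :: "'a set set" where
  "linked_sets \<equiv> {S. two_linked G Z S}"

lemma linked_subset: "S \<in> linked_sets \<Longrightarrow> S \<subseteq> Z"
  and linked_nonempty: "S \<in> linked_sets \<Longrightarrow> S \<noteq> {}"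
  by (auto simp: two_linked_def)

lemma finite_linked_sets: "finite linked_sets"
  by (rule finite_subset[of _ "Pow Z"]) (use finite_part[OF Z] in \<open>auto simp: two_linked_def\<close>)

lemma compat_disjoint:
  assumes "S \<subseteq> Z" "T \<subseteq> Z" "compatible G S T"
  shows "S \<inter> T = {}"
proof (rule equals0I)
  fix v assume "v \<in> S \<inter> T"
  then have "v \<in> S" "v \<in> T" "v \<in> Z" using assms(1) by auto
  then show False using assms incompat_iff[OF assms(1,2)] adj_refl by blast
qed

lemma compat_family_Union_inj:
  assumes X: "X \<in> compat_families incompat linked_sets" and Y: "Y \<in> compat_families incompat linked_sets"
    and eq: "\<Union>X = \<Union>Y"
  shows "X = Y"
proof -
  have sub: "S \<subseteq> T" if XY: "S \<in> X" "T \<in> Y" "v \<in> S" "v \<in> T" "\<Union>X = \<Union>Y"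
    "X \<in> compat_families incompat linked_sets" "Y \<in> compat_families incompat linked_sets" for S T v X Y
  proof (rule ccontr)
    assume "\<not> S \<subseteq> T"
    have S: "two_linked G Z S" using XY by (auto simp: compat_families_def)
    then obtain w u where wu: "w \<in> S \<inter> T" "u \<in> S - S \<inter> T" "adj w u"
      using two_linked_no_split[of S "S \<inter> T"] XY(3,4) \<open>\<not> S \<subseteq> T\<close> by blast
    have "u \<in> \<Union>X" using wu XY(1) by blast
    then obtain T' where T': "T' \<in> Y" "u \<in> T'" using XY(5) by auto
    have Z2: "T \<subseteq> Z" "T' \<subseteq> Z" using XY(2,7) T'(1) linked_subset by (auto simp: compat_families_def)
    have "T \<noteq> T'" using wu T' by auto
    then have "compatible G T T'" using XY(2,7) T'(1) by (auto simp: compat_families_def pairwise_def)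
    moreover have "incompat T T'" using incompat_iff[OF Z2] wu T' by auto
    ultimately show False by simp
  qed
  have "X \<subseteq> Y" if h: "\<Union>X = \<Union>Y" "X \<in> compat_families incompat linked_sets" "Y \<in> compat_families incompat linked_sets" for X Y
  proof
    fix S assume S: "S \<in> X"
    then obtain v where v: "v \<in> S" using h(2) linked_nonempty by (auto simp: compat_families_def)
    then have "v \<in> \<Union>Y" using S h(1) by auto
    then obtain T where T: "T \<in> Y" "v \<in> T" by auto
    have "S \<subseteq> T" by (rule sub[OF S T(1) v T(2) h])
    moreover have "T \<subseteq> S" by (rule sub[OF T(1) S T(2) v h(1)[symmetric] h(3,2)])
    ultimately show "S \<in> Y" using T by simp
  qed
  from this[OF eq X Y] this[OF eq[symmetric] Y X] show ?thesis by simp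
qed

lemma linked_component:
  fixes S v
  defines "K \<equiv> {u. (v, u) \<in> {(a, b). a \<in> S \<and> b \<in> S \<and> adj a b}\<^sup>*}"
  assumes "S \<subseteq> Z" "v \<in> S"
  shows "K \<subseteq> S" "two_linked G Z K"
proof -
  let ?R = "{(a, b). a \<in> S \<and> b \<in> S \<and> adj a b}"
  let ?Q = "{(a, b). a \<in> K \<and> b \<in> K \<and> a \<noteq> b \<and> adj a b}"
  have KS: "u \<in> S" if "(v, u) \<in> ?R\<^sup>*" for u
    using that
  proof (induction rule: rtrancl_induct)
    case base
    then show ?case by (rule assms(3))
  qed simp
  show "K \<subseteq> S"
  proof
    fix u assume "u \<in> K"
    then have "(v, u) \<in> ?R\<^sup>*" unfolding K_def by (rule CollectD)
    then show "u \<in> S" by (rule KS)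
  qed
  have vK: "v \<in> K" unfolding K_def by (rule CollectI) (rule rtrancl_refl)
  have reach: "(v, u) \<in> ?Q\<^sup>*" if "(v, u) \<in> ?R\<^sup>*" for u
    using that
  proof (induction rule: rtrancl_induct)
    case (step y z)
    have "y \<in> K" unfolding K_def using step.hyps(1) by (rule CollectI)
    have "z \<in> K" unfolding K_def using rtrancl_into_rtrancl[OF step.hyps] by (rule CollectI)
    show ?case
    proof (cases "y = z")
      case False
      then have "(y, z) \<in> ?Q" using step.hyps(2) \<open>y \<in> K\<close> \<open>z \<in> K\<close> by simp
      then show ?thesis using step.IH by (rule rtrancl_into_rtrancl[rotated])
    qed (use step.IH in simp)
  qed simp
  have "sym ?Q" using adj_sym by (auto simp: sym_def)
  then have "sym (?Q\<^sup>*)" by (rule sym_rtrancl)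
  then have "(u, u') \<in> ?Q\<^sup>*" if "u \<in> K" "u' \<in> K" for u u'
  proof -
    have "(v, u) \<in> ?Q\<^sup>*" "(v, u') \<in> ?Q\<^sup>*" using that reach unfolding K_def by blast+
    then show ?thesis using \<open>sym (?Q\<^sup>*)\<close> by (meson rtrancl_trans symD)
  qed
  then show "two_linked G Z K"
    unfolding two_linked_iff using vK \<open>K \<subseteq> S\<close> assms(2) by auto
qed

lemma linked_decomposition:
  assumes "S \<subseteq> Z"
  obtains X where "X \<in> compat_families incompat linked_sets" "\<Union>X = S"
proof -
  let ?R = "{(a, b). a \<in> S \<and> b \<in> S \<and> adj a b}"
  let ?K = "\<lambda>v. {u. (v, u) \<in> ?R\<^sup>*}"
  have "sym ?R" using adj_sym by (auto simp: sym_def)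
  then have symR: "sym (?R\<^sup>*)" by (rule sym_rtrancl)
  have K: "?K v \<subseteq> S" "two_linked G Z (?K v)" if "v \<in> S" for v
    using linked_component[OF assms that] by auto
  have "pairwise (\<lambda>A B. \<not> incompat A B) (?K ` S)"
  proof (rule pairwiseI, rule notI)
    fix A B assume AB: "A \<in> ?K ` S" "B \<in> ?K ` S" "A \<noteq> B" "incompat A B"
    then obtain v v' where v: "v \<in> S" "v' \<in> S" "A = ?K v" "B = ?K v'" by auto
    have "A \<subseteq> Z" "B \<subseteq> Z" using K(1)[OF v(1)] K(1)[OF v(2)] v assms by auto
    then obtain a b where ab: "a \<in> A" "b \<in> B" "adj a b" using AB(4) incompat_iff by auto
    have "a \<in> S" "b \<in> S" using ab K(1)[OF v(1)] K(1)[OF v(2)] v(3,4) by auto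
    then have aRb: "(a, b) \<in> ?R\<^sup>*" using ab(3) by auto
    have "(v, a) \<in> ?R\<^sup>*" "(v', b) \<in> ?R\<^sup>*" using ab v by auto
    then have vv: "(v, v') \<in> ?R\<^sup>*"
      using rtrancl_trans[OF rtrancl_trans[OF _ aRb] symD[OF symR]] by blast
    then have vv': "(v', v) \<in> ?R\<^sup>*" by (rule symD[OF symR])
    have "?K v = ?K v'" using rtrancl_trans[OF vv] rtrancl_trans[OF vv'] by auto
    then show False using AB v by simp
  qed
  then have "?K ` S \<in> compat_families incompat linked_sets"
    using K(2) unfolding compat_families_def by auto
  moreover have "\<Union>(?K ` S) = S"
  proof
    show "\<Union>(?K ` S) \<subseteq> S" by (rule UN_least, rule K(1))
  qed auto
  ultimately show ?thesis using that by blast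
qed

lemma compat_family_weight:
  assumes "X \<in> compat_families incompat linked_sets"
  shows "polymer_weight G (\<Union>X) = (\<Prod>S\<in>X. polymer_weight G S) \<and> card (\<Union>X) = (\<Sum>S\<in>X. card S)"
proof -
  have "finite X" using assms finite_linked_sets finite_subset by (auto simp: compat_families_def)
  then show ?thesis using assms
  proof (induction X rule: finite_induct)
    case empty
    then show ?case by (simp add: polymer_weight_empty)
  next
    case (insert T X)
    have X: "X \<in> compat_families incompat linked_sets" using insert.prems
      by (auto simp: compat_families_def pairwise_insert)
    have TZ: "T \<subseteq> Z" using insert.prems linked_subset by (auto simp: compat_families_def)
    have XZ: "S \<subseteq> Z" if "S \<in> X" for S using that X linked_subset by (auto simp: compat_families_def)
    have comp: "compatible G T S" if "S \<in> X" for S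
    proof -
      have "T \<noteq> S" using insert.hyps(2) that by auto
      then show ?thesis using insert.prems that by (auto simp: compat_families_def pairwise_insert)
    qed
    have "nbhd G (\<Union>X) = (\<Union>S\<in>X. nbhd G S)" by (rule nbhd_Union) (rule XZ)
    then have nb: "nbhd G T \<inter> nbhd G (\<Union>X) = {}"
      using comp by (auto simp: compatible_def)
    have dj: "T \<inter> \<Union>X = {}" using compat_disjoint[OF TZ XZ comp] by auto
    have "polymer_weight G (T \<union> \<Union>X) = polymer_weight G T * polymer_weight G (\<Union>X)"
      using TZ XZ nb by (intro polymer_weight_Un) auto
    moreover have "card (T \<union> \<Union>X) = card T + card (\<Union>X)"
      using TZ XZ finite_part[OF Z] dj by (intro card_Un_disjoint) (auto intro: finite_subset)
    ultimately show ?case using insert.IH[OF X] insert.hyps by simp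
  qed
qed

lemma Delta_ge_1: "\<Delta> \<ge> 1"
  using k_ge r_ge by (simp add: \<Delta>_def)

lemma finite_linked: "two_linked G Z S \<Longrightarrow> finite S"
  by (rule finite_subset[OF _ finite_part[OF Z]]) (simp add: two_linked_def)

definition walks :: "'a \<Rightarrow> nat \<Rightarrow> 'a list set" where
  "walks v m = {xs. length xs = Suc m \<and> last xs = v \<and> set xs \<subseteq> Z \<and> successively adj xs}"

lemma finite_walks: "finite (walks v m)"
  by (rule finite_subset[OF _ finite_lists_length_eq[OF finite_part[OF Z], of "Suc m"]])
    (auto simp: walks_def)

lemma card_walks: "v \<in> Z \<Longrightarrow> card (walks v m) \<le> \<Delta> ^ m"
proof (induction m)
  case 0
  have "walks v 0 \<subseteq> {[v]}" by (auto simp: walks_def length_Suc_conv)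
  then have "card (walks v 0) \<le> card {[v]}" by (intro card_mono) auto
  then show ?case by simp
next
  case (Suc m)
  let ?f = "\<lambda>ys. (\<lambda>u. u # ys) ` {u \<in> Z. adj (hd ys) u}"
  have "walks v (Suc m) \<subseteq> (\<Union>ys\<in>walks v m. ?f ys)"
  proof
    fix xs assume xs: "xs \<in> walks v (Suc m)"
    then obtain u y ys where e: "xs = u # y # ys" by (auto simp: walks_def length_Suc_conv)
    then have W: "y # ys \<in> walks v m" "u \<in> Z" "adj y u" using xs adj_sym by (auto simp: walks_def)
    then have "xs \<in> ?f (y # ys)" using e by simp
    then show "xs \<in> (\<Union>ys\<in>walks v m. ?f ys)" by (rule UN_I[OF W(1)])
  qed
  then have "card (walks v (Suc m)) \<le> card (\<Union>ys\<in>walks v m. ?f ys)"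
    using finite_walks finite_part[OF Z] by (intro card_mono) auto
  also have "\<dots> \<le> (\<Sum>ys\<in>walks v m. card (?f ys))" by (rule card_UN_le[OF finite_walks])
  also have "\<dots> \<le> (\<Sum>ys\<in>walks v m. \<Delta>)"
  proof (rule sum_mono)
    fix ys assume "ys \<in> walks v m"
    then have "hd ys \<in> Z" by (cases ys) (auto simp: walks_def)
    have "card (?f ys) \<le> card {u \<in> Z. adj (hd ys) u}"
      using finite_part[OF Z] by (intro card_image_le) auto
    also have "\<dots> \<le> \<Delta>" by (rule card_adj[OF \<open>hd ys \<in> Z\<close>])
    finally show "card (?f ys) \<le> \<Delta>" .
  qed
  also have "\<dots> \<le> \<Delta> ^ m * \<Delta>" using Suc by simp
  finally show ?case by (simp add: mult.commute)
qed

lemma linked_walk: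
  assumes S: "two_linked G Z S" and v: "v \<in> S" and j: "j < card S"
  shows "\<exists>xs. length xs = Suc (2 * j) \<and> last xs = v \<and> set xs \<subseteq> S \<and> card (set xs) = Suc j \<and> successively adj xs"
  using j
proof (induction j)
  case 0
  then show ?case using v by (intro exI[of _ "[v]"]) auto
next
  case (Suc j)
  then obtain xs where xs: "length xs = Suc (2 * j)" "last xs = v" "set xs \<subseteq> S" "card (set xs) = Suc j" "successively adj xs"
    by auto
  have SZ: "S \<subseteq> Z" using S by (auto simp: two_linked_def)
  have "set xs \<noteq> {}" "set xs \<noteq> S" using xs Suc.prems by auto
  then obtain w u where wu: "w \<in> set xs" "u \<in> S - set xs" "adj w u"
    using two_linked_no_split[OF S xs(3)] by blast
  obtain as bs where ab: "xs = as @ w # bs" using wu(1) by (auto simp: in_set_conv_decomp)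
  let ?ys = "as @ w # u # w # bs"
  have "set ?ys = insert u (set xs)" using ab by auto
  then have "set ?ys \<subseteq> S" "card (set ?ys) = Suc (Suc j)" using wu xs by auto
  moreover have "last ?ys = v" using xs(2) ab by auto
  moreover have "successively adj ?ys"
    using xs(5) wu(3) adj_sym unfolding ab by (auto simp: successively_append_iff)
  moreover have "length ?ys = Suc (2 * Suc j)" using xs(1) ab by simp
  ultimately show ?case by blast
qed

lemma card_linked_containing:
  assumes v: "v \<in> Z"
  shows "card {S. two_linked G Z S \<and> v \<in> S \<and> card S = s} \<le> \<Delta> ^ (2 * s)"
proof (cases s)
  case 0
  then have "{S. two_linked G Z S \<and> v \<in> S \<and> card S = s} = {}" by (auto simp: card_eq_0_iff dest: finite_linked)
  then show ?thesis by (simp only: card.empty)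
next
  case (Suc j)
  have "{S. two_linked G Z S \<and> v \<in> S \<and> card S = s} \<subseteq> set ` walks v (2 * j)"
  proof
    fix S assume S: "S \<in> {S. two_linked G Z S \<and> v \<in> S \<and> card S = s}"
    then have SZ: "S \<subseteq> Z" by (auto simp: two_linked_def)
    have "finite S" using S by (intro finite_linked) simp
    have "two_linked G Z S" "v \<in> S" "j < card S" using S Suc by simp_all
    from linked_walk[OF this] obtain xs where xs: "length xs = Suc (2 * j)" "last xs = v" "set xs \<subseteq> S"
      "card (set xs) = Suc j" "successively adj xs" by blast
    then have "set xs = S" using \<open>finite S\<close> S Suc by (intro card_subset_eq) auto
    moreover have "xs \<in> walks v (2 * j)" using xs SZ by (auto simp: walks_def)
    ultimately show "S \<in> set ` walks v (2 * j)" by auto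
  qed
  then have "card {S. two_linked G Z S \<and> v \<in> S \<and> card S = s} \<le> card (set ` walks v (2 * j))"
    using finite_walks by (intro card_mono) auto
  also have "\<dots> \<le> card (walks v (2 * j))" by (rule card_image_le[OF finite_walks])
  also have "\<dots> \<le> \<Delta> ^ (2 * j)" by (rule card_walks[OF v])
  also have "\<dots> \<le> \<Delta> ^ (2 * s)" using Delta_ge_1 Suc by (intro power_increasing) auto
  finally show ?thesis .
qed

lemma sum_linked_containing:
  fixes g :: "'a set \<Rightarrow> real" and f :: "nat \<Rightarrow> real"
  assumes v: "v \<in> Z" and A: "finite A"
    and g: "\<And>S. two_linked G Z S \<Longrightarrow> card S \<in> A \<Longrightarrow> g S \<le> f (card S)" and f: "\<And>s. s \<in> A \<Longrightarrow> 0 \<le> f s"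
  shows "(\<Sum>S | two_linked G Z S \<and> card S \<in> A \<and> v \<in> S. g S) \<le> (\<Sum>s\<in>A. \<Delta> ^ (2 * s) * f s)"
proof -
  let ?B = "{S. two_linked G Z S \<and> card S \<in> A \<and> v \<in> S}"
  have fin: "finite ?B" by (rule finite_subset[OF _ finite_linked_sets]) auto
  have "(\<Sum>S\<in>?B. g S) = (\<Sum>s\<in>A. \<Sum>S | S \<in> ?B \<and> card S = s. g S)"
    by (rule sum.group[symmetric]) (use fin A in auto)
  also have "\<dots> \<le> (\<Sum>s\<in>A. \<Delta> ^ (2 * s) * f s)"
  proof (rule sum_mono)
    fix s assume s: "s \<in> A"
    have eq: "{S. S \<in> ?B \<and> card S = s} = {S. two_linked G Z S \<and> v \<in> S \<and> card S = s}" using s by auto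
    have "(\<Sum>S | S \<in> ?B \<and> card S = s. g S) \<le> real (card {S. S \<in> ?B \<and> card S = s}) * f s"
      using g by (intro sum_bounded_above) auto
    also have "\<dots> \<le> \<Delta> ^ (2 * s) * f s"
      unfolding eq using card_linked_containing[OF v, of s] f[OF s]
      by (intro mult_right_mono) (simp_all flip: of_nat_power)
    finally show "(\<Sum>S | S \<in> ?B \<and> card S = s. g S) \<le> \<Delta> ^ (2 * s) * f s" .
  qed
  finally show ?thesis .
qed

lemma sum_linked:
  fixes g :: "'a set \<Rightarrow> real" and f :: "nat \<Rightarrow> real"
  assumes A: "finite A" and g0: "\<And>S. g S \<ge> 0"
    and g: "\<And>S. two_linked G Z S \<Longrightarrow> card S \<in> A \<Longrightarrow> g S \<le> f (card S)" and f: "\<And>s. s \<in> A \<Longrightarrow> 0 \<le> f s"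
    and W: "W \<subseteq> Z"
  shows "(\<Sum>S | two_linked G Z S \<and> card S \<in> A \<and> S \<inter> W \<noteq> {}. g S) \<le> card W * (\<Sum>s\<in>A. \<Delta> ^ (2 * s) * f s)"
proof -
  let ?B = "\<lambda>v. {S. two_linked G Z S \<and> card S \<in> A \<and> v \<in> S}"
  have finW: "finite W" by (rule finite_subset[OF W finite_part[OF Z]])
  have fin: "finite (?B v)" for v by (rule finite_subset[OF _ finite_linked_sets]) auto
  have "{S. two_linked G Z S \<and> card S \<in> A \<and> S \<inter> W \<noteq> {}} = (\<Union>v\<in>W. ?B v)" by auto
  then have "(\<Sum>S | two_linked G Z S \<and> card S \<in> A \<and> S \<inter> W \<noteq> {}. g S) = (\<Sum>S\<in>(\<Union>v\<in>W. ?B v). g S)" by simp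
  also have "\<dots> \<le> (\<Sum>v\<in>W. \<Sum>S\<in>?B v. g S)"
    using finW
  proof (induction W rule: finite_induct)
    case (insert v W)
    have "(\<Sum>S\<in>(\<Union>v\<in>insert v W. ?B v). g S) = (\<Sum>S\<in>?B v \<union> (\<Union>v\<in>W. ?B v). g S)" by simp
    also have "\<dots> \<le> (\<Sum>S\<in>?B v. g S) + (\<Sum>S\<in>(\<Union>v\<in>W. ?B v). g S)"
      using sum.union_inter[of "?B v" "\<Union>v\<in>W. ?B v" g] fin insert.hyps
        sum_nonneg[of "?B v \<inter> (\<Union>v\<in>W. ?B v)" g] g0 by auto
    finally show ?case using insert by simp
  qed simp
  also have "\<dots> \<le> (\<Sum>v\<in>W. \<Sum>s\<in>A. \<Delta> ^ (2 * s) * f s)"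
    using W by (intro sum_mono sum_linked_containing A g f) auto
  finally show ?thesis by simp
qed

end

section \<open>Estimates for one class\<close>

lemma partition_fn_mono:
  fixes w :: "'p \<Rightarrow> real"
  assumes "P \<subseteq> Q" "finite Q" "\<And>S. S \<in> Q \<Longrightarrow> w S \<ge> 0"
  shows "partition_fn inc w P \<le> partition_fn inc w Q"
  unfolding partition_fn_def
proof (rule sum_mono2)
  show "finite (compat_families inc Q)" by (rule finite_compat_families[OF assms(2)])
  show "compat_families inc P \<subseteq> compat_families inc Q" using assms(1) by (auto simp: compat_families_def)
  fix X assume "X \<in> compat_families inc Q - compat_families inc P"
  then show "0 \<le> (\<Prod>S\<in>X. w S)" using assms(3) by (intro prod_nonneg) (auto simp: compat_families_def)
qed

lemma partition_fn_Un_le: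
  fixes w :: "'p \<Rightarrow> real"
  assumes "finite P" "finite Q" "P \<inter> Q = {}"
    and w: "\<And>S. S \<in> P \<union> Q \<Longrightarrow> w S \<ge> 0"
    and sym: "\<And>S T. S \<in> P \<union> Q \<Longrightarrow> T \<in> P \<union> Q \<Longrightarrow> inc S T = inc T S"
    and refl: "\<And>S. S \<in> P \<union> Q \<Longrightarrow> inc S S"
  shows "partition_fn inc w (P \<union> Q) \<le> partition_fn inc w P * exp (\<Sum>S\<in>Q. w S)"
  using assms(2,3) w sym refl
proof (induction Q rule: finite_induct)
  case (insert S Q)
  let ?Z = "partition_fn inc w"
  have S: "S \<in> P \<union> insert S Q" "w S \<ge> 0" using insert.prems(2) by auto
  have eq: "P \<union> insert S Q - {S} = P \<union> Q" using insert.hyps insert.prems(1) by auto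
  have "?Z (P \<union> insert S Q) = ?Z (P \<union> insert S Q - {S}) + w S * ?Z {T \<in> P \<union> insert S Q. \<not> inc S T}"
    by (rule partition_fn_remove[where inc = inc, OF _ S(1) insert.prems(3)[OF S(1)] insert.prems(4)[OF S(1)]])
      (use assms(1) insert.hyps in auto)
  also have "\<dots> \<le> ?Z (P \<union> Q) + w S * ?Z (P \<union> Q)"
    unfolding eq
  proof (intro add_left_mono mult_left_mono partition_fn_mono S)
    show "{T \<in> P \<union> insert S Q. \<not> inc S T} \<subseteq> P \<union> Q" using insert.prems(4)[OF S(1)] by auto
    show "finite (P \<union> Q)" using assms(1) insert.hyps by simp
    show "w T \<ge> 0" if "T \<in> P \<union> Q" for T using insert.prems(2) that by simp
  qed
  also have "\<dots> = (1 + w S) * ?Z (P \<union> Q)" by (simp add: algebra_simps)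
  also have "\<dots> \<le> exp (w S) * (?Z P * exp (\<Sum>S\<in>Q. w S))"
  proof (intro mult_mono insert.IH)
    show "0 \<le> ?Z (P \<union> Q)"
      unfolding partition_fn_def using insert.prems(2) by (intro sum_nonneg prod_nonneg) (auto simp: compat_families_def)
  qed (use insert.prems in auto)
  finally show ?case using insert.hyps by (simp add: exp_add mult_ac)
qed simp

lemma sum_geometric_le:
  fixes q :: real
  assumes "0 \<le> q" "q \<le> 1 / 2"
  shows "(\<Sum>s=a..b. q ^ s) \<le> 2 * q ^ a"
proof -
  have "(\<Sum>s=a..b. q ^ s) * (1 - q) \<le> q ^ a"
  proof (cases "a \<le> b")
    case True
    then have "(1 - q) * (\<Sum>s=a..b. q ^ s) = q ^ a - q ^ Suc b" by (rule sum_gp_multiplied)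
    then show ?thesis using assms by (simp add: mult.commute)
  qed (use assms in simp)
  moreover have "(\<Sum>s=a..b. q ^ s) * (1 / 2) \<le> (\<Sum>s=a..b. q ^ s) * (1 - q)"
    using assms by (intro mult_left_mono sum_nonneg) auto
  ultimately show ?thesis by simp
qed

lemma ursell_not_connected:
  assumes "\<not> graph_connected H"
  shows "ursell H = 0"
proof -
  have "graph_connected H" if F: "F \<subseteq> edges H" "graph_connected \<lparr>verts = verts H, edges = F\<rparr>" for F
    using F(2) edge_rel_rtrancl_mono[OF F(1)] unfolding graph_connected_def by auto
  then have "{F. F \<subseteq> edges H \<and> graph_connected \<lparr>verts = verts H, edges = F\<rparr>} = {}"
    using assms by auto
  then have "(\<Sum>F | F \<subseteq> edges H \<and> graph_connected \<lparr>verts = verts H, edges = F\<rparr>. (- 1) ^ card F) = (0 :: real)"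
    by (simp only: sum.empty)
  then show ?thesis by (simp add: ursell_def)
qed

context partite_class
begin

lemma polymers_eq: "polymers G Z b = {S. two_linked G Z S \<and> card S \<le> b}"
proof -
  have "1 \<le> card S" if "two_linked G Z S" for S
    using finite_linked[OF that] that by (auto simp: two_linked_def Suc_le_eq card_gt_0_iff)
  then show ?thesis by (auto simp: polymers_def two_linked_def)
qed

lemma compatible_sym: "compatible G S T = compatible G T S"
  by (auto simp: compatible_def)

lemma incompat_refl: "two_linked G Z S \<Longrightarrow> incompat S S"
  using incompat_iff[of S S] adj_refl by (auto simp: two_linked_def)

lemma polymer_system_polymers: "polymer_system incompat (polymers G Z b)"
proof
  show "finite (polymers G Z b)"
    by (rule finite_subset[OF _ finite_linked_sets]) (auto simp: polymers_eq)
qed (use compatible_sym incompat_refl in \<open>auto simp: polymers_eq\<close>)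

lemma cluster_weight_eq:
  "cluster_weight G \<Gamma> = polymer_system.tuple_weight incompat (polymer_weight G) \<Gamma>"
  by (simp add: cluster_weight_def polymer_system.tuple_weight_def[OF polymer_system_polymers]
      ursell_def incompat_graph_def conn_sum_def inc_edges_def)

lemma cluster_sum_eq:
  assumes "m \<ge> 1"
  shows "(\<Sum>\<Gamma> | \<Gamma> \<in> clusters G Z t \<and> cluster_size \<Gamma> = m. cluster_weight G \<Gamma>) =
    (\<Sum>\<Gamma> | set \<Gamma> \<subseteq> polymers G Z t \<and> (\<Sum>S\<leftarrow>\<Gamma>. card S) = m.
       polymer_system.tuple_weight incompat (polymer_weight G) \<Gamma>)"
proof -
  interpret polymer_system incompat "polymers G Z t" by (rule polymer_system_polymers)
  let ?B = "{\<Gamma>. set \<Gamma> \<subseteq> polymers G Z t \<and> (\<Sum>S\<leftarrow>\<Gamma>. card S) = m}"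
  have "length \<Gamma> \<le> (\<Sum>S\<leftarrow>\<Gamma>. card S)" if "set \<Gamma> \<subseteq> polymers G Z t" for \<Gamma>
    using that by (induction \<Gamma>) (auto simp: polymers_def)
  then have "?B \<subseteq> {\<Gamma>. set \<Gamma> \<subseteq> polymers G Z t \<and> length \<Gamma> \<le> m}" by auto
  then have "finite ?B" by (rule finite_subset) (rule finite_lists_length_le[OF finite_P])
  then show ?thesis unfolding cluster_weight_eq[symmetric]
  proof (rule sum.mono_neutral_left)
    show "{\<Gamma> \<in> clusters G Z t. cluster_size \<Gamma> = m} \<subseteq> ?B"
      by (auto simp: clusters_def cluster_size_def)
    show "\<forall>\<Gamma>\<in>?B - {\<Gamma> \<in> clusters G Z t. cluster_size \<Gamma> = m}. cluster_weight G \<Gamma> = 0"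
    proof
      fix \<Gamma> assume \<Gamma>: "\<Gamma> \<in> ?B - {\<Gamma> \<in> clusters G Z t. cluster_size \<Gamma> = m}"
      then have "\<Gamma> \<noteq> []" using assms by auto
      then have "\<not> graph_connected (incompat_graph G \<Gamma>)"
        using \<Gamma> by (auto simp: clusters_def cluster_size_def)
      then show "cluster_weight G \<Gamma> = 0" by (simp add: cluster_weight_def ursell_not_connected)
    qed
  qed
qed

definition \<Xi> :: "nat \<Rightarrow> real" where
  "\<Xi> b = partition_fn incompat (polymer_weight G) (polymers G Z b)"

definition cluster_exponent :: "nat \<Rightarrow> real" where
  "cluster_exponent t = (\<Sum>m=1..t. \<Sum>\<Gamma> | \<Gamma> \<in> clusters G Z t \<and> cluster_size \<Gamma> = m. cluster_weight G \<Gamma>)"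

lemma Xi_ge_1: "\<Xi> b \<ge> 1"
proof -
  have "partition_fn incompat (polymer_weight G) {} \<le> \<Xi> b"
    unfolding \<Xi>_def using polymer_weight_nonneg polymer_system.finite_P[OF polymer_system_polymers]
    by (intro partition_fn_mono) auto
  then show ?thesis by simp
qed

lemma cluster_exponent_approx:
  fixes x :: real
  assumes x: "x > 0" "8 * exp 1 * real \<Delta> ^ 3 * x \<le> 1"
    and w: "\<And>S. S \<subseteq> Z \<Longrightarrow> card S \<le> t \<Longrightarrow> polymer_weight G S \<le> x ^ card S"
  shows "\<bar>ln (\<Xi> t) - cluster_exponent t\<bar> \<le> t * n * (4 * exp 1 * real \<Delta> ^ 3 * x) ^ Suc t"
proof -
  interpret polymer_system incompat "polymers G Z t" by (rule polymer_system_polymers)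
  define R where "R = 1 / (4 * exp 1 * real \<Delta> ^ 3 * x)"
  define f where "f = (\<lambda>s::nat. (x * (2 * R) * exp 1) ^ s)"
  define q where "q = real \<Delta> ^ 2 * (x * (2 * R) * exp 1)"
  have D1: "real \<Delta> \<ge> 1" using Delta_ge_1 by linarith
  have D0: "real \<Delta> > 0" using D1 by linarith
  have R: "R \<ge> 2" using x D0 by (simp add: R_def field_simps)
  have q: "q = 1 / (2 * real \<Delta>)"
    using x D0 by (simp add: q_def R_def field_simps power2_eq_square power3_eq_cube)
  have q12: "0 \<le> q" "q \<le> 1 / 2" using D1 by (auto simp: q field_simps)
  let ?g = "\<lambda>S. polymer_weight G S * (2 * R) ^ card S * exp (real (card S))"
  have g0: "?g S \<ge> 0" for S using polymer_weight_nonneg R by simp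
  have gf: "?g S \<le> f (card S)" if "two_linked G Z S" "card S \<in> {1..t}" for S
  proof -
    have "polymer_weight G S \<le> x ^ card S" using w that by (simp add: two_linked_def)
    then have "?g S \<le> x ^ card S * (2 * R) ^ card S * exp (real (card S))"
      using R by (intro mult_right_mono) auto
    also have "\<dots> = f (card S)" by (simp add: f_def power_mult_distrib exp_of_nat_mult[symmetric])
    finally show ?thesis .
  qed
  have f0: "f s \<ge> 0" for s using x R by (simp add: f_def)
  have sumf: "(\<Sum>s=1..t. real (\<Delta> ^ (2 * s)) * f s) \<le> 1 / \<Delta>"
  proof -
    have "(\<Sum>s=1..t. real (\<Delta> ^ (2 * s)) * f s) = (\<Sum>s=1..t. q ^ s)"
      by (rule sum.cong) (simp_all add: f_def q_def power_mult_distrib power_mult[symmetric])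
    also have "\<dots> \<le> 2 * q ^ 1" by (rule sum_geometric_le[OF q12])
    also have "\<dots> = 1 / \<Delta>" by (simp add: q)
    finally show ?thesis .
  qed
  have sumf0: "0 \<le> (\<Sum>s=1..t. real (\<Delta> ^ (2 * s)) * f s)"
    by (intro sum_nonneg mult_nonneg_nonneg f0) simp
  have sumf1: "(\<Sum>s=1..t. real (\<Delta> ^ (2 * s)) * f s) \<le> 1"
    by (rule order_trans[OF sumf]) (use D1 in simp)
  have pol: "polymers G Z t = {S. two_linked G Z S \<and> card S \<in> {1..t}}"
    by (auto simp: polymers_def two_linked_def)
  have "\<bar>ln (partition_fn incompat (polymer_weight G) (polymers G Z t)) -
      (\<Sum>m=1..t. \<Sum>xs | set xs \<subseteq> polymers G Z t \<and> (\<Sum>S\<leftarrow>xs. card S) = m. tuple_weight (polymer_weight G) xs)\<bar>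
      \<le> (real t * real n) / R ^ Suc t"
  proof (rule cluster_expansion_truncation)
    fix S assume S: "S \<in> polymers G Z t"
    then show "card S \<ge> 1" "polymer_weight G S \<ge> 0"
      by (auto simp: polymers_def polymer_weight_nonneg)
    have SZ: "S \<subseteq> Z" using S by (simp add: polymers_def)
    let ?W = "\<Union>v\<in>S. {u \<in> Z. adj v u}"
    have finS: "finite S" by (rule finite_subset[OF SZ finite_part[OF Z]])
    have "card ?W \<le> (\<Sum>v\<in>S. card {u \<in> Z. adj v u})" by (rule card_UN_le[OF finS])
    also have "\<dots> \<le> (\<Sum>v\<in>S. \<Delta>)" using SZ by (intro sum_mono card_adj) auto
    finally have cW: "real (card ?W) \<le> real (card S) * \<Delta>"
      by (simp flip: of_nat_mult)
    have "{T. T \<in> polymers G Z t \<and> incompat S T} \<subseteq> {T. two_linked G Z T \<and> card T \<in> {1..t} \<and> T \<inter> ?W \<noteq> {}}"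
    proof
      fix T assume T: "T \<in> {T. T \<in> polymers G Z t \<and> incompat S T}"
      then have T': "two_linked G Z T" "card T \<in> {1..t}" "T \<subseteq> Z" by (auto simp: pol two_linked_def)
      then obtain v u where "v \<in> S" "u \<in> T" "adj v u" using T incompat_iff[OF SZ T'(3)] by auto
      then show "T \<in> {T. two_linked G Z T \<and> card T \<in> {1..t} \<and> T \<inter> ?W \<noteq> {}}" using T' by auto
    qed
    then have "(\<Sum>T | T \<in> polymers G Z t \<and> incompat S T. ?g T) \<le>
      (\<Sum>T | two_linked G Z T \<and> card T \<in> {1..t} \<and> T \<inter> ?W \<noteq> {}. ?g T)"
      using g0 by (intro sum_mono2) (auto intro: finite_subset[OF _ finite_linked_sets])
    also have "\<dots> \<le> card ?W * (\<Sum>s=1..t. \<Delta> ^ (2 * s) * f s)"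
      by (rule sum_linked[where g = ?g and f = f and A = "{1..t}", OF _ g0 gf f0]) auto
    also have "\<dots> \<le> (real (card S) * \<Delta>) * (1 / \<Delta>)"
      by (rule mult_mono[OF cW sumf _ sumf0]) simp
    also have "\<dots> = card S" using D0 by simp
    finally show "(\<Sum>T | T \<in> polymers G Z t \<and> incompat S T. ?g T) \<le> card S" .
  next
    have eq: "polymers G Z t = {S. two_linked G Z S \<and> card S \<in> {1..t} \<and> S \<inter> Z \<noteq> {}}"
      unfolding pol by (auto simp: two_linked_def)
    have "(\<Sum>S\<in>polymers G Z t. card S * ?g S) \<le> (\<Sum>S\<in>polymers G Z t. t * ?g S)"
      using g0 by (intro sum_mono mult_right_mono) (auto simp: polymers_def)
    also have "\<dots> = t * (\<Sum>S\<in>polymers G Z t. ?g S)" by (simp add: sum_distrib_left)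
    also have "\<dots> \<le> t * (card Z * (\<Sum>s=1..t. \<Delta> ^ (2 * s) * f s))"
      unfolding eq by (intro mult_left_mono sum_linked[where g = ?g and f = f and A = "{1..t}", OF _ g0 gf f0]) auto
    also have "\<dots> \<le> t * (real n * 1)"
      unfolding part_size[OF Z] by (intro mult_left_mono sumf1) simp_all
    finally show "(\<Sum>S\<in>polymers G Z t. card S * ?g S) \<le> real t * real n" by simp
  qed (use R in auto)
  also have "(real t * real n) / R ^ Suc t = t * n * (4 * exp 1 * real \<Delta> ^ 3 * x) ^ Suc t"
    by (simp add: R_def power_divide)
  finally show ?thesis
    unfolding \<Xi>_def cluster_exponent_def by (simp add: cluster_sum_eq)
qed

definition trace_sum :: "real \<Rightarrow> real" where
  "trace_sum c = (\<Sum>S | S \<subseteq> Z \<and> real (card S) \<le> c. polymer_weight G S)"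

lemma finite_subsets: "finite {S. S \<subseteq> Z \<and> Q S}"
  by (rule finite_subset[of _ "Pow Z"]) (use finite_part[OF Z] in auto)

lemma polymers_linked: "polymers G Z b \<subseteq> linked_sets"
  by (auto simp: polymers_eq)

lemma compat_families_polymers: "compat_families incompat (polymers G Z b) \<subseteq> compat_families incompat linked_sets"
  using polymers_linked by (auto simp: compat_families_def)

lemma small_traces_le_Xi: "(\<Sum>S | S \<subseteq> Z \<and> card S \<le> b. polymer_weight G S) \<le> \<Xi> b"
proof -
  let ?A = "{S. S \<subseteq> Z \<and> card S \<le> b}"
  let ?F = "compat_families incompat (polymers G Z b)"
  have "\<exists>X. X \<in> compat_families incompat linked_sets \<and> \<Union>X = S" if "S \<subseteq> Z" for S
    using linked_decomposition[OF that] by blast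
  then obtain h where h: "\<And>S. S \<subseteq> Z \<Longrightarrow> h S \<in> compat_families incompat linked_sets \<and> \<Union>(h S) = S"
    by metis
  have "(\<Sum>S\<in>?A. polymer_weight G S) = (\<Sum>S\<in>?A. \<Prod>T\<in>h S. polymer_weight G T)"
  proof (rule sum.cong[OF refl])
    fix S assume "S \<in> ?A"
    then have "h S \<in> compat_families incompat linked_sets" "\<Union>(h S) = S" using h[of S] by simp_all
    then show "polymer_weight G S = (\<Prod>T\<in>h S. polymer_weight G T)"
      using compat_family_weight[of "h S"] by simp
  qed
  also have "\<dots> = (\<Sum>X\<in>h ` ?A. \<Prod>T\<in>X. polymer_weight G T)"
  proof (rule sum.reindex_cong[of h, symmetric])
    show "inj_on h ?A"
    proof (rule inj_onI)
      fix S T assume ST: "S \<in> ?A" "T \<in> ?A" "h S = h T"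
      have "\<Union>(h S) = S" "\<Union>(h T) = T" using h[of S] h[of T] ST(1,2) by simp_all
      then show "S = T" unfolding ST(3) by simp
    qed
  qed auto
  also have "\<dots> \<le> \<Xi> b"
    unfolding \<Xi>_def partition_fn_def
  proof (rule sum_mono2)
    show "finite ?F" by (rule finite_compat_families[OF polymer_system.finite_P[OF polymer_system_polymers]])
    show "h ` ?A \<subseteq> ?F"
    proof (rule image_subsetI)
      fix S assume S: "S \<in> ?A"
      then have hS: "h S \<in> compat_families incompat linked_sets" "\<Union>(h S) = S" using h[of S] by simp_all
      have "finite S" using S finite_subset[OF _ finite_part[OF Z]] by auto
      then have "card T \<le> b" if "T \<in> h S" for T
      proof -
        have "T \<subseteq> \<Union>(h S)" using that by (rule Union_upper)
        then have "T \<subseteq> S" by (simp only: hS(2))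
        from card_mono[OF \<open>finite S\<close> this] S show ?thesis by simp
      qed
      then have "h S \<subseteq> polymers G Z b" using hS(1) by (auto simp: compat_families_def polymers_eq)
      then show "h S \<in> ?F" using hS(1) by (simp add: compat_families_def)
    qed
  qed (auto intro: prod_nonneg polymer_weight_nonneg)
  finally show ?thesis .
qed

lemma Xi_le:
  assumes "t \<le> b"
  shows "\<Xi> b \<le> \<Xi> t * exp (\<Sum>S | two_linked G Z S \<and> card S \<in> {Suc t..b}. polymer_weight G S)"
proof -
  let ?Q = "{S. two_linked G Z S \<and> card S \<in> {Suc t..b}}"
  have eq: "polymers G Z b = polymers G Z t \<union> ?Q" using assms by (auto simp: polymers_eq)
  have fin: "finite (polymers G Z t)" by (rule polymer_system.finite_P[OF polymer_system_polymers])
  have finQ: "finite ?Q" by (rule finite_subset[OF _ finite_linked_sets]) auto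
  show ?thesis
    unfolding \<Xi>_def eq
  proof (rule partition_fn_Un_le[OF fin finQ])
    show "polymers G Z t \<inter> ?Q = {}" by (auto simp: polymers_eq)
    show "incompat S S" if "S \<in> polymers G Z t \<union> ?Q" for S
      using that by (intro incompat_refl) (auto simp: polymers_eq)
  qed (simp_all add: polymer_weight_nonneg compatible_sym)
qed

lemma trace_sum_le:
  fixes y c :: real
  assumes y: "y \<ge> 0"
    and w: "\<And>S. S \<subseteq> Z \<Longrightarrow> card S = b \<Longrightarrow> polymer_weight G S \<le> y"
  shows "trace_sum c \<le> \<Xi> b + card {S. S \<subseteq> Z \<and> real (card S) \<le> c} * y"
proof -
  let ?A = "{S. S \<subseteq> Z \<and> real (card S) \<le> c}"
  let ?B = "{S. S \<subseteq> Z \<and> card S \<le> b}"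
  have "trace_sum c \<le> (\<Sum>S\<in>?B \<union> ?A. if S \<in> ?B then polymer_weight G S else y)"
  proof -
    have "trace_sum c \<le> (\<Sum>S\<in>?A. if S \<in> ?B then polymer_weight G S else y)"
      unfolding trace_sum_def
    proof (rule sum_mono)
      fix S assume S: "S \<in> ?A"
      show "polymer_weight G S \<le> (if S \<in> ?B then polymer_weight G S else y)"
      proof (cases "S \<in> ?B")
        case False
        then have "b \<le> card S" using S by auto
        then obtain S' where S': "S' \<subseteq> S" "card S' = b" "finite S'"
          by (rule obtain_subset_with_card_n)
        then have "polymer_weight G S \<le> polymer_weight G S'" using S by (intro polymer_weight_antimono) auto
        also have "\<dots> \<le> y" using S' S by (intro w) auto
        finally show ?thesis using False by auto
      qed simp
    qed
    also have "\<dots> \<le> (\<Sum>S\<in>?B \<union> ?A. if S \<in> ?B then polymer_weight G S else y)"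
      using finite_subsets y polymer_weight_nonneg by (intro sum_mono2) auto
    finally show ?thesis .
  qed
  also have "\<dots> = (\<Sum>S\<in>?B. polymer_weight G S) + (\<Sum>S\<in>?A - ?B. y)"
  proof -
    have "?B \<union> ?A = ?B \<union> (?A - ?B)" by auto
    then have "(\<Sum>S\<in>?B \<union> ?A. if S \<in> ?B then polymer_weight G S else y) =
       (\<Sum>S\<in>?B \<union> (?A - ?B). if S \<in> ?B then polymer_weight G S else y)" by (simp only:)
    also have "\<dots> = (\<Sum>S\<in>?B. if S \<in> ?B then polymer_weight G S else y) + (\<Sum>S\<in>?A - ?B. if S \<in> ?B then polymer_weight G S else y)"
      by (rule sum.union_disjoint) (use finite_subsets finite_Diff in auto)
    also have "(\<Sum>S\<in>?B. if S \<in> ?B then polymer_weight G S else y) = (\<Sum>S\<in>?B. polymer_weight G S)"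
      by (rule sum.cong) auto
    also have "(\<Sum>S\<in>?A - ?B. if S \<in> ?B then polymer_weight G S else y) = (\<Sum>S\<in>?A - ?B. y)"
      by (rule sum.cong) auto
    finally show ?thesis .
  qed
  also have "\<dots> \<le> \<Xi> b + card ?A * y"
  proof (rule add_mono[OF small_traces_le_Xi])
    have "card (?A - ?B) \<le> card ?A" by (rule card_mono[OF finite_subsets]) auto
    then show "(\<Sum>S\<in>?A - ?B. y) \<le> card ?A * y" using y by (simp add: mult_right_mono)
  qed
  finally show ?thesis .
qed

lemma trace_sum_ge:
  fixes x c :: real
  assumes x: "0 < x" "x \<le> 1"
    and w: "\<And>S. S \<subseteq> Z \<Longrightarrow> card S \<le> t \<Longrightarrow> polymer_weight G S \<le> x ^ card S"
  shows "\<Xi> t \<le> trace_sum c + 2 ^ n * x powr c"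
proof -
  let ?F = "compat_families incompat (polymers G Z t)"
  let ?A = "{S. S \<subseteq> Z \<and> real (card S) \<le> c}" and ?B = "{S. S \<subseteq> Z \<and> \<not> real (card S) \<le> c}"
  define g where "g = (\<lambda>S. if real (card S) \<le> c then polymer_weight G S else x powr c)"
  have F: "X \<in> compat_families incompat linked_sets" if "X \<in> ?F" for X
    using that compat_families_polymers by blast
  have sub: "\<Union>X \<subseteq> Z" if "X \<in> ?F" for X
    using that by (auto simp: compat_families_def polymers_def)
  have inj: "inj_on Union ?F"
    by (rule inj_onI) (rule compat_family_Union_inj[OF F F])
  have "\<Xi> t \<le> (\<Sum>X\<in>?F. g (\<Union>X))"
    unfolding \<Xi>_def partition_fn_def
  proof (rule sum_mono)
    fix X assume X: "X \<in> ?F"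
    have wX: "polymer_weight G (\<Union>X) = (\<Prod>S\<in>X. polymer_weight G S)" "card (\<Union>X) = (\<Sum>S\<in>X. card S)"
      using compat_family_weight[OF F[OF X]] by auto
    have "(\<Prod>S\<in>X. polymer_weight G S) \<le> (\<Prod>S\<in>X. x ^ card S)"
    proof (rule prod_mono)
      fix S assume "S \<in> X"
      then have "S \<subseteq> Z" "card S \<le> t" using X by (auto simp: compat_families_def polymers_def)
      then show "0 \<le> polymer_weight G S \<and> polymer_weight G S \<le> x ^ card S" using w polymer_weight_nonneg by simp
    qed
    also have "\<dots> = x ^ card (\<Union>X)" by (simp add: wX(2) power_sum)
    also have "\<dots> = x powr real (card (\<Union>X))" using x by (simp add: powr_realpow)
    finally have le: "(\<Prod>S\<in>X. polymer_weight G S) \<le> x powr real (card (\<Union>X))" .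
    show "(\<Prod>S\<in>X. polymer_weight G S) \<le> g (\<Union>X)"
    proof (cases "real (card (\<Union>X)) \<le> c")
      case True
      then show ?thesis by (simp add: g_def wX(1))
    next
      case False
      then have "x powr real (card (\<Union>X)) \<le> x powr c" using x by (intro powr_mono') auto
      then show ?thesis using le False by (simp add: g_def)
    qed
  qed
  also have "\<dots> = (\<Sum>S\<in>Union ` ?F. g S)" by (simp add: sum.reindex[OF inj])
  also have "\<dots> \<le> (\<Sum>S\<in>?A \<union> ?B. g S)"
    using finite_subsets sub by (intro sum_mono2) (auto simp: g_def polymer_weight_nonneg)
  also have "\<dots> = (\<Sum>S\<in>?A. g S) + (\<Sum>S\<in>?B. g S)"
    using finite_subsets by (intro sum.union_disjoint) auto
  also have "(\<Sum>S\<in>?A. g S) = trace_sum c"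
    unfolding trace_sum_def by (rule sum.cong) (auto simp: g_def)
  also have "(\<Sum>S\<in>?B. g S) = card ?B * x powr c"
    by (simp add: g_def)
  also have "\<dots> \<le> 2 ^ n * x powr c"
  proof (rule mult_right_mono)
    have "card ?B \<le> card (Pow Z)" using finite_part[OF Z] by (intro card_mono) auto
    then show "real (card ?B) \<le> 2 ^ n"
      using part_size[OF Z] finite_part[OF Z] by (simp add: card_Pow)
  qed simp
  finally show ?thesis by simp
qed

lemma card_indep_sets_small_trace:
  fixes c :: real
  shows "real (card {I \<in> indep_sets G. real (card (I \<inter> Z)) \<le> c}) = 2 ^ ((k - 1) * n) * trace_sum c"
proof -
  have finI: "finite (indep_sets G)"
    by (rule finite_subset[of _ "Pow (verts G)"]) (use finite_verts in \<open>auto simp: indep_sets_def\<close>)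
  let ?A = "{S. S \<subseteq> Z \<and> real (card S) \<le> c}"
  have "{I \<in> indep_sets G. real (card (I \<inter> Z)) \<le> c} = (\<Union>S\<in>?A. {I \<in> indep_sets G. I \<inter> Z = S})" by auto
  also have "card \<dots> = (\<Sum>S\<in>?A. card {I \<in> indep_sets G. I \<inter> Z = S})"
    using finI finite_subsets by (intro card_UN_disjoint) auto
  finally have "real (card {I \<in> indep_sets G. real (card (I \<inter> Z)) \<le> c}) =
     (\<Sum>S\<in>?A. real (card {I \<in> indep_sets G. I \<inter> Z = S}))" by simp
  also have "\<dots> = (\<Sum>S\<in>?A. 2 ^ ((k - 1) * n) * polymer_weight G S)"
    by (rule sum.cong) (auto simp: card_indep_sets_trace)
  finally show ?thesis by (simp add: trace_sum_def sum_distrib_left)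
qed

end

lemma card_small_subsets_le:
  fixes \<delta> :: real
  assumes "finite Z" "card Z = n" "0 < \<delta>" "\<delta> \<le> 1"
  shows "real (card {S. S \<subseteq> Z \<and> real (card S) \<le> \<delta> * n}) \<le> exp (n * (\<delta> - \<delta> * ln \<delta>))"
proof -
  let ?A = "{S. S \<subseteq> Z \<and> real (card S) \<le> \<delta> * n}"
  have "real (card ?A) * \<delta> powr (\<delta> * n) = (\<Sum>S\<in>?A. \<delta> powr (\<delta> * n))" by simp
  also have "\<dots> \<le> (\<Sum>S\<in>?A. \<delta> ^ card S)"
  proof (rule sum_mono)
    fix S assume "S \<in> ?A"
    then have "\<delta> powr (\<delta> * n) \<le> \<delta> powr real (card S)" using assms by (intro powr_mono') auto
    then show "\<delta> powr (\<delta> * n) \<le> \<delta> ^ card S" using assms by (simp add: powr_realpow)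
  qed
  also have "\<dots> \<le> (\<Sum>S\<in>Pow Z. \<delta> ^ card S)"
    using assms by (intro sum_mono2) auto
  also have "\<dots> = (\<Prod>v\<in>Z. \<delta> + 1)"
    by (subst prod_add[OF assms(1)]) simp
  also have "\<dots> = (1 + \<delta>) ^ n" using assms by (simp add: add.commute)
  also have "\<dots> \<le> exp \<delta> ^ n" using assms by (intro power_mono) auto
  also have "\<dots> = exp (n * \<delta>)" by (simp add: exp_of_nat_mult)
  finally have "real (card ?A) * \<delta> powr (\<delta> * n) \<le> exp (n * \<delta>)" .
  moreover have "\<delta> powr (\<delta> * n) = exp (n * (\<delta> * ln \<delta>))" using assms by (simp add: powr_def mult_ac)
  ultimately have "real (card ?A) \<le> exp (n * \<delta>) / exp (n * (\<delta> * ln \<delta>))"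
    by (simp add: pos_le_divide_eq)
  also have "\<dots> = exp (n * (\<delta> - \<delta> * ln \<delta>))" by (simp add: right_diff_distrib exp_diff)
  finally show ?thesis .
qed

context regular_partite
begin

lemma partite_class_of_part: "Z \<in> \<Z> \<Longrightarrow> partite_class G \<Z> k n r Z"
  by unfold_locales

lemma finite_indep_sets: "finite (indep_sets G)"
  by (rule finite_subset[of _ "Pow (verts G)"]) (use finite_verts in \<open>auto simp: indep_sets_def\<close>)

lemma card_two_small_traces_le:
  fixes c N :: real
  assumes Z: "Z \<in> \<Z>" "Z' \<in> \<Z>" "Z \<noteq> Z'"
    and N: "\<And>Z. Z \<in> \<Z> \<Longrightarrow> card {S. S \<subseteq> Z \<and> real (card S) \<le> c} \<le> N"
  shows "card {I \<in> indep_sets G. real (card (I \<inter> Z)) \<le> c \<and> real (card (I \<inter> Z')) \<le> c} \<le> N ^ 2 * 2 ^ ((k - 2) * n)"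
proof -
  let ?A = "\<lambda>Z. {S. S \<subseteq> Z \<and> real (card S) \<le> c}"
  let ?V = "verts G - Z - Z'"
  let ?I = "{I \<in> indep_sets G. real (card (I \<inter> Z)) \<le> c \<and> real (card (I \<inter> Z')) \<le> c}"
  let ?f = "\<lambda>I. (I \<inter> Z, I \<inter> Z', I \<inter> ?V)"
  have fin: "finite (?A Z)" if "Z \<in> \<Z>" for Z
    by (rule finite_subset[of _ "Pow Z"]) (use finite_part[OF that] in auto)
  have "inj_on ?f ?I"
  proof (rule inj_onI)
    fix I J assume IJ: "I \<in> ?I" "J \<in> ?I" "?f I = ?f J"
    then have "I \<subseteq> verts G" "J \<subseteq> verts G" by (auto simp: indep_sets_def)
    then have "I = (I \<inter> Z) \<union> (I \<inter> Z') \<union> (I \<inter> ?V)" "J = (J \<inter> Z) \<union> (J \<inter> Z') \<union> (J \<inter> ?V)" by auto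
    then show "I = J" using IJ(3) by (metis prod.inject)
  qed
  moreover have "?f ` ?I \<subseteq> ?A Z \<times> ?A Z' \<times> Pow ?V" by auto
  moreover have "finite (?A Z \<times> ?A Z' \<times> Pow ?V)" using fin Z finite_verts by auto
  ultimately have "card ?I \<le> card (?A Z \<times> ?A Z' \<times> Pow ?V)" by (rule card_inj_on_le)
  also have "\<dots> = card (?A Z) * (card (?A Z') * 2 ^ card ?V)"
    using finite_verts by (simp add: card_cartesian_product card_Pow)
  also have "card ?V = (k - 2) * n"
  proof -
    have "Z' \<subseteq> verts G - Z" using parts_disjoint[OF Z] part_subset[OF Z(2)] by auto
    then have "card ?V = (k - 1) * n - n"
      using finite_part[OF Z(2)] card_verts_minus_part[OF Z(1)] part_size[OF Z(2)] by (simp add: card_Diff_subset)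
    also have "\<dots> = (k - 2) * n"
      using diff_mult_distrib[of "k - 1" 1 n] by (simp add: numeral_2_eq_2)
    finally show ?thesis .
  qed
  finally have "real (card ?I) \<le> real (card (?A Z) * (card (?A Z') * 2 ^ ((k - 2) * n)))"
    by (rule of_nat_mono)
  also have "\<dots> = real (card (?A Z)) * (real (card (?A Z')) * 2 ^ ((k - 2) * n))"
    by (simp only: of_nat_mult of_nat_power of_nat_numeral)
  also have "\<dots> \<le> N * (N * 2 ^ ((k - 2) * n))"
    using N[OF Z(1)] N[OF Z(2)] by (intro mult_mono mult_right_mono) auto
  finally show ?thesis by (simp add: power2_eq_square mult.assoc)
qed

lemma card_indep_sets_bounds:
  fixes b c N :: real
  assumes D: "Defect G \<Z> b" "b \<le> c"
    and N: "\<And>Z. Z \<in> \<Z> \<Longrightarrow> card {S. S \<subseteq> Z \<and> real (card S) \<le> c} \<le> N"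
  shows "card (indep_sets G) \<le> 2 ^ ((k - 1) * n) * (\<Sum>Z\<in>\<Z>. partite_class.trace_sum G Z c)"
    and "2 ^ ((k - 1) * n) * (\<Sum>Z\<in>\<Z>. partite_class.trace_sum G Z c) \<le>
      card (indep_sets G) + real k ^ 2 * (N ^ 2 * 2 ^ ((k - 2) * n))"
proof -
  let ?I = "\<lambda>Z. {I \<in> indep_sets G. real (card (I \<inter> Z)) \<le> c}"
  have cI: "real (card (?I Z)) = 2 ^ ((k - 1) * n) * partite_class.trace_sum G Z c" if "Z \<in> \<Z>" for Z
    by (rule partite_class.card_indep_sets_small_trace[OF partite_class_of_part[OF that]])
  have finI: "finite (?I Z)" for Z using finite_indep_sets by simp
  have Un: "indep_sets G = (\<Union>Z\<in>\<Z>. ?I Z)"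
  proof (intro equalityI subsetI)
    fix I assume I: "I \<in> indep_sets G"
    then obtain Z where "Z \<in> \<Z>" "real (card (I \<inter> Z)) \<le> b" using D(1) by (auto simp: Defect_def)
    then show "I \<in> (\<Union>Z\<in>\<Z>. ?I Z)" using I D(2) by force
  qed auto
  have sum: "(\<Sum>Z\<in>\<Z>. real (card (?I Z))) = 2 ^ ((k - 1) * n) * (\<Sum>Z\<in>\<Z>. partite_class.trace_sum G Z c)"
    using cI by (simp add: sum_distrib_left)
  have "card (indep_sets G) \<le> (\<Sum>Z\<in>\<Z>. card (?I Z))"
    by (subst Un, rule card_UN_le[OF finite_parts])
  then have "real (card (indep_sets G)) \<le> real (\<Sum>Z\<in>\<Z>. card (?I Z))" by linarith
  then show "card (indep_sets G) \<le> 2 ^ ((k - 1) * n) * (\<Sum>Z\<in>\<Z>. partite_class.trace_sum G Z c)"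
    using sum by simp
  let ?O = "\<lambda>Z Z'. {I \<in> indep_sets G. real (card (I \<inter> Z)) \<le> c \<and> real (card (I \<inter> Z')) \<le> c}"
  let ?J = "\<lambda>Z. ?I Z - (\<Union>Z'\<in>\<Z> - {Z}. ?O Z Z')"
  have N0: "N \<ge> 0" if "Z \<in> \<Z>" for Z using N[OF that] by linarith
  have IJ: "real (card (?I Z)) \<le> real (card (?J Z)) + real k * (N ^ 2 * 2 ^ ((k - 2) * n))" if Z: "Z \<in> \<Z>" for Z
  proof -
    have "card (?I Z) \<le> card (?J Z \<union> (\<Union>Z'\<in>\<Z> - {Z}. ?O Z Z'))"
      using finite_indep_sets finite_parts by (intro card_mono) auto
    also have "\<dots> \<le> card (?J Z) + card (\<Union>Z'\<in>\<Z> - {Z}. ?O Z Z')" by (rule card_Un_le)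
    also have "card (\<Union>Z'\<in>\<Z> - {Z}. ?O Z Z') \<le> (\<Sum>Z'\<in>\<Z> - {Z}. card (?O Z Z'))"
      using finite_parts by (intro card_UN_le) auto
    finally have "real (card (?I Z)) \<le> real (card (?J Z) + (\<Sum>Z'\<in>\<Z> - {Z}. card (?O Z Z')))"
      by (intro of_nat_mono) simp
    also have "\<dots> = real (card (?J Z)) + (\<Sum>Z'\<in>\<Z> - {Z}. real (card (?O Z Z')))"
      by (simp only: of_nat_add of_nat_sum)
    also have "(\<Sum>Z'\<in>\<Z> - {Z}. real (card (?O Z Z'))) \<le> (\<Sum>Z'\<in>\<Z> - {Z}. N ^ 2 * 2 ^ ((k - 2) * n))"
      using Z N by (intro sum_mono card_two_small_traces_le) auto
    also have "\<dots> \<le> real k * (N ^ 2 * 2 ^ ((k - 2) * n))"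
      using Z card_parts finite_parts by (simp add: mult_right_mono)
    finally show ?thesis by simp
  qed
  have "(\<Sum>Z\<in>\<Z>. card (?J Z)) = card (\<Union>Z\<in>\<Z>. ?J Z)"
    using finite_indep_sets finite_parts by (intro card_UN_disjoint[symmetric]) auto
  also have "\<dots> \<le> card (indep_sets G)"
    using finite_indep_sets by (intro card_mono) auto
  finally have J: "(\<Sum>Z\<in>\<Z>. real (card (?J Z))) \<le> real (card (indep_sets G))"
    unfolding of_nat_sum[symmetric] by (rule of_nat_mono)
  have "(\<Sum>Z\<in>\<Z>. real (card (?I Z))) \<le> (\<Sum>Z\<in>\<Z>. real (card (?J Z)) + real k * (N ^ 2 * 2 ^ ((k - 2) * n)))"
    by (intro sum_mono IJ)
  also have "\<dots> = (\<Sum>Z\<in>\<Z>. real (card (?J Z))) + real k ^ 2 * (N ^ 2 * 2 ^ ((k - 2) * n))"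
    by (simp add: sum.distrib card_parts power2_eq_square)
  finally show "2 ^ ((k - 1) * n) * (\<Sum>Z\<in>\<Z>. partite_class.trace_sum G Z c) \<le>
      card (indep_sets G) + real k ^ 2 * (N ^ 2 * 2 ^ ((k - 2) * n))"
    using J sum by linarith
qed

end

context partite_class
begin

lemma Xi_estimates:
  fixes x y z \<epsilon> :: real
  assumes x: "0 < x" "x \<le> z" "real n * x ^ Suc t \<le> z ^ Suc t"
    and y: "0 < y" "real n * (real \<Delta> ^ 2 * y) ^ r \<le> 1"
    and wx: "\<And>S. S \<subseteq> Z \<Longrightarrow> card S \<le> r \<Longrightarrow> polymer_weight G S \<le> x ^ card S"
    and wy: "\<And>S. S \<subseteq> Z \<Longrightarrow> card S \<le> b \<Longrightarrow> polymer_weight G S \<le> y ^ card S"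
    and t: "t \<le> r" "t \<le> b" and \<epsilon>: "0 < \<epsilon>" "\<epsilon> \<le> 1"
    and z: "8 * exp 1 * real \<Delta> ^ 3 * z \<le> \<epsilon> / (4 * (real t + 1))"
    and y2: "real \<Delta> ^ 2 * y \<le> \<epsilon> / 4"
  shows "\<bar>ln (\<Xi> t) - cluster_exponent t\<bar> \<le> \<epsilon>" and "\<Xi> b \<le> \<Xi> t * exp \<epsilon>"
proof -
  have D1: "real \<Delta> \<ge> 1" using Delta_ge_1 by linarith
  have z0: "z > 0" using x by linarith
  let ?u = "8 * exp 1 * real \<Delta> ^ 3 * z"
  have u0: "?u > 0" using z0 D1 by simp
  have u1: "?u \<le> \<epsilon> / 4"
  proof -
    have "\<epsilon> / (4 * (real t + 1)) \<le> \<epsilon> / 4" using \<epsilon> by (intro divide_left_mono) auto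
    then show ?thesis using z by linarith
  qed
  have xz: "8 * exp 1 * real \<Delta> ^ 3 * x \<le> ?u" using x(2) D1 by (intro mult_left_mono) auto
  have pw: "?u ^ Suc t \<le> ?u"
    using u0 u1 \<epsilon> power_le_one[of ?u t] by (simp add: mult_left_le)
  have "\<bar>ln (\<Xi> t) - cluster_exponent t\<bar> \<le> t * n * (4 * exp 1 * real \<Delta> ^ 3 * x) ^ Suc t"
  proof (rule cluster_exponent_approx[OF x(1)])
    show "8 * exp 1 * real \<Delta> ^ 3 * x \<le> 1" using xz u1 \<epsilon> by linarith
    show "polymer_weight G S \<le> x ^ card S" if "S \<subseteq> Z" "card S \<le> t" for S
      using that t(1) by (intro wx) auto
  qed
  also have "\<dots> = t * ((4 * exp 1 * real \<Delta> ^ 3) ^ Suc t * (real n * x ^ Suc t))"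
    by (simp only: power_mult_distrib of_nat_mult) (simp only: ac_simps)
  also have "\<dots> \<le> t * ((4 * exp 1 * real \<Delta> ^ 3) ^ Suc t * z ^ Suc t)"
    using x(3) by (intro mult_left_mono) auto
  also have "\<dots> = t * (4 * exp 1 * real \<Delta> ^ 3 * z) ^ Suc t"
    by (simp only: power_mult_distrib)
  also have "\<dots> \<le> t * ?u ^ Suc t"
    using z0 D1 by (intro mult_left_mono power_mono mult_right_mono) auto
  also have "\<dots> \<le> t * ?u" using pw by (intro mult_left_mono) auto
  also have "\<dots> \<le> (real t + 1) * (\<epsilon> / (4 * (real t + 1)))"
    using z u0 by (intro mult_mono) auto
  also have "\<dots> = \<epsilon> / 4" by (simp add: divide_simps)
  also have "\<dots> \<le> \<epsilon>" using \<epsilon> by simp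
  finally show "\<bar>ln (\<Xi> t) - cluster_exponent t\<bar> \<le> \<epsilon>" .
  let ?f = "\<lambda>s. if s \<le> r then x ^ s else y ^ s"
  let ?px = "real \<Delta> ^ 2 * x" and ?py = "real \<Delta> ^ 2 * y"
  have eq: "{S. two_linked G Z S \<and> card S \<in> {Suc t..b}} = {S. two_linked G Z S \<and> card S \<in> {Suc t..b} \<and> S \<inter> Z \<noteq> {}}"
    by (auto simp: two_linked_def)
  have pxu: "?px \<le> ?u" and pzu: "real \<Delta> ^ 2 * z \<le> ?u"
  proof -
    have "real \<Delta> ^ 2 \<le> real \<Delta> ^ 3" using D1 by (intro power_increasing) auto
    also have "\<dots> = 1 * real \<Delta> ^ 3" by simp
    also have "\<dots> \<le> 8 * exp 1 * real \<Delta> ^ 3"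
      using exp_ge_add_one_self[of "1 :: real"] by (intro mult_right_mono) auto
    finally have d: "real \<Delta> ^ 2 \<le> 8 * exp 1 * real \<Delta> ^ 3" .
    show "real \<Delta> ^ 2 * z \<le> ?u" by (rule mult_right_mono[OF d]) (use z0 in simp)
    then show "?px \<le> ?u" using mult_left_mono[OF x(2), of "real \<Delta> ^ 2"] by simp
  qed
  have "(\<Sum>S | two_linked G Z S \<and> card S \<in> {Suc t..b}. polymer_weight G S) \<le>
    card Z * (\<Sum>s\<in>{Suc t..b}. \<Delta> ^ (2 * s) * ?f s)"
    unfolding eq
  proof (rule sum_linked)
    fix S assume "two_linked G Z S" "card S \<in> {Suc t..b}"
    then show "polymer_weight G S \<le> ?f (card S)" using wx[of S] wy[of S] by (auto simp: two_linked_def)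
  qed (use x y polymer_weight_nonneg in auto)
  also have "(\<Sum>s\<in>{Suc t..b}. \<Delta> ^ (2 * s) * ?f s) \<le> (\<Sum>s=Suc t..r. ?px ^ s) + (\<Sum>s=Suc r..b. ?py ^ s)"
  proof -
    have px: "real (\<Delta> ^ (2 * s)) * x ^ s = ?px ^ s" and py: "real (\<Delta> ^ (2 * s)) * y ^ s = ?py ^ s" for s
      by (simp_all add: power_mult_distrib power_mult)
    have "(\<Sum>s\<in>{Suc t..b}. \<Delta> ^ (2 * s) * ?f s) \<le> (\<Sum>s\<in>{Suc t..r} \<union> {Suc r..b}. \<Delta> ^ (2 * s) * ?f s)"
      using x y by (intro sum_mono2) auto
    also have "\<dots> = (\<Sum>s\<in>{Suc t..r}. \<Delta> ^ (2 * s) * ?f s) + (\<Sum>s\<in>{Suc r..b}. \<Delta> ^ (2 * s) * ?f s)"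
      by (rule sum.union_disjoint) auto
    also have "(\<Sum>s\<in>{Suc t..r}. \<Delta> ^ (2 * s) * ?f s) = (\<Sum>s=Suc t..r. ?px ^ s)"
      by (rule sum.cong[OF refl]) (simp add: px[symmetric])
    also have "(\<Sum>s\<in>{Suc r..b}. \<Delta> ^ (2 * s) * ?f s) = (\<Sum>s=Suc r..b. ?py ^ s)"
      by (rule sum.cong[OF refl]) (simp add: py[symmetric])
    finally show ?thesis .
  qed
  also have "\<dots> \<le> 2 * ?px ^ Suc t + 2 * ?py ^ Suc r"
    using x y pxu u1 y2 \<epsilon> by (intro add_mono sum_geometric_le) auto
  finally have "(\<Sum>S | two_linked G Z S \<and> card S \<in> {Suc t..b}. polymer_weight G S) \<le>
    real n * (2 * ?px ^ Suc t + 2 * ?py ^ Suc r)"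
    unfolding part_size[OF Z] by (simp add: mult_left_mono)
  also have "\<dots> = 2 * ((real \<Delta> ^ 2) ^ Suc t * (real n * x ^ Suc t)) + 2 * (real n * ?py ^ r * ?py)"
    unfolding power_mult_distrib[of _ x] by (simp add: algebra_simps)
  also have "\<dots> \<le> 2 * ((real \<Delta> ^ 2) ^ Suc t * z ^ Suc t) + 2 * (1 * ?py)"
    using x(3) y by (intro add_mono mult_left_mono mult_right_mono) auto
  also have "\<dots> = 2 * (real \<Delta> ^ 2 * z) ^ Suc t + 2 * ?py" by (simp only: power_mult_distrib mult_1)
  also have "\<dots> \<le> 2 * ?u ^ Suc t + 2 * ?py"
    using pzu z0 by (intro add_mono mult_left_mono power_mono) auto
  also have "\<dots> \<le> \<epsilon>" using pw u1 y2 by linarith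
  finally have E: "(\<Sum>S | two_linked G Z S \<and> card S \<in> {Suc t..b}. polymer_weight G S) \<le> \<epsilon>" .
  have "\<Xi> b \<le> \<Xi> t * exp (\<Sum>S | two_linked G Z S \<and> card S \<in> {Suc t..b}. polymer_weight G S)"
    by (rule Xi_le[OF t(2)])
  also have "\<dots> \<le> \<Xi> t * exp \<epsilon>" using E Xi_ge_1[of t] by (intro mult_left_mono) auto
  finally show "\<Xi> b \<le> \<Xi> t * exp \<epsilon>" .
qed

lemma degree_le:
  assumes E1: "Exp1 k r G \<Z> a" and a: "a \<le> 1 / 2" and n: "n \<ge> 2"
  shows "real r ^ 2 \<le> 2 * real n"
proof -
  have main: "real r * real (card S) \<le> 2 * real n" if S: "S \<subseteq> Z" "card S \<le> r" for S
  proof -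
    have "card (nbhd G S) \<le> card (verts G - Z)"
      using nbhd_subset[OF S(1)] finite_verts by (intro card_mono) auto
    then have "real (card (nbhd G S)) \<le> real ((k - 1) * n)"
      unfolding card_verts_minus_part[OF Z] by (rule of_nat_mono)
    moreover have "(real k - 1 - a) * r * card S \<le> card (nbhd G S)"
      using E1 Z S unfolding Exp1_def by blast
    ultimately have "(real k - 1 - a) * r * card S \<le> (real k - 1) * n" using k_ge by (simp add: of_nat_diff)
    moreover have "(real k - 1) / 2 * (real r * card S) \<le> (real k - 1 - a) * (real r * card S)"
      using a k_ge by (intro mult_right_mono) auto
    ultimately have "(real k - 1) * (real r * card S) \<le> (real k - 1) * (2 * real n)" by (simp add: mult.assoc)
    then show ?thesis using k_ge by (simp add: mult_le_cancel_left)
  qed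
  show ?thesis
  proof (cases "r \<le> n")
    case True
    then obtain S where "S \<subseteq> Z" "card S = r" "finite S"
      using obtain_subset_with_card_n[of r Z] part_size[OF Z] by auto
    then show ?thesis using main[of S] by (simp add: power2_eq_square)
  next
    case False
    then have "real r * real n \<le> 2 * real n" using main[of Z] part_size[OF Z] by simp
    then have "r \<le> 2" using n by simp
    then show ?thesis using False n by simp
  qed
qed

lemma trace_sum_estimates:
  fixes a \<beta> \<delta> \<epsilon> g :: real and t :: nat
  defines "g \<equiv> gam k"
  assumes E1: "Exp1 k r G \<Z> a" and E2: "Exp2 k n r G \<Z> \<beta>"
    and \<beta>: "\<beta> > 0" and t: "t \<ge> 1" and a: "a * (real t + 1) \<le> 1 / 2"
    and n: "n \<ge> 2" "real n \<le> g powr (real r * real t)"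
    and r: "t \<le> r" "2 * (real t + 1) \<le> \<beta> * r"
    and \<epsilon>: "0 < \<epsilon>" "\<epsilon> \<le> 1" and \<delta>: "0 < \<delta>" "\<delta> \<le> 1"
    and u1: "8 * exp 1 * (real k * real r ^ 2) ^ 3 * exp (- (ln g / (2 * (real t + 1))) * r) \<le> \<epsilon> / (4 * (real t + 1))"
    and u2: "g ^ t * ((real k * real r ^ 2) ^ 2 * exp (- (\<beta> * ln g) * r)) \<le> \<epsilon> / 4"
    and u3: "exp (- (ln g / 2 * \<delta>) * r) \<le> 1 / 4"
    and n2: "(1 / 2) ^ n \<le> \<epsilon>" and ent: "\<delta> - \<delta> * ln \<delta> \<le> ln g * \<beta> ^ 2 / 4"
    and n3: "exp (- (ln g * \<beta> ^ 2 / 4) * n) \<le> \<epsilon>"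
  shows "\<bar>ln (\<Xi> t) - cluster_exponent t\<bar> \<le> \<epsilon>"
    and "trace_sum (\<delta> * n) \<le> \<Xi> t * exp \<epsilon> + \<epsilon>"
    and "\<Xi> t \<le> trace_sum (\<delta> * n) + \<epsilon>"
proof -
  have g: "g > 1" unfolding g_def by (rule gam_gt_1[OF k_ge])
  have lng: "ln g > 0" using g by simp
  have pe: "g powr c = exp (ln g * c)" for c using g by (simp add: powr_def mult.commute)
  have a2: "a \<le> 1 / 4"
  proof (cases "a \<ge> 0")
    case True
    then have "a * 2 \<le> a * (real t + 1)" using t by (intro mult_left_mono) auto
    then show ?thesis using a by simp
  qed simp
  have r0: "real r > 0" using r_ge by simp
  define x where "x = g powr (- ((1 - a) * r))"
  define y where "y = g powr (- (\<beta> * r))"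
  define z where "z = g powr (- (r / (2 * (real t + 1))))"
  define q where "q = \<beta> * (real n / real r)"
  define b where "b = nat \<lfloor>q\<rfloor>"
  have xp: "x ^ s = g powr (- ((1 - a) * r * s))" and yp: "y ^ s = g powr (- (\<beta> * r * s))" for s
    using g by (simp_all add: x_def y_def powr_powr flip: powr_realpow)
  have D: "real \<Delta> = real k * real r ^ 2" by (simp add: \<Delta>_def)
  have wx: "polymer_weight G S \<le> x ^ card S" if S: "S \<subseteq> Z" "card S \<le> r" for S
    unfolding xp g_def
  proof (rule polymer_weight_le[OF S(1)])
    have "(real k - 1 - a) * r * card S \<le> card (nbhd G S)"
      using E1 Z S unfolding Exp1_def by blast
    then show "(1 - a) * r * card S \<le> card (nbhd G S) - (real k - 2) * r * card S"
      by (simp add: algebra_simps)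
  qed
  have bn: "real b \<le> q" unfolding b_def q_def using \<beta> by simp
  have wy: "polymer_weight G S \<le> y ^ card S" if S: "S \<subseteq> Z" "card S \<le> b" for S
    unfolding yp g_def
  proof (rule polymer_weight_le[OF S(1)])
    have "real (card S) \<le> \<beta> * (real n / real r)" using S(2) bn unfolding q_def[symmetric] by linarith
    then have "(real k - 2 + \<beta>) * r * card S \<le> card (nbhd G S)"
      using E2 Z S unfolding Exp2_def by blast
    then show "\<beta> * r * card S \<le> card (nbhd G S) - (real k - 2) * r * card S"
      by (simp add: algebra_simps)
  qed
  have x0: "0 < x" and y0: "0 < y" using g by (simp_all add: x_def y_def)
  have xz: "x \<le> z"
    unfolding x_def z_def
  proof (rule powr_mono)
    have "1 / (2 * (real t + 1)) \<le> 1 / 2" by (intro divide_left_mono) auto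
    then have "1 / (2 * (real t + 1)) \<le> 1 - a" using a2 by linarith
    then have "1 / (2 * (real t + 1)) * r \<le> (1 - a) * r" by (intro mult_right_mono) auto
    then show "- ((1 - a) * real r) \<le> - (real r / (2 * (real t + 1)))" by simp
  qed (use g in simp)
  have nx: "real n * x ^ Suc t \<le> z ^ Suc t"
  proof -
    have "real n * x ^ Suc t \<le> g powr (real r * real t) * x ^ Suc t"
      using n(2) x0 by (intro mult_right_mono) auto
    also have "\<dots> = g powr (real r * real t - (1 - a) * r * Suc t)"
      unfolding xp using g by (simp flip: powr_add)
    also have "\<dots> \<le> g powr (- (real r / 2))"
    proof (rule powr_mono)
      have "a * (real t + 1) * r \<le> 1 / 2 * r" using a by (intro mult_right_mono) auto
      then show "real r * real t - (1 - a) * r * Suc t \<le> - (real r / 2)" by (simp add: algebra_simps)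
    qed (use g in simp)
    also have "- (real r / 2) = - (r / (2 * (real t + 1))) * (real t + 1)"
      using add_pos_nonneg[of 1 "real t"] by (simp add: divide_simps)
    also have "g powr (- (r / (2 * (real t + 1))) * (real t + 1)) = g powr (- (r / (2 * (real t + 1))) * Suc t)"
      by (simp add: add.commute)
    also have "\<dots> = z ^ Suc t"
      using g by (simp add: z_def powr_powr flip: powr_realpow del: power_Suc)
    finally show ?thesis .
  qed
  have ye: "y = exp (- (\<beta> * ln g) * r)" by (simp add: y_def pe mult_ac)
  have ze: "z = exp (- (ln g / (2 * (real t + 1))) * r)" by (simp add: z_def pe)
  have gt1: "1 \<le> g ^ t" using g by simp
  have Dy: "g ^ t * (real \<Delta> ^ 2 * y) \<le> \<epsilon> / 4" using u2 by (simp only: D ye)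
  have y2: "real \<Delta> ^ 2 * y \<le> \<epsilon> / 4"
    using mult_right_mono[OF gt1, of "real \<Delta> ^ 2 * y"] y0 Dy by simp
  have ny: "real n * (real \<Delta> ^ 2 * y) ^ r \<le> 1"
  proof -
    have "g powr (real r * real t) = g powr real (t * r)" by (simp add: mult.commute)
    also have "\<dots> = g ^ (t * r)" using g by (intro powr_realpow) simp
    also have "\<dots> = (g ^ t) ^ r" by (rule power_mult)
    finally have "real n \<le> (g ^ t) ^ r" using n(2) by simp
    then have "real n * (real \<Delta> ^ 2 * y) ^ r \<le> (g ^ t) ^ r * (real \<Delta> ^ 2 * y) ^ r"
      using y0 by (intro mult_right_mono) auto
    also have "\<dots> = (g ^ t * (real \<Delta> ^ 2 * y)) ^ r" by (simp only: power_mult_distrib)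
    also have "\<dots> \<le> 1" using Dy \<epsilon> y0 g by (intro power_le_one) auto
    finally show ?thesis .
  qed
  have r2: "real r ^ 2 \<le> 2 * real n" using E1 a2 n(1) by (intro degree_le) auto
  have "\<beta> * r / 2 \<le> q"
    using r2 r0 \<beta> by (simp add: q_def field_simps power2_eq_square)
  moreover have "real t + 1 \<le> \<beta> * r / 2" using divide_right_mono[OF r(2), of 2] by simp
  ultimately have bnr: "real t + 1 \<le> q" by (rule order_trans[rotated])
  have bge: "q - 1 \<le> real b" unfolding b_def using bnr by linarith
  have tb: "t \<le> b" using bge bnr by linarith
  have bhalf: "q / 2 \<le> real b" using bge bnr t by simp
  show 1: "\<bar>ln (\<Xi> t) - cluster_exponent t\<bar> \<le> \<epsilon>"
    by (rule Xi_estimates(1)[OF x0 xz nx y0 ny wx wy r(1) tb \<epsilon> _ y2]) (use u1 in \<open>simp_all only: D ze\<close>)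
  have 2: "\<Xi> b \<le> \<Xi> t * exp \<epsilon>"
    by (rule Xi_estimates(2)[OF x0 xz nx y0 ny wx wy r(1) tb \<epsilon> _ y2]) (use u1 in \<open>simp_all only: D ze\<close>)
  have "trace_sum (\<delta> * n) \<le> \<Xi> b + card {S. S \<subseteq> Z \<and> real (card S) \<le> \<delta> * n} * y ^ b"
    using y0 wy by (intro trace_sum_le) auto
  also have "card {S. S \<subseteq> Z \<and> real (card S) \<le> \<delta> * n} * y ^ b \<le> exp (n * (ln g * \<beta> ^ 2 / 4)) * exp (- (ln g * \<beta> ^ 2 / 2) * n)"
  proof (rule mult_mono)
    have "real (card {S. S \<subseteq> Z \<and> real (card S) \<le> \<delta> * n}) \<le> exp (n * (\<delta> - \<delta> * ln \<delta>))"
      by (rule card_small_subsets_le[OF finite_part[OF Z] part_size[OF Z] \<delta>])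
    also have "\<dots> \<le> exp (n * (ln g * \<beta> ^ 2 / 4))"
      using mult_left_mono[OF ent, of "real n"] by (subst exp_le_cancel_iff) simp
    finally show "real (card {S. S \<subseteq> Z \<and> real (card S) \<le> \<delta> * n}) \<le> exp (n * (ln g * \<beta> ^ 2 / 4))" .
    have "\<beta> * r * (q / 2) \<le> \<beta> * r * b"
      using bhalf \<beta> by (intro mult_left_mono) auto
    moreover have "\<beta> * r * (q / 2) = \<beta> ^ 2 / 2 * n" using r0 by (simp add: q_def power2_eq_square)
    ultimately have "\<beta> ^ 2 / 2 * n \<le> \<beta> * r * b" by linarith
    then have "ln g * (\<beta> ^ 2 / 2 * n) \<le> ln g * (\<beta> * r * b)" using lng by (intro mult_left_mono) auto
    then show "y ^ b \<le> exp (- (ln g * \<beta> ^ 2 / 2) * n)" unfolding yp pe by (simp add: mult_ac)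
  qed (use y0 in auto)
  also have "\<dots> = exp (- (ln g * \<beta> ^ 2 / 4) * n)" by (simp flip: exp_add)
  finally show "trace_sum (\<delta> * n) \<le> \<Xi> t * exp \<epsilon> + \<epsilon>" using 2 n3 by linarith
  have x1: "x \<le> 1" unfolding pe x_def using lng a2 by simp
  have "\<Xi> t \<le> trace_sum (\<delta> * n) + 2 ^ n * x powr (\<delta> * n)"
    using r(1) by (intro trace_sum_ge x0 x1 wx) auto
  also have "x powr (\<delta> * n) = (x powr \<delta>) ^ n"
    using powr_realpow[of "x powr \<delta>" n] x0 by (simp add: powr_powr)
  also have "\<dots> \<le> (1 / 4) ^ n"
  proof (rule power_mono)
    have "x powr \<delta> = g powr (- ((1 - a) * r) * \<delta>)" unfolding x_def by (rule powr_powr)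
    also have "\<dots> = exp (- (ln g * ((1 - a) * r * \<delta>)))" by (simp add: pe)
    also have "\<dots> \<le> exp (- (ln g / 2 * \<delta>) * r)"
    proof -
      have "1 / 2 * (ln g * r * \<delta>) \<le> (1 - a) * (ln g * r * \<delta>)"
        using a2 lng \<delta> by (intro mult_right_mono) auto
      then show ?thesis by (simp add: mult_ac)
    qed
    finally show "x powr \<delta> \<le> 1 / 4" using u3 by linarith
  qed simp
  also have "(2::real) ^ n * (1 / 4) ^ n = (1 / 2) ^ n" by (simp flip: power_mult_distrib)
  finally show "\<Xi> t \<le> trace_sum (\<delta> * n) + \<epsilon>" using n2 by simp
qed

end

section \<open>The independent set count\<close>

lemma alpha_le: "k \<ge> 2 \<Longrightarrow> alpha k t * (real t + 1) \<le> 1 / 2"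
proof -
  assume k: "k \<ge> 2"
  have "(2::real) ^ 1 \<le> 2 ^ (k - 1)" using k by (intro power_increasing) auto
  then have "gam k \<le> 2" by (simp add: gam_def field_simps)
  then have "log 2 (gam k) \<le> 1" using gam_gt_1[OF k] by simp
  moreover have "real t + 1 \<le> exp (2 * real t)" using exp_ge_add_one_self[of "2 * real t"] by linarith
  ultimately have "log 2 (gam k) / exp (2 * real t) \<le> 1 / (real t + 1)"
    using gam_gt_1[OF k] by (intro frac_le) auto
  then have "alpha k t \<le> 1 / 2 * (1 / (real t + 1))"
    unfolding alpha_def by (intro mult_left_mono min.coboundedI1) auto
  then have "alpha k t * (real t + 1) \<le> 1 / 2 * (1 / (real t + 1)) * (real t + 1)"
    by (intro mult_right_mono) auto
  also have "\<dots> = 1 / 2" by (simp add: divide_simps)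
  finally show ?thesis .
qed

lemma ex_small_error:
  fixes \<rho> :: real
  assumes "\<rho> > 0"
  obtains \<epsilon> where "0 < \<epsilon>" "\<epsilon> \<le> 1 / 2" "exp (2 * \<epsilon>) + \<epsilon> * exp \<epsilon> \<le> 1 + \<rho>" "1 - \<rho> \<le> (1 - 2 * \<epsilon>) * exp (- \<epsilon>)"
proof -
  have "((\<lambda>\<epsilon>::real. exp (2 * \<epsilon>) + \<epsilon> * exp \<epsilon>) \<longlongrightarrow> 1) (at_right 0)" by real_asymp
  then have "eventually (\<lambda>\<epsilon>. exp (2 * \<epsilon>) + \<epsilon> * exp \<epsilon> < 1 + \<rho>) (at_right 0)"
    using assms by (intro order_tendstoD) auto
  moreover have "((\<lambda>\<epsilon>::real. (1 - 2 * \<epsilon>) * exp (- \<epsilon>)) \<longlongrightarrow> 1) (at_right 0)" by real_asymp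
  then have "eventually (\<lambda>\<epsilon>. 1 - \<rho> < (1 - 2 * \<epsilon>) * exp (- \<epsilon>)) (at_right 0)"
    using assms by (intro order_tendstoD) auto
  moreover have "eventually (\<lambda>\<epsilon>::real. \<epsilon> \<in> {0<..<1 / 2}) (at_right 0)"
    by (intro eventually_at_right_real) auto
  ultimately have "eventually (\<lambda>\<epsilon>. 0 < \<epsilon> \<and> \<epsilon> \<le> 1 / 2 \<and> exp (2 * \<epsilon>) + \<epsilon> * exp \<epsilon> \<le> 1 + \<rho> \<and> 1 - \<rho> \<le> (1 - 2 * \<epsilon>) * exp (- \<epsilon>)) (at_right 0)"
    by eventually_elim auto
  then obtain \<epsilon> where "0 < \<epsilon> \<and> \<epsilon> \<le> 1 / 2 \<and> exp (2 * \<epsilon>) + \<epsilon> * exp \<epsilon> \<le> 1 + \<rho> \<and> 1 - \<rho> \<le> (1 - 2 * \<epsilon>) * exp (- \<epsilon>)"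
    using eventually_happens[of _ "at_right (0::real)"] by auto
  then show ?thesis using that by blast
qed

lemma ex_small_density:
  fixes \<eta> :: real
  assumes "\<eta> > 0"
  obtains \<delta> where "0 < \<delta>" "\<delta> \<le> 1" "\<delta> - \<delta> * ln \<delta> \<le> \<eta>"
proof -
  have "((\<lambda>\<delta>::real. \<delta> - \<delta> * ln \<delta>) \<longlongrightarrow> 0) (at_right 0)" by real_asymp
  then have "eventually (\<lambda>\<delta>. \<delta> - \<delta> * ln \<delta> < \<eta>) (at_right 0)"
    using assms by (intro order_tendstoD) auto
  moreover have "eventually (\<lambda>\<delta>::real. \<delta> \<in> {0<..<1}) (at_right 0)"
    by (intro eventually_at_right_real) auto
  ultimately have "eventually (\<lambda>\<delta>. 0 < \<delta> \<and> \<delta> \<le> 1 \<and> \<delta> - \<delta> * ln \<delta> \<le> \<eta>) (at_right 0)"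
    by eventually_elim auto
  then obtain \<delta> where "0 < \<delta> \<and> \<delta> \<le> 1 \<and> \<delta> - \<delta> * ln \<delta> \<le> \<eta>"
    using eventually_happens[of _ "at_right (0::real)"] by auto
  then show ?thesis using that by blast
qed

lemma eventually_poly_exp_le:
  fixes c e :: real
  assumes "c > 0" "e > 0"
  shows "eventually (\<lambda>r::nat. A * (K * real r ^ 2) ^ p * exp (- c * r) \<le> e) sequentially"
proof -
  have "((\<lambda>x::real. x ^ (2 * p) / exp x) \<longlongrightarrow> 0) at_top" by (rule tendsto_power_div_exp_0)
  moreover have "filterlim (\<lambda>r::nat. c * real r) at_top sequentially"
    using assms(1) filterlim_real_sequentially by (intro filterlim_tendsto_pos_mult_at_top[OF tendsto_const])
  ultimately have "(\<lambda>r::nat. (c * real r) ^ (2 * p) / exp (c * real r)) \<longlonglongrightarrow> 0"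
    by (rule filterlim_compose)
  then have "(\<lambda>r::nat. A * K ^ p / c ^ (2 * p) * ((c * real r) ^ (2 * p) / exp (c * real r))) \<longlonglongrightarrow> A * K ^ p / c ^ (2 * p) * 0"
    by (intro tendsto_mult tendsto_const)
  then have "(\<lambda>r::nat. A * K ^ p / c ^ (2 * p) * ((c * real r) ^ (2 * p) / exp (c * real r))) \<longlonglongrightarrow> 0"
    by simp
  moreover have "A * K ^ p / c ^ (2 * p) * ((c * real r) ^ (2 * p) / exp (c * real r)) = A * (K * real r ^ 2) ^ p * exp (- c * r)" for r
    using assms(1) by (simp add: power_mult_distrib power_mult exp_minus divide_simps)
  ultimately have "(\<lambda>r::nat. A * (K * real r ^ 2) ^ p * exp (- c * r)) \<longlonglongrightarrow> 0" by simp
  then have "eventually (\<lambda>r::nat. A * (K * real r ^ 2) ^ p * exp (- c * r) < e) sequentially"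
    using assms(2) by (rule order_tendstoD(2))
  then show ?thesis by eventually_elim simp
qed

lemma eq_upto_factor_from_estimates:
  fixes A \<Xi> E :: "'z \<Rightarrow> real" and \<epsilon> \<rho> M I :: real
  assumes \<Z>: "finite \<Z>" "\<Z> \<noteq> {}" and M: "M > 0"
    and \<epsilon>: "0 < \<epsilon>" "\<epsilon> \<le> 1 / 2" "exp (2 * \<epsilon>) + \<epsilon> * exp \<epsilon> \<le> 1 + \<rho>" "1 - \<rho> \<le> (1 - 2 * \<epsilon>) * exp (- \<epsilon>)"
    and up: "I \<le> M * (\<Sum>Z\<in>\<Z>. A Z)" and low: "M * (\<Sum>Z\<in>\<Z>. A Z) \<le> I + M * \<epsilon>"
    and Xi: "\<And>Z. Z \<in> \<Z> \<Longrightarrow> \<Xi> Z \<ge> 1" "\<And>Z. Z \<in> \<Z> \<Longrightarrow> \<bar>ln (\<Xi> Z) - E Z\<bar> \<le> \<epsilon>"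
    and A: "\<And>Z. Z \<in> \<Z> \<Longrightarrow> A Z \<le> \<Xi> Z * exp \<epsilon> + \<epsilon>" "\<And>Z. Z \<in> \<Z> \<Longrightarrow> \<Xi> Z \<le> A Z + \<epsilon>"
  shows "eq_upto_factor \<rho> I (M * (\<Sum>Z\<in>\<Z>. exp (E Z)))"
proof -
  let ?T = "\<Sum>Z\<in>\<Z>. exp (E Z)"
  have XE: "\<Xi> Z \<le> exp \<epsilon> * exp (E Z)" "exp (- \<epsilon>) * exp (E Z) \<le> \<Xi> Z" if "Z \<in> \<Z>" for Z
  proof -
    have eq: "\<Xi> Z = exp (ln (\<Xi> Z))" using Xi(1)[OF that] by simp
    have "ln (\<Xi> Z) \<le> \<epsilon> + E Z" "- \<epsilon> + E Z \<le> ln (\<Xi> Z)" using Xi(2)[OF that] by linarith+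
    then have "exp (ln (\<Xi> Z)) \<le> exp (\<epsilon> + E Z)" "exp (- \<epsilon> + E Z) \<le> exp (ln (\<Xi> Z))" by simp_all
    then show "\<Xi> Z \<le> exp \<epsilon> * exp (E Z)" "exp (- \<epsilon>) * exp (E Z) \<le> \<Xi> Z"
      unfolding exp_add eq[symmetric] .
  qed
  have T0: "?T \<ge> 0" by (intro sum_nonneg) auto
  have "(\<Sum>Z\<in>\<Z>. A Z) \<le> (\<Sum>Z\<in>\<Z>. (exp (2 * \<epsilon>) + \<epsilon> * exp \<epsilon>) * exp (E Z))"
  proof (rule sum_mono)
    fix Z assume Z: "Z \<in> \<Z>"
    have "A Z \<le> \<Xi> Z * exp \<epsilon> + \<epsilon> * 1" using A(1)[OF Z] by simp
    also have "\<dots> \<le> \<Xi> Z * exp \<epsilon> + \<epsilon> * \<Xi> Z" using Xi(1)[OF Z] \<epsilon> by (intro add_left_mono mult_left_mono) auto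
    also have "\<dots> = (exp \<epsilon> + \<epsilon>) * \<Xi> Z" by (simp add: algebra_simps)
    also have "\<dots> \<le> (exp \<epsilon> + \<epsilon>) * (exp \<epsilon> * exp (E Z))" using XE(1)[OF Z] \<epsilon> by (intro mult_left_mono) auto
    also have "\<dots> = (exp (2 * \<epsilon>) + \<epsilon> * exp \<epsilon>) * exp (E Z)"
      by (simp add: algebra_simps flip: exp_add)
    finally show "A Z \<le> (exp (2 * \<epsilon>) + \<epsilon> * exp \<epsilon>) * exp (E Z)" .
  qed
  also have "\<dots> = (exp (2 * \<epsilon>) + \<epsilon> * exp \<epsilon>) * ?T" by (simp add: sum_distrib_left)
  also have "\<dots> \<le> (1 + \<rho>) * ?T" using \<epsilon>(3) T0 by (rule mult_right_mono)
  finally have "M * (\<Sum>Z\<in>\<Z>. A Z) \<le> M * ((1 + \<rho>) * ?T)" using M by (intro mult_left_mono) auto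
  then have upper: "I \<le> (1 + \<rho>) * (M * ?T)" using up by (simp add: mult_ac)
  have "(1 - \<rho>) * ?T \<le> (1 - 2 * \<epsilon>) * exp (- \<epsilon>) * ?T" using \<epsilon>(4) T0 by (rule mult_right_mono)
  also have "\<dots> = (1 - 2 * \<epsilon>) * (\<Sum>Z\<in>\<Z>. exp (- \<epsilon>) * exp (E Z))" by (simp add: sum_distrib_left mult.assoc)
  also have "\<dots> \<le> (1 - 2 * \<epsilon>) * (\<Sum>Z\<in>\<Z>. \<Xi> Z)"
    using XE(2) \<epsilon> by (intro mult_left_mono sum_mono) auto
  also have "\<dots> = (\<Sum>Z\<in>\<Z>. \<Xi> Z) - 2 * \<epsilon> * (\<Sum>Z\<in>\<Z>. \<Xi> Z)" by (simp add: algebra_simps)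
  also have "\<dots> \<le> (\<Sum>Z\<in>\<Z>. A Z) - \<epsilon>"
  proof -
    have c1: "real (card \<Z>) \<ge> 1" using \<Z> by (simp add: Suc_leI card_gt_0_iff)
    have "(\<Sum>Z\<in>\<Z>. 1) \<le> (\<Sum>Z\<in>\<Z>. \<Xi> Z)" by (intro sum_mono Xi(1))
    then have "\<epsilon> * real (card \<Z>) \<le> \<epsilon> * (\<Sum>Z\<in>\<Z>. \<Xi> Z)" using \<epsilon> by (intro mult_left_mono) auto
    moreover have "\<epsilon> * 1 \<le> \<epsilon> * real (card \<Z>)" using c1 \<epsilon> by (intro mult_left_mono) auto
    moreover have "(\<Sum>Z\<in>\<Z>. \<Xi> Z) \<le> (\<Sum>Z\<in>\<Z>. A Z + \<epsilon>)" by (intro sum_mono A(2))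
    moreover have "(\<Sum>Z\<in>\<Z>. A Z + \<epsilon>) = (\<Sum>Z\<in>\<Z>. A Z) + \<epsilon> * real (card \<Z>)"
      by (simp add: sum.distrib mult.commute)
    ultimately show ?thesis unfolding mult.assoc by linarith
  qed
  finally have "M * ((1 - \<rho>) * ?T) \<le> M * ((\<Sum>Z\<in>\<Z>. A Z) - \<epsilon>)" using M by (intro mult_left_mono) auto
  then have "(1 - \<rho>) * (M * ?T) \<le> I" using low by (simp add: algebra_simps)
  then show ?thesis using upper by (simp add: eq_upto_factor_def)
qed

theorem theorem2p1:
  fixes k t :: nat and \<beta> :: real and b :: "nat \<Rightarrow> real"
  assumes "k \<ge> 3" and "t \<ge> 1" and "\<beta> > 0" and "b \<in> o(\<lambda>n. real n)"
  shows "\<forall>\<rho>>0. \<exists>n\<^sub>0. \<forall>n\<ge>n\<^sub>0. \<forall>(G :: 'a hypergraph) \<Z> r.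
    uniform_hypergraph k G \<and> partite_with k G \<Z> \<and> regular r G \<and> (\<forall>Z\<in>\<Z>. card Z = n) \<and>
    Reg k n r t \<and> Exp1 k r G \<Z> (alpha k t) \<and> Exp2 k n r G \<Z> \<beta> \<and> Defect G \<Z> (b n) \<longrightarrow>
    eq_upto_factor \<rho> (real (card (indep_sets G)))
      (2 ^ ((k - 1) * n) *
        (\<Sum>Z\<in>\<Z>. exp (\<Sum>m=1..t. \<Sum>\<Gamma> | \<Gamma> \<in> clusters G Z t \<and> cluster_size \<Gamma> = m. cluster_weight G \<Gamma>)))"
proof (intro allI impI)
  fix \<rho> :: real assume "\<rho> > 0"
  then obtain \<epsilon> where \<epsilon>: "0 < \<epsilon>" "\<epsilon> \<le> 1 / 2" "exp (2 * \<epsilon>) + \<epsilon> * exp \<epsilon> \<le> 1 + \<rho>"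
    "1 - \<rho> \<le> (1 - 2 * \<epsilon>) * exp (- \<epsilon>)" by (rule ex_small_error)
  define g where "g = gam k"
  have k2: "k \<ge> 2" using assms(1) by simp
  have g: "g > 1" unfolding g_def by (rule gam_gt_1[OF k2])
  have lng: "ln g > 0" using g by simp
  have "min (ln g * \<beta> ^ 2 / 4) (ln 2 / 4) > 0" using lng assms(3) by simp
  then obtain \<delta> where \<delta>: "0 < \<delta>" "\<delta> \<le> 1" "\<delta> - \<delta> * ln \<delta> \<le> min (ln g * \<beta> ^ 2 / 4) (ln 2 / 4)"
    by (rule ex_small_density)
  have "eventually (\<lambda>r::nat. 8 * exp 1 * (real k * real r ^ 2) ^ 3 * exp (- (ln g / (2 * (real t + 1))) * r) \<le> \<epsilon> / (4 * (real t + 1))) sequentially"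
    using lng \<epsilon> by (intro eventually_poly_exp_le) auto
  moreover have "eventually (\<lambda>r::nat. g ^ t * (real k * real r ^ 2) ^ 2 * exp (- (\<beta> * ln g) * r) \<le> \<epsilon> / 4) sequentially"
    using lng \<epsilon> assms(3) by (intro eventually_poly_exp_le) auto
  moreover have "eventually (\<lambda>r::nat. 1 * (1 * real r ^ 2) ^ 0 * exp (- (ln g / 2 * \<delta>) * r) \<le> 1 / 4) sequentially"
    using lng \<delta> by (intro eventually_poly_exp_le) auto
  moreover have "eventually (\<lambda>r::nat. max t (max 1 (nat \<lceil>2 * (real t + 1) / \<beta>\<rceil>)) \<le> r) sequentially"
    by (rule eventually_ge_at_top)
  ultimately have "eventually (\<lambda>r::nat.
      8 * exp 1 * (real k * real r ^ 2) ^ 3 * exp (- (ln g / (2 * (real t + 1))) * r) \<le> \<epsilon> / (4 * (real t + 1)) \<and>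
      g ^ t * ((real k * real r ^ 2) ^ 2 * exp (- (\<beta> * ln g) * r)) \<le> \<epsilon> / 4 \<and>
      exp (- (ln g / 2 * \<delta>) * r) \<le> 1 / 4 \<and> t \<le> r \<and> 1 \<le> r \<and> 2 * (real t + 1) \<le> \<beta> * r) sequentially"
  proof eventually_elim
    case (elim r)
    have "2 * (real t + 1) / \<beta> \<le> real r" using elim(4) by linarith
    then have "2 * (real t + 1) \<le> \<beta> * r" using assms(3) by (simp add: field_simps)
    with elim show ?case by (simp add: mult.assoc)
  qed
  then obtain r\<^sub>0 where r\<^sub>0: "\<And>r::nat. r \<ge> r\<^sub>0 \<Longrightarrow>
      8 * exp 1 * (real k * real r ^ 2) ^ 3 * exp (- (ln g / (2 * (real t + 1))) * r) \<le> \<epsilon> / (4 * (real t + 1)) \<and>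
      g ^ t * ((real k * real r ^ 2) ^ 2 * exp (- (\<beta> * ln g) * r)) \<le> \<epsilon> / 4 \<and>
      exp (- (ln g / 2 * \<delta>) * r) \<le> 1 / 4 \<and> t \<le> r \<and> 1 \<le> r \<and> 2 * (real t + 1) \<le> \<beta> * r"
    unfolding eventually_sequentially by blast
  have "eventually (\<lambda>n::nat. (1 / 2) ^ n < \<epsilon>) sequentially"
    using \<epsilon> by (intro order_tendstoD[OF LIMSEQ_realpow_zero]) auto
  moreover have "eventually (\<lambda>n::nat. 1 * (1 * real n ^ 2) ^ 0 * exp (- (ln g * \<beta> ^ 2 / 4) * n) \<le> \<epsilon>) sequentially"
    using lng \<epsilon> assms(3) by (intro eventually_poly_exp_le) auto
  moreover have "eventually (\<lambda>n::nat. real k ^ 2 * (1 * real n ^ 2) ^ 0 * exp (- (ln 2 / 2) * n) \<le> \<epsilon>) sequentially"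
    using \<epsilon> by (intro eventually_poly_exp_le) auto
  moreover have "eventually (\<lambda>n::nat. norm (b n) \<le> \<delta> * norm (real n)) sequentially"
    by (rule landau_o.smallD[OF assms(4) \<delta>(1)])
  moreover have "eventually (\<lambda>n::nat. max 2 (nat \<lceil>g powr (real t * real r\<^sub>0)\<rceil>) \<le> n) sequentially"
    by (rule eventually_ge_at_top)
  ultimately have "eventually (\<lambda>n::nat. (1 / 2) ^ n \<le> \<epsilon> \<and> exp (- (ln g * \<beta> ^ 2 / 4) * n) \<le> \<epsilon> \<and>
      real k ^ 2 * exp (- (ln 2 / 2) * n) \<le> \<epsilon> \<and> b n \<le> \<delta> * n \<and> 2 \<le> n \<and> g powr (real t * real r\<^sub>0) \<le> n) sequentially"
  proof eventually_elim
    case (elim n)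
    have "g powr (real t * real r\<^sub>0) \<le> n" using elim(5) by linarith
    with elim show ?case by simp
  qed
  then obtain n\<^sub>0 where n\<^sub>0: "\<And>n::nat. n \<ge> n\<^sub>0 \<Longrightarrow> (1 / 2) ^ n \<le> \<epsilon> \<and> exp (- (ln g * \<beta> ^ 2 / 4) * n) \<le> \<epsilon> \<and>
      real k ^ 2 * exp (- (ln 2 / 2) * n) \<le> \<epsilon> \<and> b n \<le> \<delta> * n \<and> 2 \<le> n \<and> g powr (real t * real r\<^sub>0) \<le> n"
    unfolding eventually_sequentially by blast
  show "\<exists>n\<^sub>0. \<forall>n\<ge>n\<^sub>0. \<forall>(G :: 'a hypergraph) \<Z> r.
    uniform_hypergraph k G \<and> partite_with k G \<Z> \<and> regular r G \<and> (\<forall>Z\<in>\<Z>. card Z = n) \<and>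
    Reg k n r t \<and> Exp1 k r G \<Z> (alpha k t) \<and> Exp2 k n r G \<Z> \<beta> \<and> Defect G \<Z> (b n) \<longrightarrow>
    eq_upto_factor \<rho> (real (card (indep_sets G)))
      (2 ^ ((k - 1) * n) *
        (\<Sum>Z\<in>\<Z>. exp (\<Sum>m=1..t. \<Sum>\<Gamma> | \<Gamma> \<in> clusters G Z t \<and> cluster_size \<Gamma> = m. cluster_weight G \<Gamma>)))"
  proof (intro exI[of _ n\<^sub>0] allI impI, elim conjE)
    fix n r and G :: "'a hypergraph" and \<Z>
    assume n: "n \<ge> n\<^sub>0" and G: "uniform_hypergraph k G" "partite_with k G \<Z>" "regular r G" "\<forall>Z\<in>\<Z>. card Z = n"
      and reg: "Reg k n r t" and E1: "Exp1 k r G \<Z> (alpha k t)" and E2: "Exp2 k n r G \<Z> \<beta>" and df: "Defect G \<Z> (b n)"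
    note N = n\<^sub>0[OF n]
    have n0: "real n > 0" using N by simp
    have t0: "real t > 0" using assms(2) by simp
    have lg: "log g n \<le> real r * real t"
      using reg t0 unfolding Reg_def g_def[symmetric] by (simp add: field_simps)
    have "real t * real r\<^sub>0 \<le> log g n" using N g n0 by (simp add: le_log_iff)
    then have "real t * real r\<^sub>0 \<le> real t * real r" using lg by (simp add: mult.commute)
    then have "r\<^sub>0 \<le> r" using t0 by simp
    note R = r\<^sub>0[OF this]
    have ng: "real n \<le> g powr (real r * real t)" using lg g n0 by (simp add: log_le_iff)
    interpret regular_partite G \<Z> k n r
      using G k2 R by unfold_locales auto
    let ?c = "\<delta> * real n"
    let ?N = "exp (n * (ln 2 / 4))"
    have cardN: "real (card {S. S \<subseteq> Z \<and> real (card S) \<le> ?c}) \<le> ?N" if "Z \<in> \<Z>" for Z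
    proof -
      have "real (card {S. S \<subseteq> Z \<and> real (card S) \<le> ?c}) \<le> exp (n * (\<delta> - \<delta> * ln \<delta>))"
        by (rule card_small_subsets_le[OF finite_part[OF that] part_size[OF that] \<delta>(1,2)])
      also have "\<dots> \<le> ?N" using \<delta>(3) by (subst exp_le_cancel_iff, intro mult_left_mono) auto
      finally show ?thesis .
    qed
    have bc: "b n \<le> ?c" using N by simp
    let ?M = "2 ^ ((k - 1) * n) :: real"
    have up: "card (indep_sets G) \<le> ?M * (\<Sum>Z\<in>\<Z>. partite_class.trace_sum G Z ?c)"
      by (rule card_indep_sets_bounds(1)[OF df bc cardN])
    have overlap: "?M * (\<Sum>Z\<in>\<Z>. partite_class.trace_sum G Z ?c) \<le>
        card (indep_sets G) + real k ^ 2 * (?N ^ 2 * 2 ^ ((k - 2) * n))"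
      by (rule card_indep_sets_bounds(2)[OF df bc cardN])
    have est: "\<bar>ln (partite_class.\<Xi> G Z t) - partite_class.cluster_exponent G Z t\<bar> \<le> \<epsilon>"
      "partite_class.trace_sum G Z ?c \<le> partite_class.\<Xi> G Z t * exp \<epsilon> + \<epsilon>"
      "partite_class.\<Xi> G Z t \<le> partite_class.trace_sum G Z ?c + \<epsilon>"
      "partite_class.\<Xi> G Z t \<ge> 1" if Z: "Z \<in> \<Z>" for Z
    proof -
      interpret partite_class G \<Z> k n r Z by (rule partite_class_of_part[OF Z])
      have a: "alpha k t * (real t + 1) \<le> 1 / 2" by (rule alpha_le[OF k2])
      have "\<delta> - \<delta> * ln \<delta> \<le> ln (gam k) * \<beta> ^ 2 / 4" "\<epsilon> \<le> 1" using \<delta>(3) \<epsilon>(2) by (auto simp: g_def)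
      note class_est = trace_sum_estimates[OF E1 E2 assms(3,2) a _ _ _ _ \<epsilon>(1) this(2) \<delta>(1,2) _ _ _ _ this(1)]
      show "\<bar>ln (\<Xi> t) - cluster_exponent t\<bar> \<le> \<epsilon>" "trace_sum ?c \<le> \<Xi> t * exp \<epsilon> + \<epsilon>" "\<Xi> t \<le> trace_sum ?c + \<epsilon>"
        using N R ng unfolding g_def by (intro class_est; simp)+
      show "\<Xi> t \<ge> 1" by (rule Xi_ge_1)
    qed
    have "real k ^ 2 * (?N ^ 2 * 2 ^ ((k - 2) * n)) \<le> ?M * \<epsilon>"
    proof -
      have N2: "?N ^ 2 = exp (- (ln 2 / 2) * n) * 2 ^ n"
      proof -
        have "(2::real) ^ n = exp (n * ln 2)" by (simp add: exp_of_nat_mult)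
        then show ?thesis by (simp flip: exp_add exp_of_nat_mult add: power2_eq_square)
      qed
      have M: "?M = 2 ^ ((k - 2) * n) * 2 ^ n"
      proof -
        have "(k - 1) * n = (k - 2) * n + n" using k2 by (cases k) (auto simp: algebra_simps Suc_diff_le)
        then show ?thesis by (simp add: power_add)
      qed
      have "real k ^ 2 * (?N ^ 2 * 2 ^ ((k - 2) * n)) = (real k ^ 2 * exp (- (ln 2 / 2) * n)) * ?M"
        unfolding N2 M by (simp only: ac_simps)
      also have "\<dots> \<le> \<epsilon> * ?M" using N by (intro mult_right_mono) auto
      finally show ?thesis by (simp add: mult.commute)
    qed
    then have low: "?M * (\<Sum>Z\<in>\<Z>. partite_class.trace_sum G Z ?c) \<le> card (indep_sets G) + ?M * \<epsilon>"
      using overlap by linarith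
    have "\<Z> \<noteq> {}" using card_parts assms(1) by auto
    have "eq_upto_factor \<rho> (card (indep_sets G)) (?M * (\<Sum>Z\<in>\<Z>. exp (partite_class.cluster_exponent G Z t)))"
      by (rule eq_upto_factor_from_estimates[OF finite_parts \<open>\<Z> \<noteq> {}\<close> _ \<epsilon> up low est(4,1,2,3)]) auto
    moreover have "partite_class.cluster_exponent G Z t =
      (\<Sum>m=1..t. \<Sum>\<Gamma> | \<Gamma> \<in> clusters G Z t \<and> cluster_size \<Gamma> = m. cluster_weight G \<Gamma>)" if "Z \<in> \<Z>" for Z
      by (rule partite_class.cluster_exponent_def[OF partite_class_of_part[OF that]])
    ultimately show "eq_upto_factor \<rho> (real (card (indep_sets G)))
      (2 ^ ((k - 1) * n) *
        (\<Sum>Z\<in>\<Z>. exp (\<Sum>m=1..t. \<Sum>\<Gamma> | \<Gamma> \<in> clusters G Z t \<and> cluster_size \<Gamma> = m. cluster_weight G \<Gamma>)))"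
      by simp
  qed
qed

end
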